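(* For all integers $m\ge 1$ the natural inclusion $$\mathbf{rat}_\infty(m)\hookrightarrow\Omega\mathbf{RP}^m$$ is a homotopy equivalence.
   Context: $\Omega\mathbf{RP}^m$ denotes the space of continuous basepoint-preserving maps $\mathbf{RP}^1\to\mathbf{RP}^m$ (sending $\infty\in\mathbf{RP}^1=\mathbf{R}\cup\{\infty\}$ to the basepoint $[1:1:\cdots:1]$), with the compact-open topology. $\mathrm{RRat}_n(m)$ denotes the space of basepoint-preserving rational maps $\mathbf{CP}^1\to\mathbf{CP}^m$ of degree $n$ (sending $\infty$ to $[1:\cdots:1]$) that commute with complex conjugation. Equivalently, its elements are the maps $x\mapsto[f_0(x):\cdots:f_m(x)]$ where $f_0,\dots,f_m$ are monic polynomials of degree $n$ with real coefficients having no common zero in $\mathbf{C}$. Such a map is uniquely determined by its restriction to the real axis $\mathbf{RP}^1\to\mathbf{RP}^m$, so restriction gives an inclusion of sets $\mathrm{RRat}_n(m)\subset\Omega\mathbf{RP}^m$. The space $\mathbf{rat}_n(m)$ is defined as the closure of (the image of) $\mathrm{RRat}_n(m)$ in $\Omega\mathbf{RP}^m$, with the subspace topology. One has $\mathbf{rat}_n(m)\subset\mathbf{rat}_{n+2}(m)$ as subspaces of $\Omega\mathbf{RP}^m$; let $i_n$ denote this inclusion. $\mathbf{rat}_{\mathrm{odd}}(m)$ is the direct limit (with the direct limit topology) of $\mathbf{rat}_1(m)\xrightarrow{i_1}\mathbf{rat}_3(m)\xrightarrow{i_3}\cdots$, $\mathbf{rat}_{\mathrm{ev}}(m)$ is the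 analogous direct limit over even $n$, and $\mathbf{rat}_\infty(m)$ is the disjoint union $\mathbf{rat}_{\mathrm{odd}}(m)\sqcup\mathbf{rat}_{\mathrm{ev}}(m)$. The natural inclusion into $\Omega\mathbf{RP}^m$ is the one induced by the inclusions $\mathbf{rat}_n(m)\subset\Omega\mathbf{RP}^m$. *)

theory Defs
  imports "HOL-Analysis.Analysis" "HOL-Computational_Algebra.Polynomial"
begin

section \<open>General topological constructions\<close>

definition quotient_topology :: "'a topology \<Rightarrow> ('a \<Rightarrow> 'b) \<Rightarrow> 'b topology" where
  "quotient_topology X q =
     topology (\<lambda>U. U \<subseteq> q ` topspace X \<and> openin X {x \<in> topspace X. q x \<in> U})"

lemma openin_quotient_topology:
  "openin (quotient_topology X q) U \<longleftrightarrow>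
     U \<subseteq> q ` topspace X \<and> openin X {x \<in> topspace X. q x \<in> U}"
proof -
  have Int: "{x \<in> topspace X. q x \<in> S \<inter> T} = {x \<in> topspace X. q x \<in> S} \<inter> {x \<in> topspace X. q x \<in> T}"
    for S T by auto
  have Un: "{x \<in> topspace X. q x \<in> \<Union>\<K>} = (\<Union>K\<in>\<K>. {x \<in> topspace X. q x \<in> K})" for \<K>
    by auto
  have "istopology (\<lambda>U. U \<subseteq> q ` topspace X \<and> openin X {x \<in> topspace X. q x \<in> U})"
    unfolding istopology_def Int Un by blast
  then show ?thesis
    by (simp add: quotient_topology_def)
qed

lemma topspace_quotient_topology [simp]:
  "topspace (quotient_topology X q) = q ` topspace X"
proof
  show "topspace (quotient_topology X q) \<subseteq> q ` topspace X"
    by (metis openin_quotient_topology openin_topspace)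
  have "{x \<in> topspace X. q x \<in> q ` topspace X} = topspace X"
    by auto
  then have "openin (quotient_topology X q) (q ` topspace X)"
    by (simp add: openin_quotient_topology)
  then show "q ` topspace X \<subseteq> topspace (quotient_topology X q)"
    by (rule openin_subset)
qed

lemma quotient_map_quotient_topology: "quotient_map X (quotient_topology X q) q"
  by (auto simp: quotient_map_def openin_quotient_topology)

text \<open>
  The direct limit of a chain of spaces whose bonding maps are inclusions: the disjoint union
  modulo identification of each point with its images further up the chain, so the
  underlying set is the union of the chain.
\<close>

definition direct_limit :: "('i \<Rightarrow> 'a topology) \<Rightarrow> 'i set \<Rightarrow> 'a topology" where
  "direct_limit X I = quotient_topology (sum_topology X I) snd"

lemma topspace_direct_limit [simp]:
  "topspace (direct_limit X I) = (\<Union>i\<in>I. topspace (X i))"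
  by (force simp: direct_limit_def)

lemma openin_direct_limit:
  "openin (direct_limit X I) U \<longleftrightarrow>
     U \<subseteq> (\<Union>i\<in>I. topspace (X i)) \<and> (\<forall>i\<in>I. openin (X i) (topspace (X i) \<inter> U))"
proof -
  have img: "snd ` Sigma I (topspace \<circ> X) = (\<Union>i\<in>I. topspace (X i))"
    by force
  have fib: "{x. (i, x) \<in> {p \<in> Sigma I (topspace \<circ> X). snd p \<in> U}} = topspace (X i) \<inter> U"
    if "i \<in> I" for i using that by auto
  show ?thesis
    unfolding direct_limit_def openin_quotient_topology openin_sum_topology
      topspace_sum_topology img
    using fib by auto
qed

text \<open>
  Functions are required to be \<^const>\<open>extensional\<close>, so that two maps that
  agree on the domain are equal.
\<close>

definition compact_open_topology :: "'a topology \<Rightarrow> 'b topology \<Rightarrow> ('a \<Rightarrow> 'b) topology" where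
  "compact_open_topology X Y =
     topology_generated_by
       {{f \<in> extensional (topspace X). continuous_map X Y f \<and> f ` K \<subseteq> U} | K U.
          compactin X K \<and> openin Y U}"

lemma topspace_compact_open_topology [simp]:
  "topspace (compact_open_topology X Y) =
     {f \<in> extensional (topspace X). continuous_map X Y f}"
proof -
  have "{f \<in> extensional (topspace X). continuous_map X Y f} \<in>
     {{f \<in> extensional (topspace X). continuous_map X Y f \<and> f ` K \<subseteq> U} | K U.
          compactin X K \<and> openin Y U}"
    by (rule CollectI, rule exI[of _ "{}"], rule exI[of _ "{}"]) auto
  then show ?thesis
    unfolding compact_open_topology_def topology_generated_by_topspace by auto
qed

text \<open>This unfolds \<^const>\<open>homotopy_equivalent_space\<close> for a specified map.\<close>

definition homotopy_equivalence :: "'a topology \<Rightarrow> 'b topology \<Rightarrow> ('a \<Rightarrow> 'b) \<Rightarrow> bool" where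
  "homotopy_equivalence X Y f \<longleftrightarrow>
     continuous_map X Y f \<and>
     (\<exists>g. continuous_map Y X g \<and>
          homotopic_with (\<lambda>x. True) X X (g \<circ> f) id \<and>
          homotopic_with (\<lambda>x. True) Y Y (f \<circ> g) id)"

section \<open>Real projective space and its loop space\<close>

text \<open>A point of projective space is a line through the origin with the origin removed.\<close>

definition proj_class :: "(nat \<Rightarrow> real) \<Rightarrow> (nat \<Rightarrow> real) set" where
  "proj_class v = {\<lambda>i. c * v i | c. c \<noteq> 0}"

definition RP :: "nat \<Rightarrow> (nat \<Rightarrow> real) set topology" where
  "RP m = quotient_topology (subtopology (Euclidean_space (Suc m)) (- {\<lambda>_. 0})) proj_class"

text \<open>The point $[v_0 : \dots : v_m]$; coordinates of \<open>v\<close> beyond \<open>m\<close> are discarded.\<close>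

definition hpoint :: "nat \<Rightarrow> (nat \<Rightarrow> real) \<Rightarrow> (nat \<Rightarrow> real) set" where
  "hpoint m v = proj_class (\<lambda>i. if i \<le> m then v i else 0)"

text \<open>$\mathbf{RP}^1 = \mathbf{R} \cup \{\infty\}$ with $x = [x : 1]$ and $\infty = [1 : 0]$.\<close>

definition RP1_real :: "real \<Rightarrow> (nat \<Rightarrow> real) set" where
  "RP1_real x = hpoint 1 (\<lambda>i. if i = 0 then x else 1)"

definition RP1_infinity :: "(nat \<Rightarrow> real) set" where
  "RP1_infinity = hpoint 1 (\<lambda>i. if i = 0 then 1 else 0)"

definition Omega_RP :: "nat \<Rightarrow> ((nat \<Rightarrow> real) set \<Rightarrow> (nat \<Rightarrow> real) set) topology" where
  "Omega_RP m =
     subtopology (compact_open_topology (RP 1) (RP m))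
       {\<phi>. \<phi> RP1_infinity = hpoint m (\<lambda>_. 1)}"

section \<open>Spaces of rational maps and their stabilization\<close>

text \<open>
  A map is identified with its restriction to the real axis.  The value at infinity is
  prescribed by membership in \<^const>\<open>Omega_RP\<close>; continuity there is automatic, because the
  polynomials are monic of the same degree.
\<close>

definition RRat :: "nat \<Rightarrow> nat \<Rightarrow> ((nat \<Rightarrow> real) set \<Rightarrow> (nat \<Rightarrow> real) set) set" where
  "RRat n m =
     {\<phi> \<in> topspace (Omega_RP m).
        \<exists>f :: nat \<Rightarrow> real poly.
          (\<forall>i\<le>m. degree (f i) = n \<and> lead_coeff (f i) = 1) \<and>
          \<not> (\<exists>z::complex. \<forall>i\<le>m. poly (map_poly of_real (f i)) z = 0) \<and>
          (\<forall>x. \<phi> (RP1_real x) = hpoint m (\<lambda>i. poly (f i) x))}"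

definition rat :: "nat \<Rightarrow> nat \<Rightarrow> ((nat \<Rightarrow> real) set \<Rightarrow> (nat \<Rightarrow> real) set) topology" where
  "rat n m = subtopology (Omega_RP m) (Omega_RP m closure_of RRat n m)"

definition rat_odd :: "nat \<Rightarrow> ((nat \<Rightarrow> real) set \<Rightarrow> (nat \<Rightarrow> real) set) topology" where
  "rat_odd m = direct_limit (\<lambda>n. rat n m) {n. odd n}"

definition rat_ev :: "nat \<Rightarrow> ((nat \<Rightarrow> real) set \<Rightarrow> (nat \<Rightarrow> real) set) topology" where
  "rat_ev m = direct_limit (\<lambda>n. rat n m) {n. even n}"

text \<open>The summand over \<open>True\<close> is the odd part, the one over \<open>False\<close> the even part.\<close>

definition rat_infinity ::
    "nat \<Rightarrow> (bool \<times> ((nat \<Rightarrow> real) set \<Rightarrow> (nat \<Rightarrow> real) set)) topology" where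
  "rat_infinity m = sum_topology (\<lambda>b. if b then rat_odd m else rat_ev m) UNIV"

text \<open>The underlying sets of both limits lie in \<^const>\<open>Omega_RP\<close>, so forgetting the summand is
  the map induced by the inclusions of the individual spaces.\<close>

definition rat_inclusion ::
    "bool \<times> ((nat \<Rightarrow> real) set \<Rightarrow> (nat \<Rightarrow> real) set) \<Rightarrow> ((nat \<Rightarrow> real) set \<Rightarrow> (nat \<Rightarrow> real) set)"
  where "rat_inclusion = snd"

end

theory Submission
  imports Defs
begin

text \<open>
  Two lines \<open>[u]\<close>, \<open>[v]\<close> that are not orthogonal are joined by the path
  \<open>[(1 - t) (u \<bullet> v) u + t (u \<bullet> u) v]\<close>. It does not depend on the representatives, and it is polynomial in
  \<open>u\<close> and \<open>v\<close>; so if two pointwise non-orthogonal loops are rational of degrees \<open>k\<close> and \<open>n\<close>, then the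
  homotopy between them consists of rational loops of degree \<open>2 k + n\<close>. Common complex zeros of the
  polynomials are harmless, because a small perturbation removes them and \<open>rat\<close> is a closure.

  By lifting to the sphere and the Stone-Weierstrass theorem, countably many rational loops (those with
  rational coefficients) suffice to approximate every loop. Blending them with a locally finite family of
  continuous weights gives a continuous map \<open>blend\<close> from the loop space to itself. Locally its values are
  rational of one fixed degree, and \<open>blend \<phi>\<close> is nowhere orthogonal to \<open>\<phi>\<close>. The blended summands add up without
  cancellation: two approximations of the same loop are nowhere orthogonal, so their inner product
  has constant sign and their degrees have the same parity, as a polynomial of odd degree has a root. The
  path above from \<open>blend \<phi>\<close> to \<open>\<phi>\<close> is then a homotopy on the loop space as well as on the direct limits.
\<close>

section \<open>Compact-open topology\<close>

text \<open>The space \<open>rat_infinity m\<close> carries the limit topology, which may be finer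
  than the one induced from the loop space. A map into it is shown to be continuous by landing
  locally in a single stage \<open>rat N m\<close>; this is why the blend must have one fixed degree
  near every loop, and hence why its weights must be locally finite. A map out of it is tested on
  the stages, even after taking the product with the interval, because the interval is locally
  compact. Adding rational loops requires their vectors to agree in sign, although a point of
  projective space has no sign. The base point supplies one: all monic tuples take the value (1,
  ..., 1) at infinity, and an inner product without zeros keeps the positive sign that it has
  there.\<close>

lemma continuous_map_locally:
  assumes "\<And>x. x \<in> topspace X \<Longrightarrow>
             \<exists>U. openin X U \<and> x \<in> U \<and> continuous_map (subtopology X U) Y f"
  shows "continuous_map X Y f"
proof -
  define I where "I = {U. openin X U \<and> continuous_map (subtopology X U) Y f}"
  show ?thesis
    by (rule pasting_lemma[where I = I and T = "\<lambda>U. U" and f = "\<lambda>_. f"])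
       (use assms in \<open>auto simp: I_def\<close>)
qed

text \<open>The tube lemma in quantifier form: it makes a condition imposed along the whole compact
  circle an open condition on the loop.\<close>

lemma openin_forall_compact:
  assumes "openin (prod_topology Z K) W" "compactin K C"
  shows "openin Z {z \<in> topspace Z. \<forall>x\<in>C. (z, x) \<in> W}"
proof (subst openin_subopen, intro ballI)
  fix z assume z: "z \<in> {z \<in> topspace Z. \<forall>x\<in>C. (z, x) \<in> W}"
  then have "{z} \<times> C \<subseteq> W" "z \<in> topspace Z" by auto
  then obtain U V where "openin Z U" "openin K V" "z \<in> U" "C \<subseteq> V" "U \<times> V \<subseteq> W"
    using tube_lemma_right[OF assms] by metis
  then show "\<exists>T. openin Z T \<and> z \<in> T \<and> T \<subseteq> {z \<in> topspace Z. \<forall>x\<in>C. (z, x) \<in> W}"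
    using openin_subset[of Z U] by (intro exI[of _ U]) auto
qed

text \<open>The currying half of the exponential law; the other half is
  \<open>continuous_map_compact_open_eval\<close>.\<close>

lemma continuous_map_into_compact_open:
  assumes cont: "continuous_map (prod_topology Z K) Y (\<lambda>(z, x). f z x)"
    and ext: "\<And>z. z \<in> topspace Z \<Longrightarrow> f z \<in> extensional (topspace K)"
  shows "continuous_map Z (compact_open_topology K Y) f"
proof -
  have cz: "continuous_map K Y (f z)" if "z \<in> topspace Z" for z
  proof -
    have "continuous_map K (prod_topology Z K) (\<lambda>x. (z, x))"
      using that by (intro continuous_map_pairedI) auto
    from continuous_map_compose[OF this cont] show ?thesis
      by (simp add: o_def)
  qed
  show ?thesis
    unfolding compact_open_topology_def
  proof (rule continuous_on_generated_topo)
    fix A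
    assume "A \<in> {{f \<in> extensional (topspace K). continuous_map K Y f \<and> f ` C \<subseteq> U} | C U.
          compactin K C \<and> openin Y U}"
    then obtain C U where A: "A = {f \<in> extensional (topspace K). continuous_map K Y f \<and> f ` C \<subseteq> U}"
      and C: "compactin K C" and U: "openin Y U" by blast
    have *: "openin (prod_topology Z K) {p \<in> topspace (prod_topology Z K). (case p of (z, x) \<Rightarrow> f z x) \<in> U}"
      using openin_continuous_map_preimage[OF cont U] .
    have "f -` A \<inter> topspace Z = {z \<in> topspace Z. \<forall>x\<in>C.
        (z, x) \<in> {p \<in> topspace (prod_topology Z K). (case p of (z, x) \<Rightarrow> f z x) \<in> U}}"
      using compactin_subset_topspace[OF C] cz ext unfolding A by auto
    then show "openin Z (f -` A \<inter> topspace Z)"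
      using openin_forall_compact[OF * C] by simp
  next
    \<comment> \<open>With both sets empty, the whole function space is itself a subbasic
      set.\<close>
    have "{f \<in> extensional (topspace K). continuous_map K Y f} \<in>
      {{f \<in> extensional (topspace K). continuous_map K Y f \<and> f ` C \<subseteq> U} | C U.
          compactin K C \<and> openin Y U}"
      by (rule CollectI, rule exI[of _ "{}"], rule exI[of _ "{}"]) auto
    then show "f ` topspace Z \<subseteq> \<Union> {{f \<in> extensional (topspace K). continuous_map K Y f \<and> f ` C \<subseteq> U} | C U.
          compactin K C \<and> openin Y U}"
      using cz ext by blast
  qed
qed

text \<open>Evaluation is continuous because a compact Hausdorff space has a base of compact
  neighbourhoods, and each of them yields a subbasic set of maps.\<close>

lemma continuous_map_compact_open_eval:
  assumes "compact_space K" "Hausdorff_space K"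
  shows "continuous_map (prod_topology (compact_open_topology K Y) K) Y (\<lambda>(f, x). f x)"
  unfolding continuous_map_def
proof (intro conjI allI impI)
  show "(\<lambda>(f, x). f x) \<in> topspace (prod_topology (compact_open_topology K Y) K) \<rightarrow> topspace Y"
    by (auto dest: continuous_map_image_subset_topspace)
next
  fix U assume U: "openin Y U"
  have nb: "neighbourhood_base_of (compactin K) K"
    using assms compact_imp_locally_compact_space locally_compact_space_neighbourhood_base by blast
  show "openin (prod_topology (compact_open_topology K Y) K)
     {p \<in> topspace (prod_topology (compact_open_topology K Y) K). (case p of (f, x) \<Rightarrow> f x) \<in> U}"
  proof (subst openin_subopen, clarify)
    fix f x
    assume "(f, x) \<in> topspace (prod_topology (compact_open_topology K Y) K)" and fx: "f x \<in> U"
    then have f: "f \<in> extensional (topspace K)" "continuous_map K Y f" and x: "x \<in> topspace K" by auto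
    have "openin K {y \<in> topspace K. f y \<in> U}"
      using openin_continuous_map_preimage[OF f(2) U] .
    then obtain V C where V: "openin K V" "compactin K C" "x \<in> V" "V \<subseteq> C"
      "C \<subseteq> {y \<in> topspace K. f y \<in> U}"
      using nb x fx unfolding neighbourhood_base_of by (metis (mono_tags, lifting) mem_Collect_eq)
    define A where "A = {f \<in> extensional (topspace K). continuous_map K Y f \<and> f ` C \<subseteq> U}"
    have "openin (compact_open_topology K Y) A"
      unfolding compact_open_topology_def A_def
      by (rule topology_generated_by_Basis) (use V(2) U in blast)
    moreover have "A \<times> V \<subseteq> {p \<in> topspace (prod_topology (compact_open_topology K Y) K).
        (case p of (f, x) \<Rightarrow> f x) \<in> U}"
      using V by (auto simp: A_def)
    moreover have "(f, x) \<in> A \<times> V" using V f by (auto simp: A_def)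
    ultimately show "\<exists>T. openin (prod_topology (compact_open_topology K Y) K) T \<and> (f, x) \<in> T \<and>
        T \<subseteq> {p \<in> topspace (prod_topology (compact_open_topology K Y) K). (case p of (f, x) \<Rightarrow> f x) \<in> U}"
      using V(1) by (intro exI[of _ "A \<times> V"]) (simp add: openin_prod_Times_iff)
  qed
qed

text \<open>A lower bound on the infimum is a universal condition over a compact space, so the tube
  lemma applies. An upper bound is existential, and projections are open.\<close>

lemma continuous_map_INF_compact:
  fixes F :: "'a \<Rightarrow> 'b \<Rightarrow> real"
  assumes cont: "continuous_map (prod_topology Z K) euclideanreal (\<lambda>(z, x). F z x)"
    and K: "compact_space K" "topspace K \<noteq> {}"
    and nonneg: "\<And>z x. z \<in> topspace Z \<Longrightarrow> x \<in> topspace K \<Longrightarrow> F z x \<ge> 0"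
  shows "continuous_map Z euclideanreal (\<lambda>z. INF x\<in>topspace K. F z x)"
  unfolding continuous_map_upper_lower_semicontinuous_lt
proof (intro conjI allI)
  fix a
  have bdd: "bdd_below (F z ` topspace K)" if "z \<in> topspace Z" for z
    using nonneg[OF that] by (intro bdd_belowI[of _ 0]) auto
  have op: "openin (prod_topology Z K) {p \<in> topspace (prod_topology Z K). (case p of (z, x) \<Rightarrow> F z x) > b}"
     "openin (prod_topology Z K) {p \<in> topspace (prod_topology Z K). (case p of (z, x) \<Rightarrow> F z x) < b}" for b
    using cont unfolding continuous_map_upper_lower_semicontinuous_lt by blast+
  have o1: "openin Z {z \<in> topspace Z. \<forall>x\<in>topspace K. F z x > b}" for b
    using openin_forall_compact[OF op(1)[of b], of "topspace K"] K(1)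
    by (simp add: compact_space_def cong: conj_cong)
  \<comment> \<open>Values above \<open>a\<close> at all points only give an infimum of at least
    \<open>a\<close>; the gap between \<open>a\<close> and \<open>b\<close> restores
    strictness.\<close>
  have "{z \<in> topspace Z. a < (INF x\<in>topspace K. F z x)} =
      (\<Union>b\<in>{b. b > a}. {z \<in> topspace Z. \<forall>x\<in>topspace K. F z x > b})" (is "?L = ?R")
  proof (intro equalityI subsetI)
    fix z assume z: "z \<in> ?L"
    then obtain b where b: "a < b" "b < (INF x\<in>topspace K. F z x)"
      using dense by auto
    then have "\<forall>x\<in>topspace K. F z x > b"
      using z cINF_lower[OF bdd, of z] by (metis (mono_tags, lifting) mem_Collect_eq order_less_le_trans)
    then show "z \<in> ?R" using b z by auto
  next
    fix z assume "z \<in> ?R"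
    then obtain b where b: "a < b" "z \<in> topspace Z" "\<forall>x\<in>topspace K. F z x > b" by auto
    then have "b \<le> (INF x\<in>topspace K. F z x)"
      by (intro cINF_greatest) (use K in auto)
    then show "z \<in> ?L" using b by auto
  qed
  then show "openin Z {z \<in> topspace Z. a < (INF x\<in>topspace K. F z x)}"
    using o1 by auto
  have "openin Z (fst ` {p \<in> topspace (prod_topology Z K). (case p of (z, x) \<Rightarrow> F z x) < a})"
    using open_map_fst[of Z K] op(2)[of a] unfolding open_map_def by blast
  moreover have "fst ` {p \<in> topspace (prod_topology Z K). (case p of (z, x) \<Rightarrow> F z x) < a} =
     {z \<in> topspace Z. (INF x\<in>topspace K. F z x) < a}"
    using cINF_less_iff[OF K(2) bdd] by (force simp: image_iff)
  ultimately show "openin Z {z \<in> topspace Z. (INF x\<in>topspace K. F z x) < a}" by simp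
qed

text \<open>Products of quotient maps need not be quotient maps, but products of open surjections
  are. Continuity descends to pairs of projective points in this way.\<close>

lemma open_map_Times:
  assumes "open_map X X' f" "open_map Y Y' g"
  shows "open_map (prod_topology X Y) (prod_topology X' Y') (\<lambda>(x, y). (f x, g y))"
  unfolding open_map_def
proof (intro allI impI)
  fix U assume U: "openin (prod_topology X Y) U"
  show "openin (prod_topology X' Y') ((\<lambda>(x, y). (f x, g y)) ` U)"
  proof (subst openin_subopen, clarify)
    fix x y assume "(x, y) \<in> U"
    then obtain A B where AB: "openin X A" "openin Y B" "x \<in> A" "y \<in> B" "A \<times> B \<subseteq> U"
      using U unfolding openin_prod_topology_alt by metis
    have "openin X' (f ` A)" "openin Y' (g ` B)"
      using assms AB unfolding open_map_def by blast+
    moreover have "f ` A \<times> g ` B \<subseteq> (\<lambda>(x, y). (f x, g y)) ` U"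
      using AB(5) by force
    ultimately show "\<exists>T. openin (prod_topology X' Y') T \<and> (f x, g y) \<in> T \<and> T \<subseteq> (\<lambda>(x, y). (f x, g y)) ` U"
      using AB by (intro exI[of _ "f ` A \<times> g ` B"]) (simp add: openin_prod_Times_iff)
  qed
qed

section \<open>Projective space\<close>

(* Otherwise RP 1 and nzvec 1 are rewritten to RP (Suc 0) and nzvec (Suc 0). *)
declare One_nat_def [simp del]

definition ip :: "nat \<Rightarrow> (nat \<Rightarrow> real) \<Rightarrow> (nat \<Rightarrow> real) \<Rightarrow> real" where
  "ip m u v = (\<Sum>i\<le>m. u i * v i)"

definition nzvec :: "nat \<Rightarrow> (nat \<Rightarrow> real) topology" where
  "nzvec m = subtopology (Euclidean_space (Suc m)) (- {\<lambda>_. 0})"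

lemma topspace_nzvec: "topspace (nzvec m) = {v. (\<forall>i>m. v i = 0) \<and> v \<noteq> (\<lambda>_. 0)}"
  by (auto simp: nzvec_def topspace_Euclidean_space Suc_le_eq)

lemma continuous_map_nzvec_coord: "continuous_map (nzvec m) euclideanreal (\<lambda>v. v i)"
  unfolding nzvec_def Euclidean_space_def
  by (intro continuous_map_from_subtopology continuous_map_product_projection) simp

lemma continuous_map_into_nzvec:
  assumes "\<And>i. continuous_map Z euclideanreal (\<lambda>z. L z i)"
    and "\<And>z. z \<in> topspace Z \<Longrightarrow> L z \<in> topspace (nzvec m)"
  shows "continuous_map Z (nzvec m) L"
  unfolding nzvec_def Euclidean_space_def
  using assms
  by (auto simp: continuous_map_in_subtopology continuous_map_componentwise_UNIV topspace_nzvec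
      topspace_Euclidean_space Suc_le_eq)

lemma ip_commute: "ip m u v = ip m v u"
  by (simp add: ip_def mult.commute)

lemma ip_scale [simp]: "ip m (\<lambda>i. c * u i) v = c * ip m u v" "ip m u (\<lambda>i. c * v i) = c * ip m u v"
  by (simp_all add: ip_def sum_distrib_left mult_ac)

lemma ip_add: "ip m (\<lambda>i. u i + v i) w = ip m u w + ip m v w"
   "ip m w (\<lambda>i. u i + v i) = ip m w u + ip m w v"
  by (simp_all add: ip_def sum.distrib algebra_simps)

lemma ip_diff: "ip m (\<lambda>i. u i - v i) w = ip m u w - ip m v w"
   "ip m w (\<lambda>i. u i - v i) = ip m w u - ip m w v"
  by (simp_all add: ip_def sum_subtractf algebra_simps)

lemma ip_sum: "ip m (\<lambda>i. \<Sum>k\<in>A. f k i) w = (\<Sum>k\<in>A. ip m (f k) w)"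
  unfolding ip_def sum_distrib_right by (rule sum.swap)

lemma ip_self_nonneg [simp]: "ip m u u \<ge> 0"
  by (simp add: ip_def sum_nonneg)

lemma ip_self_pos: "u \<in> topspace (nzvec m) \<Longrightarrow> ip m u u > 0"
proof -
  assume u: "u \<in> topspace (nzvec m)"
  then obtain i where i: "u i \<noteq> 0" "i \<le> m"
    by (force simp: topspace_nzvec simp flip: not_le)
  show ?thesis
    unfolding ip_def
  proof (rule sum_pos2[where i = i])
    show "0 < u i * u i" using i(1) not_real_square_gt_zero by blast
  qed (use i in auto)
qed

lemma Cauchy_Schwarz_ip: "(ip m u v)\<^sup>2 \<le> ip m u u * ip m v v"
  using Cauchy_Schwarz_ineq_sum[of u v "{..m}"] by (simp add: ip_def power2_eq_square)

lemma continuous_map_ip: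
  assumes "\<And>i. continuous_map Z euclideanreal (\<lambda>z. f z i)" "\<And>i. continuous_map Z euclideanreal (\<lambda>z. g z i)"
  shows "continuous_map Z euclideanreal (\<lambda>z. ip m (f z) (g z))"
  unfolding ip_def by (intro continuous_intros assms) auto

lemma proj_class_eq_iff: "proj_class u = proj_class v \<longleftrightarrow> (\<exists>c. c \<noteq> 0 \<and> u = (\<lambda>i. c * v i))"
proof
  assume "proj_class u = proj_class v"
  moreover have "u \<in> proj_class u"
    unfolding proj_class_def by (intro CollectI exI[of _ 1]) auto
  ultimately show "\<exists>c. c \<noteq> 0 \<and> u = (\<lambda>i. c * v i)" by (auto simp: proj_class_def)
next
  assume "\<exists>c. c \<noteq> 0 \<and> u = (\<lambda>i. c * v i)"
  then obtain c where c: "c \<noteq> 0" "u = (\<lambda>i. c * v i)" by blast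
  have "\<exists>d'. (\<lambda>i. d * u i) = (\<lambda>i. d' * v i) \<and> d' \<noteq> 0" if "d \<noteq> 0" for d
    by (rule exI[of _ "d * c"]) (use that c in auto)
  moreover have "\<exists>d'. (\<lambda>i. d * v i) = (\<lambda>i. d' * u i) \<and> d' \<noteq> 0" if "d \<noteq> 0" for d
    by (rule exI[of _ "d / c"]) (use that c in auto)
  ultimately show "proj_class u = proj_class v" unfolding proj_class_def by auto
qed

lemma topspace_RP: "topspace (RP m) = proj_class ` topspace (nzvec m)"
  by (simp add: RP_def nzvec_def)

lemma continuous_map_proj_class: "continuous_map (nzvec m) (RP m) proj_class"
  using quotient_map_quotient_topology quotient_imp_continuous_map
  unfolding RP_def nzvec_def by blast

text \<open>The saturation of an open set is the union of its multiples by nonzero scalars, each of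
  which is open.\<close>

lemma open_map_proj_class: "open_map (nzvec m) (RP m) proj_class"
  unfolding open_map_def
proof (intro allI impI)
  fix U assume U: "openin (nzvec m) U"
  have "{v \<in> topspace (nzvec m). proj_class v \<in> proj_class ` U} =
        (\<Union>c\<in>- {0}. {v \<in> topspace (nzvec m). (\<lambda>i. c * v i) \<in> U})" (is "?L = ?R")
  proof (intro equalityI subsetI)
    fix v assume "v \<in> ?L"
    then obtain u where u: "u \<in> U" "proj_class u = proj_class v" "v \<in> topspace (nzvec m)" by auto
    then show "v \<in> ?R" unfolding proj_class_eq_iff by auto
  next
    fix v assume "v \<in> ?R"
    then obtain c where c: "c \<noteq> 0" "(\<lambda>i. c * v i) \<in> U" "v \<in> topspace (nzvec m)" by auto
    have "proj_class (\<lambda>i. c * v i) = proj_class v"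
      unfolding proj_class_eq_iff using c by blast
    then have "proj_class v \<in> proj_class ` U" using imageI[OF c(2), of proj_class] by simp
    then show "v \<in> ?L" using c by blast
  qed
  moreover have "openin (nzvec m) {v \<in> topspace (nzvec m). (\<lambda>i. c * v i) \<in> U}" if "c \<noteq> 0" for c
  proof (rule openin_continuous_map_preimage[OF _ U])
    show "continuous_map (nzvec m) (nzvec m) (\<lambda>v i. c * v i)"
      by (rule continuous_map_into_nzvec)
         (use that in \<open>auto intro!: continuous_intros continuous_map_nzvec_coord simp: topspace_nzvec fun_eq_iff\<close>)
  qed
  ultimately have "openin (nzvec m) {v \<in> topspace (nzvec m). proj_class v \<in> proj_class ` U}"
    by (simp only:) (intro openin_Union, auto)
  moreover have "proj_class ` U \<subseteq> proj_class ` topspace (nzvec m)"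
    using openin_subset[OF U] by blast
  ultimately show "openin (RP m) (proj_class ` U)"
    unfolding RP_def openin_quotient_topology nzvec_def by blast
qed

text \<open>An arbitrary choice, with no continuity. Functions of lines are written with
  \<open>rep\<close>, shown to be independent of scaling, and then proved continuous on vectors,
  through the quotient map.\<close>

definition rep :: "(nat \<Rightarrow> real) set \<Rightarrow> nat \<Rightarrow> real" where
  "rep l = (SOME v. v \<in> l)"

lemma rep_proj_class: "\<exists>c. c \<noteq> 0 \<and> rep (proj_class v) = (\<lambda>i. c * v i)"
proof -
  have "v \<in> proj_class v" unfolding proj_class_def by (intro CollectI exI[of _ 1]) simp
  then have "rep (proj_class v) \<in> proj_class v" unfolding rep_def by (rule someI[of "\<lambda>u. u \<in> proj_class v"])
  then show ?thesis by (auto simp: proj_class_def)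
qed

lemma rep:
  assumes "l \<in> topspace (RP m)"
  shows "rep l \<in> topspace (nzvec m)" "proj_class (rep l) = l"
proof -
  obtain v where v: "v \<in> topspace (nzvec m)" "l = proj_class v"
    using assms topspace_RP by auto
  obtain c where c: "c \<noteq> 0" "rep l = (\<lambda>i. c * v i)" using rep_proj_class[of v] v by auto
  show "proj_class (rep l) = l" using c v(2) by (simp add: proj_class_eq_iff) blast
  show "rep l \<in> topspace (nzvec m)" using c v by (auto simp: topspace_nzvec fun_eq_iff)
qed

text \<open>The squared cosine of the angle between two lines. Unlike the inner product it does not
  change with the representatives, so it measures distance in projective space.\<close>

definition cosq :: "nat \<Rightarrow> (nat \<Rightarrow> real) \<Rightarrow> (nat \<Rightarrow> real) \<Rightarrow> real" where
  "cosq m u v = (ip m u v)\<^sup>2 / (ip m u u * ip m v v)"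

definition cosq_RP :: "nat \<Rightarrow> (nat \<Rightarrow> real) set \<Rightarrow> (nat \<Rightarrow> real) set \<Rightarrow> real" where
  "cosq_RP m l l' = cosq m (rep l) (rep l')"

lemma cosq_scale:
  assumes "c \<noteq> 0" "d \<noteq> 0"
  shows "cosq m (\<lambda>i. c * u i) (\<lambda>i. d * v i) = cosq m u v"
  using assms by (simp add: cosq_def field_simps power2_eq_square)

lemma cosq_RP_proj_class [simp]: "cosq_RP m (proj_class u) (proj_class v) = cosq m u v"
  using rep_proj_class[of u] rep_proj_class[of v] cosq_scale unfolding cosq_RP_def by metis

lemma cosq_nonneg: "cosq m u v \<ge> 0"
  by (simp add: cosq_def)

lemma cosq_le_1: "cosq m u v \<le> 1"
  using Cauchy_Schwarz_ip[of m u v] ip_self_nonneg[of m u] ip_self_nonneg[of m v]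
  by (auto simp: cosq_def divide_le_eq_1 less_le)

lemma quotient_map_proj_class_Times:
  "quotient_map (prod_topology (nzvec m) (nzvec m')) (prod_topology (RP m) (RP m'))
     (\<lambda>(u, v). (proj_class u, proj_class v))"
proof (rule continuous_open_imp_quotient_map)
  show "continuous_map (prod_topology (nzvec m) (nzvec m')) (prod_topology (RP m) (RP m'))
     (\<lambda>(u, v). (proj_class u, proj_class v))"
    unfolding case_prod_unfold
    by (intro continuous_map_pairedI continuous_map_compose[OF continuous_map_fst continuous_map_proj_class, unfolded o_def]
          continuous_map_compose[OF continuous_map_snd continuous_map_proj_class, unfolded o_def])
  show "open_map (prod_topology (nzvec m) (nzvec m')) (prod_topology (RP m) (RP m'))
     (\<lambda>(u, v). (proj_class u, proj_class v))"
    by (intro open_map_Times open_map_proj_class)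
  show "(\<lambda>(u, v). (proj_class u, proj_class v)) ` topspace (prod_topology (nzvec m) (nzvec m')) =
    topspace (prod_topology (RP m) (RP m'))"
    by (auto simp: topspace_RP)
qed

lemmas continuous_map_coord_fst =
  continuous_map_compose[OF continuous_map_fst continuous_map_nzvec_coord, unfolded o_def]
lemmas continuous_map_coord_snd =
  continuous_map_compose[OF continuous_map_snd continuous_map_nzvec_coord, unfolded o_def]

lemma continuous_map_cosq_RP:
  "continuous_map (prod_topology (RP m) (RP m)) euclideanreal (\<lambda>(l, l'). cosq_RP m l l')"
proof (rule continuous_compose_quotient_map[OF quotient_map_proj_class_Times])
  have "continuous_map (prod_topology (nzvec m) (nzvec m)) euclideanreal (\<lambda>p. cosq m (fst p) (snd p))"
    unfolding cosq_def
    by (intro continuous_map_real_divide continuous_map_real_mult continuous_map_real_pow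
        continuous_map_ip continuous_map_coord_fst continuous_map_coord_snd)
       (auto dest!: ip_self_pos)
  then show "continuous_map (prod_topology (nzvec m) (nzvec m)) euclideanreal
     ((\<lambda>(l, l'). cosq_RP m l l') \<circ> (\<lambda>(u, v). (proj_class u, proj_class v)))"
    by (simp add: o_def case_prod_unfold)
qed

text \<open>The equality case of Cauchy-Schwarz: \<open>c\<close> is the coefficient of the
  orthogonal projection of \<open>u\<close> to \<open>v\<close>, and the residual has norm
  zero.\<close>

lemma cosq_eq_1_imp:
  assumes "u \<in> topspace (nzvec m)" "v \<in> topspace (nzvec m)" "cosq m u v = 1"
  shows "proj_class u = proj_class v"
proof -
  have pos: "ip m u u > 0" "ip m v v > 0" using assms ip_self_pos by auto
  then have eq: "(ip m u v)\<^sup>2 = ip m u u * ip m v v"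
    using assms(3) unfolding cosq_def by (metis divide_eq_1_iff)
  define c where "c = ip m u v / ip m v v"
  have c0: "c \<noteq> 0" using eq pos by (auto simp: c_def)
  have "ip m (\<lambda>i. u i - c * v i) (\<lambda>i. u i - c * v i) = ip m u u - 2 * c * ip m u v + c\<^sup>2 * ip m v v"
    by (simp add: ip_diff ip_commute power2_eq_square algebra_simps)
  also have "\<dots> = 0"
    using pos eq by (simp add: c_def field_simps power2_eq_square)
  finally have "ip m (\<lambda>i. u i - c * v i) (\<lambda>i. u i - c * v i) = 0" .
  then have "(\<lambda>i. u i - c * v i) \<notin> topspace (nzvec m)"
    using ip_self_pos by fastforce
  then have "u = (\<lambda>i. c * v i)" using assms(1,2) by (auto simp: topspace_nzvec fun_eq_iff)
  then show ?thesis using c0 proj_class_eq_iff by blast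
qed

text \<open>The function \<open>cosq_RP m k\<close> is 1 at \<open>k\<close> and smaller elsewhere,
  so it separates \<open>k\<close> from every other point.\<close>

lemma Hausdorff_space_RP: "Hausdorff_space (RP m)"
  unfolding Hausdorff_space_def
proof (intro allI impI)
  fix k l assume kl: "k \<in> topspace (RP m) \<and> l \<in> topspace (RP m) \<and> k \<noteq> l"
  define f where "f = cosq_RP m k"
  have cont: "continuous_map (RP m) euclideanreal f"
  proof -
    have "continuous_map (RP m) (prod_topology (RP m) (RP m)) (\<lambda>l. (k, l))"
      using kl by (intro continuous_map_pairedI) auto
    from continuous_map_compose[OF this continuous_map_cosq_RP] show ?thesis
      by (simp add: o_def f_def)
  qed
  have fk: "f k = 1"
    using ip_self_pos[OF rep(1)[of k m]] kl by (auto simp: f_def cosq_RP_def cosq_def power2_eq_square)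
  have fl: "f l < 1"
    using cosq_eq_1_imp[OF rep(1) rep(1), of k m l] cosq_le_1[of m "rep k" "rep l"] rep(2)[of k m] rep(2)[of l m] kl
    unfolding f_def cosq_RP_def less_le by metis
  obtain b where fkl: "f l < b" "b < f k" using fk fl dense by metis
  have "openin (RP m) {x \<in> topspace (RP m). f x > b}" "openin (RP m) {x \<in> topspace (RP m). f x < b}"
    using cont unfolding continuous_map_upper_lower_semicontinuous_lt by blast+
  then show "\<exists>U V. openin (RP m) U \<and> openin (RP m) V \<and> k \<in> U \<and> l \<in> V \<and> disjnt U V"
    using kl fkl
    by (intro exI[of _ "{x \<in> topspace (RP m). f x > b}"] exI[of _ "{x \<in> topspace (RP m). f x < b}"] conjI)
       (auto simp: disjnt_def)
qed

section \<open>Coordinates and angles on the projective line\<close>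

definition vec2 :: "real \<Rightarrow> real \<Rightarrow> nat \<Rightarrow> real" where
  "vec2 a b = (\<lambda>i. if i = 0 then a else if i = 1 then b else 0)"

lemma vec2_simps [simp]: "vec2 a b 0 = a" "vec2 a b 1 = b"
  by (simp_all add: vec2_def)

lemma vec2_in [simp]: "vec2 a b \<in> topspace (nzvec 1) \<longleftrightarrow> a \<noteq> 0 \<or> b \<noteq> 0"
proof -
  have "vec2 a b = (\<lambda>_. 0) \<longleftrightarrow> a = 0 \<and> b = 0"
    by (metis (full_types) vec2_def vec2_simps)
  then show ?thesis by (auto simp: topspace_nzvec vec2_def)
qed

lemma vec2_cos_sin_in: "vec2 (cos \<theta>) (sin \<theta>) \<in> topspace (nzvec 1)"
  unfolding vec2_in by (metis sin_zero_norm_cos_one norm_zero zero_neq_one)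

lemma nzvec_1_vec2: "v \<in> topspace (nzvec 1) \<Longrightarrow> v = vec2 (v 0) (v 1)"
  by (auto simp: topspace_nzvec vec2_def fun_eq_iff)

lemma RP1_real_vec2: "RP1_real x = proj_class (vec2 x 1)"
  unfolding RP1_real_def hpoint_def vec2_def
  by (rule arg_cong[where f = proj_class]) auto

lemma RP1_infinity_vec2: "RP1_infinity = proj_class (vec2 1 0)"
  unfolding RP1_infinity_def hpoint_def vec2_def
  by (rule arg_cong[where f = proj_class]) auto

lemma proj_class_scale: "c \<noteq> 0 \<Longrightarrow> proj_class (\<lambda>i. c * v i) = proj_class v"
  using proj_class_eq_iff by blast

text \<open>The line at a given angle. Angle 0 is \<open>RP1_infinity\<close>, and the period is
  \<pi>, so the interval from 0 to \<open>2 * pi\<close> covers the projective line twice.\<close>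

definition circ :: "real \<Rightarrow> (nat \<Rightarrow> real) set" where
  "circ \<theta> = proj_class (vec2 (cos \<theta>) (sin \<theta>))"

lemma polar_vec2:
  assumes "v \<in> topspace (nzvec 1)"
  obtains r \<theta> where "r > 0" "0 \<le> \<theta>" "\<theta> \<le> 2 * pi" "v = (\<lambda>i. r * vec2 (cos \<theta>) (sin \<theta>) i)"
proof -
  define r where "r = sqrt ((v 0)\<^sup>2 + (v 1)\<^sup>2)"
  have "v 0 \<noteq> 0 \<or> v 1 \<noteq> 0" using assms nzvec_1_vec2 vec2_in by metis
  then have r: "r > 0" by (simp add: r_def sum_power2_gt_zero_iff)
  have "r\<^sup>2 = (v 0)\<^sup>2 + (v 1)\<^sup>2" by (simp add: r_def)
  then have "(v 0 / r)\<^sup>2 + (v 1 / r)\<^sup>2 = r\<^sup>2 / r\<^sup>2"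
    by (simp only: power_divide add_divide_distrib)
  then have "(v 0 / r)\<^sup>2 + (v 1 / r)\<^sup>2 = 1" using r by simp
  then obtain t where t: "0 \<le> t" "t < 2 * pi" "v 0 / r = cos t" "v 1 / r = sin t"
    by (rule sincos_total_2pi)
  then have "v = (\<lambda>i. r * vec2 (cos t) (sin t) i)"
    using r by (subst nzvec_1_vec2[OF assms]) (auto simp: vec2_def fun_eq_iff field_simps)
  with t r that show ?thesis by force
qed

lemma circ_in [simp]: "circ \<theta> \<in> topspace (RP 1)"
  unfolding topspace_RP circ_def by (rule imageI, rule vec2_cos_sin_in)

lemma continuous_map_circ: "continuous_map euclideanreal (RP 1) circ"
proof -
  have "continuous_map euclideanreal (nzvec 1) (\<lambda>\<theta>. vec2 (cos \<theta>) (sin \<theta>))"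
  proof (rule continuous_map_into_nzvec)
    fix i show "continuous_map euclideanreal euclideanreal (\<lambda>\<theta>. vec2 (cos \<theta>) (sin \<theta>) i)"
      by (cases "i = 0"; cases "i = 1") (auto simp: vec2_def intro!: continuous_intros)
  qed (rule vec2_cos_sin_in)
  from continuous_map_compose[OF this continuous_map_proj_class] show ?thesis
    by (simp add: o_def circ_def[abs_def])
qed

lemma circ_surj:
  assumes "l \<in> topspace (RP 1)"
  obtains \<theta> where "0 \<le> \<theta>" "\<theta> \<le> 2 * pi" "l = circ \<theta>"
proof -
  obtain v where v: "v \<in> topspace (nzvec 1)" "l = proj_class v"
    using assms topspace_RP by auto
  obtain r \<theta> where "r > 0" "0 \<le> \<theta>" "\<theta> \<le> 2 * pi" "v = (\<lambda>i. r * vec2 (cos \<theta>) (sin \<theta>) i)"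
    using polar_vec2[OF v(1)] .
  then show ?thesis using that v proj_class_scale[of r] unfolding circ_def by auto
qed

lemma compact_space_RP1: "compact_space (RP 1)"
proof -
  have "compactin euclideanreal {0..2*pi}" by simp
  then have "compactin (RP 1) (circ ` {0..2*pi})"
    using continuous_map_circ image_compactin by blast
  moreover have "circ ` {0..2*pi} = topspace (RP 1)"
  proof (intro equalityI subsetI)
    fix l assume "l \<in> topspace (RP 1)"
    from circ_surj[OF this] show "l \<in> circ ` {0..2*pi}" by (metis atLeastAtMost_iff imageI)
  qed (use circ_in in blast)
  ultimately show ?thesis by (simp add: compact_space_def)
qed

section \<open>Segments between non-orthogonal loops\<close>

definition nonorth :: "nat \<Rightarrow> (nat \<Rightarrow> real) set \<Rightarrow> (nat \<Rightarrow> real) set \<Rightarrow> bool" where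
  "nonorth m l l' \<longleftrightarrow> ip m (rep l) (rep l') \<noteq> 0"

definition seg_vec :: "nat \<Rightarrow> real \<Rightarrow> (nat \<Rightarrow> real) \<Rightarrow> (nat \<Rightarrow> real) \<Rightarrow> nat \<Rightarrow> real" where
  "seg_vec m t u v = (\<lambda>i. (1 - t) * ip m u v * u i + t * ip m u u * v i)"

definition seg :: "nat \<Rightarrow> real \<Rightarrow> (nat \<Rightarrow> real) set \<Rightarrow> (nat \<Rightarrow> real) set \<Rightarrow> (nat \<Rightarrow> real) set" where
  "seg m t l l' = proj_class (seg_vec m t (rep l) (rep l'))"

lemma nonorth_proj_class [simp]: "nonorth m (proj_class u) (proj_class v) \<longleftrightarrow> ip m u v \<noteq> 0"
proof -
  obtain c d where "c \<noteq> 0" "rep (proj_class u) = (\<lambda>i. c * u i)" "d \<noteq> 0" "rep (proj_class v) = (\<lambda>i. d * v i)"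
    using rep_proj_class by metis
  then show ?thesis by (simp add: nonorth_def)
qed

lemma nonorth_iff_cosq_RP:
  assumes "l \<in> topspace (RP m)" "l' \<in> topspace (RP m)"
  shows "nonorth m l l' \<longleftrightarrow> cosq_RP m l l' > 0"
  using ip_self_pos[OF rep(1)[OF assms(1)]] ip_self_pos[OF rep(1)[OF assms(2)]]
  by (auto simp: nonorth_def cosq_RP_def cosq_def zero_less_divide_iff zero_less_mult_iff)

lemma seg_proj_class [simp]: "seg m t (proj_class u) (proj_class v) = proj_class (seg_vec m t u v)"
proof -
  obtain c d where cd: "c \<noteq> 0" "rep (proj_class u) = (\<lambda>i. c * u i)" "d \<noteq> 0" "rep (proj_class v) = (\<lambda>i. d * v i)"
    using rep_proj_class by metis
  \<comment> \<open>Both summands of \<open>seg_vec\<close> are quadratic in \<open>u\<close> and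
    linear in \<open>v\<close>.\<close>
  then have "seg m t (proj_class u) (proj_class v) = proj_class (\<lambda>i. (c\<^sup>2 * d) * seg_vec m t u v i)"
    unfolding seg_def by (simp add: seg_vec_def power2_eq_square algebra_simps)
  also have "\<dots> = proj_class (seg_vec m t u v)"
    using cd by (intro proj_class_scale) auto
  finally show ?thesis .
qed

text \<open>This value is independent of \<open>t\<close>, so the segment between non-orthogonal
  vectors never meets zero, for any real \<open>t\<close>.\<close>

lemma ip_seg_vec: "ip m (seg_vec m t u v) u = ip m u u * ip m u v"
  unfolding seg_vec_def ip_add(1) ip_scale by (simp add: ip_commute[of m v u] algebra_simps)

lemma seg_vec_in:
  assumes "u \<in> topspace (nzvec m)" "v \<in> topspace (nzvec m)" "ip m u v \<noteq> 0"
  shows "seg_vec m t u v \<in> topspace (nzvec m)"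
proof -
  have "ip m (seg_vec m t u v) u \<noteq> 0"
    using ip_self_pos[OF assms(1)] assms(3) by (simp add: ip_seg_vec)
  then have "seg_vec m t u v \<noteq> (\<lambda>_. 0)" by (auto simp: ip_def)
  moreover have "\<forall>i>m. seg_vec m t u v i = 0"
    using assms(1,2) by (simp add: topspace_nzvec seg_vec_def)
  ultimately show ?thesis by (simp add: topspace_nzvec)
qed

lemma seg_0:
  assumes "l \<in> topspace (RP m)" "l' \<in> topspace (RP m)" "nonorth m l l'"
  shows "seg m 0 l l' = l"
proof -
  have "seg m 0 l l' = proj_class (\<lambda>i. ip m (rep l) (rep l') * rep l i)"
    by (simp add: seg_def seg_vec_def)
  also have "\<dots> = l"
    using assms proj_class_scale rep(2) nonorth_def by metis
  finally show ?thesis .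
qed

lemma seg_1:
  assumes "l \<in> topspace (RP m)" "l' \<in> topspace (RP m)"
  shows "seg m 1 l l' = l'"
proof -
  have "seg m 1 l l' = proj_class (\<lambda>i. ip m (rep l) (rep l) * rep l' i)"
    by (simp add: seg_def seg_vec_def)
  also have "\<dots> = l'"
    using assms proj_class_scale rep ip_self_pos by (metis less_numeral_extra(3))
  finally show ?thesis .
qed

lemma openin_nonorth:
  "openin (prod_topology (RP m) (RP m)) {p \<in> topspace (prod_topology (RP m) (RP m)). nonorth m (fst p) (snd p)}"
proof -
  have "openin (prod_topology (RP m) (RP m))
      {p \<in> topspace (prod_topology (RP m) (RP m)). (case p of (l, l') \<Rightarrow> cosq_RP m l l') > 0}"
    using continuous_map_cosq_RP[of m] unfolding continuous_map_upper_lower_semicontinuous_lt by blast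
  also have "{p \<in> topspace (prod_topology (RP m) (RP m)). (case p of (l, l') \<Rightarrow> cosq_RP m l l') > 0} =
     {p \<in> topspace (prod_topology (RP m) (RP m)). nonorth m (fst p) (snd p)}"
    by (auto simp: nonorth_iff_cosq_RP)
  finally show ?thesis .
qed

text \<open>Quotient maps restrict well over open sets of the target, which is where
  \<open>openin_nonorth\<close> enters; the factor of the parameter \<open>t\<close> is harmless
  since the real line is locally compact.\<close>

lemma continuous_map_seg:
  "continuous_map (subtopology (prod_topology euclideanreal (prod_topology (RP m) (RP m)))
      {p. nonorth m (fst (snd p)) (snd (snd p))})
      (RP m) (\<lambda>p. seg m (fst p) (fst (snd p)) (snd (snd p)))"
proof -
  define X where "X = prod_topology euclideanreal (prod_topology (nzvec m) (nzvec m))"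
  define Y where "Y = prod_topology euclideanreal (prod_topology (RP m) (RP m))"
  define q where "q = (\<lambda>(t::real, p). (t, (\<lambda>(u, v). (proj_class u, proj_class v)) p))"
  define V where "V = {p \<in> topspace Y. nonorth m (fst (snd p)) (snd (snd p))}"
  define U where "U = {x \<in> topspace X. q x \<in> V}"
  have q: "quotient_map X Y q"
    unfolding X_def Y_def q_def
    by (rule quotient_map_prod_right[OF _ _ quotient_map_proj_class_Times])
       (auto simp: locally_compact_space_euclidean)
  have "V = UNIV \<times> {p \<in> topspace (prod_topology (RP m) (RP m)). nonorth m (fst p) (snd p)}"
    by (auto simp: V_def Y_def)
  then have "openin Y V"
    using openin_nonorth[of m] unfolding Y_def by (simp add: openin_prod_Times_iff)
  then have qr: "quotient_map (subtopology X U) (subtopology Y V) q"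
    using quotient_map_restriction[OF q] U_def by blast
  have U: "U = {(t, u, v). u \<in> topspace (nzvec m) \<and> v \<in> topspace (nzvec m) \<and> ip m u v \<noteq> 0}"
  proof (intro set_eqI)
    fix x :: "real \<times> (nat \<Rightarrow> real) \<times> (nat \<Rightarrow> real)"
    obtain t u v where x: "x = (t, u, v)" by (cases x) auto
    have "u \<in> topspace (nzvec m) \<and> v \<in> topspace (nzvec m) \<Longrightarrow> q x \<in> topspace Y"
      by (auto simp: x q_def Y_def topspace_RP)
    then show "x \<in> U \<longleftrightarrow> x \<in> {(t, u, v). u \<in> topspace (nzvec m) \<and> v \<in> topspace (nzvec m) \<and> ip m u v \<noteq> 0}"
      by (auto simp: U_def V_def X_def x q_def)
  qed
  have fs: "continuous_map (subtopology X U) euclideanreal fst"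
       "\<And>i. continuous_map (subtopology X U) euclideanreal (\<lambda>x. fst (snd x) i)"
       "\<And>i. continuous_map (subtopology X U) euclideanreal (\<lambda>x. snd (snd x) i)"
    unfolding X_def
    using continuous_map_compose[OF continuous_map_snd continuous_map_coord_fst]
     continuous_map_compose[OF continuous_map_snd continuous_map_coord_snd]
    by (auto intro!: continuous_map_from_subtopology continuous_map_fst simp: o_def)
  have "continuous_map (subtopology X U) (nzvec m) (\<lambda>x. seg_vec m (fst x) (fst (snd x)) (snd (snd x)))"
  proof (rule continuous_map_into_nzvec)
    show "continuous_map (subtopology X U) euclideanreal (\<lambda>z. seg_vec m (fst z) (fst (snd z)) (snd (snd z)) i)" for i
      unfolding seg_vec_def
      by (intro continuous_map_add continuous_map_real_mult continuous_map_diff continuous_map_ip fs) simp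
  qed (auto simp: U intro!: seg_vec_in)
  from continuous_map_compose[OF this continuous_map_proj_class]
  have "continuous_map (subtopology X U) (RP m) ((\<lambda>p. seg m (fst p) (fst (snd p)) (snd (snd p))) \<circ> q)"
    by (simp add: o_def q_def case_prod_unfold)
  from continuous_compose_quotient_map[OF qr this]
  have "continuous_map (subtopology Y V) (RP m) (\<lambda>p. seg m (fst p) (fst (snd p)) (snd (snd p)))" .
  moreover have "V = topspace Y \<inter> {p. nonorth m (fst (snd p)) (snd (snd p))}"
    by (auto simp: V_def)
  ultimately show ?thesis
    using subtopology_restrict[of Y] by (simp add: Y_def)
qed

section \<open>The based loop space and segments of loops\<close>

lemma topspace_Omega:
  "topspace (Omega_RP m) = {\<phi>. \<phi> \<in> extensional (topspace (RP 1)) \<and> continuous_map (RP 1) (RP m) \<phi> \<and>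
     \<phi> RP1_infinity = hpoint m (\<lambda>_. 1)}"
  by (auto simp: Omega_RP_def)

lemma Omega_in_RP: "\<phi> \<in> topspace (Omega_RP m) \<Longrightarrow> x \<in> topspace (RP 1) \<Longrightarrow> \<phi> x \<in> topspace (RP m)"
  using continuous_map_image_subset_topspace by (fastforce simp: topspace_Omega)

lemma Omega_ext:
  assumes "\<phi> \<in> topspace (Omega_RP m)" "\<psi> \<in> topspace (Omega_RP m)"
    and "\<And>x. x \<in> topspace (RP 1) \<Longrightarrow> \<phi> x = \<psi> x"
  shows "\<phi> = \<psi>"
  by (rule extensionalityI[of _ "topspace (RP 1)"]) (use assms in \<open>auto simp: topspace_Omega\<close>)

lemma RP1_infinity_in [simp]: "RP1_infinity \<in> topspace (RP 1)"
  unfolding RP1_infinity_vec2 topspace_RP by (rule imageI) simp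

lemma RP1_nontrivial [simp]: "RP 1 \<noteq> trivial_topology"
  using RP1_infinity_in by force

lemma continuous_map_into_Omega:
  assumes "continuous_map (prod_topology Z (RP 1)) (RP m) (\<lambda>(z, x). f z x)"
    and "\<And>z. z \<in> topspace Z \<Longrightarrow> f z \<in> extensional (topspace (RP 1))"
    and "\<And>z. z \<in> topspace Z \<Longrightarrow> f z RP1_infinity = hpoint m (\<lambda>_. 1)"
  shows "continuous_map Z (Omega_RP m) f"
  unfolding Omega_RP_def continuous_map_in_subtopology
  using continuous_map_into_compact_open[OF assms(1,2)] assms(3) by auto

lemma continuous_map_Omega_eval:
  assumes "continuous_map Z (Omega_RP m) f" "continuous_map Z (RP 1) g"
  shows "continuous_map Z (RP m) (\<lambda>z. f z (g z))"
proof -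
  have "continuous_map Z (compact_open_topology (RP 1) (RP m)) f"
    using assms(1) unfolding Omega_RP_def continuous_map_in_subtopology by blast
  then have "continuous_map Z (prod_topology (compact_open_topology (RP 1) (RP m)) (RP 1)) (\<lambda>z. (f z, g z))"
    using assms(2) by (intro continuous_map_pairedI)
  from continuous_map_compose[OF this continuous_map_compact_open_eval[OF compact_space_RP1 Hausdorff_space_RP]]
  show ?thesis by (simp add: o_def)
qed

lemma openin_Omega_nonorth:
  assumes \<psi>: "\<psi> \<in> topspace (Omega_RP m)"
  shows "openin (Omega_RP m) {\<phi> \<in> topspace (Omega_RP m). \<forall>x\<in>topspace (RP 1). nonorth m (\<psi> x) (\<phi> x)}"
proof -
  let ?Z = "prod_topology (Omega_RP m) (RP 1)"
  have c: "continuous_map ?Z (prod_topology (RP m) (RP m)) (\<lambda>p. (\<psi> (snd p), fst p (snd p)))"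
    using continuous_map_compose[OF continuous_map_snd, of "RP 1" "RP m" \<psi> "Omega_RP m"] \<psi>
    by (intro continuous_map_pairedI continuous_map_Omega_eval[OF continuous_map_fst continuous_map_snd])
       (auto simp: topspace_Omega o_def)
  have "openin (Omega_RP m) {\<phi> \<in> topspace (Omega_RP m). \<forall>x\<in>topspace (RP 1).
     (\<phi>, x) \<in> {p \<in> topspace ?Z. (\<psi> (snd p), fst p (snd p)) \<in>
       {p \<in> topspace (prod_topology (RP m) (RP m)). nonorth m (fst p) (snd p)}}}"
    by (rule openin_forall_compact[OF openin_continuous_map_preimage[OF c openin_nonorth]])
       (use compact_space_RP1 compact_space_def in blast)
  also have "{\<phi> \<in> topspace (Omega_RP m). \<forall>x\<in>topspace (RP 1).
     (\<phi>, x) \<in> {p \<in> topspace ?Z. (\<psi> (snd p), fst p (snd p)) \<in>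
       {p \<in> topspace (prod_topology (RP m) (RP m)). nonorth m (fst p) (snd p)}}} =
     {\<phi> \<in> topspace (Omega_RP m). \<forall>x\<in>topspace (RP 1). nonorth m (\<psi> x) (\<phi> x)}"
    using \<psi> Omega_in_RP by auto
  finally show ?thesis .
qed

definition seg_map where
  "seg_map m t \<phi> \<psi> = restrict (\<lambda>x. seg m t (\<phi> x) (\<psi> x)) (topspace (RP 1))"

lemma hpoint_1_proj: "hpoint m (\<lambda>_. 1) = proj_class (\<lambda>i. if i \<le> m then 1 else 0)"
  by (simp add: hpoint_def)

text \<open>Keeps the segment of two based loops based at every time.\<close>

lemma seg_hpoint_1: "seg m t (hpoint m (\<lambda>_. 1)) (hpoint m (\<lambda>_. 1)) = hpoint m (\<lambda>_. 1)"
proof -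
  let ?u = "\<lambda>i. if i \<le> m then 1 else 0 :: real"
  have "ip m ?u ?u = real m + 1" by (simp add: ip_def)
  then have "seg_vec m t ?u ?u = (\<lambda>i. (real m + 1) * ?u i)"
    by (auto simp: seg_vec_def fun_eq_iff algebra_simps)
  then show ?thesis
    unfolding hpoint_1_proj seg_proj_class using proj_class_scale[of "real m + 1" ?u] by simp
qed

lemma continuous_map_seg_map:
  assumes t: "continuous_map Z euclideanreal t" and a: "continuous_map Z (Omega_RP m) a"
    and b: "continuous_map Z (Omega_RP m) b"
    and no: "\<And>z x. z \<in> topspace Z \<Longrightarrow> x \<in> topspace (RP 1) \<Longrightarrow> nonorth m (a z x) (b z x)"
  shows "continuous_map Z (Omega_RP m) (\<lambda>z. seg_map m (t z) (a z) (b z))"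
proof (rule continuous_map_into_Omega)
  let ?Z = "prod_topology Z (RP 1)"
  have "continuous_map ?Z (prod_topology euclideanreal (prod_topology (RP m) (RP m)))
      (\<lambda>p. (t (fst p), a (fst p) (snd p), b (fst p) (snd p)))"
    by (intro continuous_map_pairedI
        continuous_map_Omega_eval[OF continuous_map_compose[OF continuous_map_fst a, unfolded o_def] continuous_map_snd]
        continuous_map_Omega_eval[OF continuous_map_compose[OF continuous_map_fst b, unfolded o_def] continuous_map_snd]
        continuous_map_compose[OF continuous_map_fst t, unfolded o_def])
  then have "continuous_map ?Z (subtopology (prod_topology euclideanreal (prod_topology (RP m) (RP m)))
      {p. nonorth m (fst (snd p)) (snd (snd p))})
      (\<lambda>p. (t (fst p), a (fst p) (snd p), b (fst p) (snd p)))"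
    using no by (auto simp: continuous_map_in_subtopology)
  from continuous_map_compose[OF this continuous_map_seg]
  show "continuous_map ?Z (RP m) (\<lambda>(z, x). seg_map m (t z) (a z) (b z) x)"
    by (rule continuous_map_eq) (auto simp: seg_map_def)
next
  fix z assume z: "z \<in> topspace Z"
  show "seg_map m (t z) (a z) (b z) \<in> extensional (topspace (RP 1))"
    by (simp add: seg_map_def)
  have "a z \<in> topspace (Omega_RP m)" "b z \<in> topspace (Omega_RP m)"
    using z a b continuous_map_image_subset_topspace by blast+
  then show "seg_map m (t z) (a z) (b z) RP1_infinity = hpoint m (\<lambda>_. 1)"
    by (simp add: seg_map_def topspace_Omega seg_hpoint_1)
qed

lemma seg_map_0:
  assumes "\<phi> \<in> topspace (Omega_RP m)" "\<psi> \<in> topspace (Omega_RP m)"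
    and "\<And>x. x \<in> topspace (RP 1) \<Longrightarrow> nonorth m (\<phi> x) (\<psi> x)"
  shows "seg_map m 0 \<phi> \<psi> = \<phi>"
proof (rule extensionalityI[of _ "topspace (RP 1)"])
  fix x assume x: "x \<in> topspace (RP 1)"
  then show "seg_map m 0 \<phi> \<psi> x = \<phi> x"
    using seg_0[OF Omega_in_RP[OF assms(1) x] Omega_in_RP[OF assms(2) x] assms(3)[OF x]] by (simp add: seg_map_def)
qed (use assms in \<open>simp_all add: seg_map_def topspace_Omega\<close>)

lemma seg_map_1:
  assumes "\<phi> \<in> topspace (Omega_RP m)" "\<psi> \<in> topspace (Omega_RP m)"
  shows "seg_map m 1 \<phi> \<psi> = \<psi>"
proof (rule extensionalityI[of _ "topspace (RP 1)"])
  fix x assume x: "x \<in> topspace (RP 1)"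
  then show "seg_map m 1 \<phi> \<psi> x = \<psi> x"
    using seg_1[OF Omega_in_RP[OF assms(1) x] Omega_in_RP[OF assms(2) x]] by (simp add: seg_map_def)
qed (use assms in \<open>simp_all add: seg_map_def topspace_Omega\<close>)

text \<open>What is required to descend to lines. The factor \<open>d\<close> is left open because
  it is \<open>c ^ n\<close> for a rational loop of degree \<open>n\<close>, but only 1 or the sign
  of \<open>c\<close> for a blend.\<close>

definition equivar :: "((nat \<Rightarrow> real) \<Rightarrow> (nat \<Rightarrow> real)) \<Rightarrow> bool" where
  "equivar L \<longleftrightarrow> (\<forall>v\<in>topspace (nzvec 1). \<forall>c. c \<noteq> 0 \<longrightarrow> (\<exists>d. d \<noteq> 0 \<and> L (\<lambda>i. c * v i) = (\<lambda>i. d * L v i)))"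

definition lift_map :: "((nat \<Rightarrow> real) \<Rightarrow> (nat \<Rightarrow> real)) \<Rightarrow> (nat \<Rightarrow> real) set \<Rightarrow> (nat \<Rightarrow> real) set" where
  "lift_map L = restrict (\<lambda>l. proj_class (L (rep l))) (topspace (RP 1))"

lemma lift_map_proj_class:
  assumes "equivar L" "v \<in> topspace (nzvec 1)"
  shows "lift_map L (proj_class v) = proj_class (L v)"
proof -
  obtain c where c: "c \<noteq> 0" "rep (proj_class v) = (\<lambda>i. c * v i)" using rep_proj_class by blast
  obtain d where "d \<noteq> 0" "L (\<lambda>i. c * v i) = (\<lambda>i. d * L v i)"
    using assms c unfolding equivar_def by blast
  then show ?thesis
    using assms(2) c by (simp add: lift_map_def topspace_RP proj_class_scale)
qed

lemma continuous_map_lift_map: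
  assumes cont: "\<And>i. continuous_map (prod_topology Z (nzvec 1)) euclideanreal (\<lambda>p. L (fst p) (snd p) i)"
    and nz: "\<And>z v. z \<in> topspace Z \<Longrightarrow> v \<in> topspace (nzvec 1) \<Longrightarrow> L z v \<in> topspace (nzvec m)"
    and eq: "\<And>z. z \<in> topspace Z \<Longrightarrow> equivar (L z)"
    and base: "\<And>z. z \<in> topspace Z \<Longrightarrow> proj_class (L z (vec2 1 0)) = hpoint m (\<lambda>_. 1)"
  shows "continuous_map Z (Omega_RP m) (\<lambda>z. lift_map (L z))"
proof (rule continuous_map_into_Omega)
  let ?q = "\<lambda>(z, v). (z, proj_class v)"
  have "quotient_map (prod_topology Z (nzvec 1)) (prod_topology Z (RP 1)) ?q"
  proof (rule continuous_open_imp_quotient_map)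
    show "continuous_map (prod_topology Z (nzvec 1)) (prod_topology Z (RP 1)) ?q"
      unfolding case_prod_unfold
      using continuous_map_compose[OF continuous_map_snd continuous_map_proj_class]
      by (intro continuous_map_pairedI continuous_map_fst) (auto simp: o_def)
    show "open_map (prod_topology Z (nzvec 1)) (prod_topology Z (RP 1)) ?q"
      using open_map_Times[OF open_map_id open_map_proj_class] by simp
    show "?q ` topspace (prod_topology Z (nzvec 1)) = topspace (prod_topology Z (RP 1))"
      by (auto simp: topspace_RP)
  qed
  moreover have "continuous_map (prod_topology Z (nzvec 1)) (RP m) ((\<lambda>(z, x). lift_map (L z) x) \<circ> ?q)"
  proof -
    have "continuous_map (prod_topology Z (nzvec 1)) (nzvec m) (\<lambda>p. L (fst p) (snd p))"
      by (rule continuous_map_into_nzvec[OF cont]) (auto intro: nz)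
    from continuous_map_compose[OF this continuous_map_proj_class] show ?thesis
      by (rule continuous_map_eq) (auto simp: lift_map_proj_class eq)
  qed
  ultimately show "continuous_map (prod_topology Z (RP 1)) (RP m) (\<lambda>(z, x). lift_map (L z) x)"
    by (rule continuous_compose_quotient_map)
next
  fix z assume z: "z \<in> topspace Z"
  show "lift_map (L z) \<in> extensional (topspace (RP 1))"
    by (simp add: lift_map_def)
  show "lift_map (L z) RP1_infinity = hpoint m (\<lambda>_. 1)"
    using lift_map_proj_class[OF eq[OF z]] base[OF z] by (simp add: RP1_infinity_vec2)
qed

section \<open>Real rational loops\<close>

text \<open>The homogenisation of \<open>p\<close> in degree \<open>n\<close>, which may exceed the
  degree of \<open>p\<close>. At \<open>b = 0\<close> it reads off the coefficient of index
  \<open>n\<close>; a polynomial that is monic of degree \<open>n\<close> thus takes the value 1 at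
  (1, 0).\<close>

definition hom_poly :: "nat \<Rightarrow> real poly \<Rightarrow> real \<Rightarrow> real \<Rightarrow> real" where
  "hom_poly n p a b = (\<Sum>j\<le>n. coeff p j * a ^ j * b ^ (n - j))"

lemma hom_poly_scale: "hom_poly n p (c * a) (c * b) = c ^ n * hom_poly n p a b"
proof -
  have "coeff p j * (c * a) ^ j * (c * b) ^ (n - j) = c ^ n * (coeff p j * a ^ j * b ^ (n - j))" if "j \<le> n" for j
  proof -
    have "c ^ n = c ^ j * c ^ (n - j)" using that by (simp flip: power_add)
    then show ?thesis by (simp add: power_mult_distrib)
  qed
  then show ?thesis unfolding hom_poly_def sum_distrib_left by (intro sum.cong) auto
qed

lemma hom_poly_1:
  assumes "degree p \<le> n"
  shows "hom_poly n p x 1 = poly p x"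
proof -
  have "poly p x = (\<Sum>j\<le>degree p. coeff p j * x ^ j)" by (rule poly_altdef)
  also have "\<dots> = (\<Sum>j\<le>n. coeff p j * x ^ j)"
    by (rule sum.mono_neutral_left) (use assms in \<open>auto simp: coeff_eq_0\<close>)
  finally show ?thesis by (simp add: hom_poly_def)
qed

lemma hom_poly_dehom:
  assumes "degree p \<le> n" "b \<noteq> 0"
  shows "hom_poly n p a b = b ^ n * poly p (a / b)"
  using hom_poly_scale[of n p b "a / b" 1] assms by (simp add: hom_poly_1)

lemma hom_poly_at_infinity: "hom_poly n p a 0 = coeff p n * a ^ n"
proof -
  have "hom_poly n p a 0 = (\<Sum>j\<in>{n}. coeff p j * a ^ j * 0 ^ (n - j))"
    unfolding hom_poly_def by (rule sum.mono_neutral_right) auto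
  then show ?thesis by simp
qed

lemma hom_poly_add: "hom_poly n (p + q) a b = hom_poly n p a b + hom_poly n q a b"
  by (simp add: hom_poly_def sum.distrib algebra_simps)

lemma hom_poly_const: "hom_poly n [:c:] a b = c * b ^ n"
proof -
  have "hom_poly n [:c:] a b = (\<Sum>j\<in>{0}. coeff [:c:] j * a ^ j * b ^ (n - j))"
    unfolding hom_poly_def by (rule sum.mono_neutral_right) (auto simp: coeff_pCons split: nat.splits)
  then show ?thesis by simp
qed

lemma coeff_mult_top:
  fixes p q :: "real poly"
  assumes "degree p \<le> n" "degree q \<le> k"
  shows "coeff (p * q) (n + k) = coeff p n * coeff q k"
proof -
  have "coeff p i * coeff q (n + k - i) = 0" if "i \<noteq> n" "i \<le> n + k" for i
    using that assms by (cases "i < n") (auto simp: coeff_eq_0)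
  then have "coeff (p * q) (n + k) = (\<Sum>i\<in>{n}. coeff p i * coeff q (n + k - i))"
    unfolding coeff_mult by (intro sum.mono_neutral_right) auto
  then show ?thesis by simp
qed

lemma hom_poly_mult:
  assumes "degree p \<le> n" "degree q \<le> k"
  shows "hom_poly (n + k) (p * q) a b = hom_poly n p a b * hom_poly k q a b"
proof (cases "b = 0")
  case True
  then show ?thesis using assms by (simp add: hom_poly_at_infinity coeff_mult_top power_add)
next
  case False
  moreover have "degree (p * q) \<le> n + k" using assms degree_mult_le[of p q] by linarith
  ultimately show ?thesis using assms by (simp add: hom_poly_dehom power_add)
qed

lemma monicI:
  fixes p :: "real poly"
  assumes "degree p \<le> n" "coeff p n = 1"
  shows "degree p = n \<and> lead_coeff p = 1"
proof -
  have "n \<le> degree p" using assms(2) by (intro le_degree) simp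
  then show ?thesis using assms by simp
qed

text \<open>Only common real zeros are excluded. Segments and blends stay in this class because they
  are nowhere zero on the real axis, while they need not keep polynomials coprime over the complex
  numbers.\<close>

definition real_rat :: "nat \<Rightarrow> nat \<Rightarrow> (nat \<Rightarrow> real poly) \<Rightarrow> bool" where
  "real_rat m n f \<longleftrightarrow> (\<forall>i\<le>m. degree (f i) = n \<and> lead_coeff (f i) = 1) \<and> (\<forall>x. \<exists>i\<le>m. poly (f i) x \<noteq> 0)"

lemma real_ratD:
  assumes "real_rat m n f" "i \<le> m"
  shows "degree (f i) = n" "coeff (f i) n = 1"
  using assms unfolding real_rat_def by auto

definition rat_vec :: "nat \<Rightarrow> nat \<Rightarrow> (nat \<Rightarrow> real poly) \<Rightarrow> (nat \<Rightarrow> real) \<Rightarrow> nat \<Rightarrow> real" where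
  "rat_vec m n f v = (\<lambda>i. if i \<le> m then hom_poly n (f i) (v 0) (v 1) else 0)"

definition real_loops :: "nat \<Rightarrow> nat \<Rightarrow> ((nat \<Rightarrow> real) set \<Rightarrow> (nat \<Rightarrow> real) set) set" where
  "real_loops n m = {\<phi> \<in> topspace (Omega_RP m).
     \<exists>f. real_rat m n f \<and> (\<forall>x. \<phi> (RP1_real x) = hpoint m (\<lambda>i. poly (f i) x))}"

lemma rat_vec_scale: "rat_vec m n f (\<lambda>i. c * v i) = (\<lambda>i. c ^ n * rat_vec m n f v i)"
  by (auto simp: rat_vec_def hom_poly_scale fun_eq_iff)

lemma equivar_rat_vec: "equivar (rat_vec m n f)"
  unfolding equivar_def
proof (intro ballI allI impI)
  fix v and c :: real assume "c \<noteq> 0"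
  then show "\<exists>d. d \<noteq> 0 \<and> rat_vec m n f (\<lambda>i. c * v i) = (\<lambda>i. d * rat_vec m n f v i)"
    by (intro exI[of _ "c ^ n"]) (simp add: rat_vec_scale)
qed

lemma rat_vec_in:
  assumes "real_rat m n f" "v \<in> topspace (nzvec 1)"
  shows "rat_vec m n f v \<in> topspace (nzvec m)"
proof -
  have "\<exists>i\<le>m. hom_poly n (f i) (v 0) (v 1) \<noteq> 0"
  proof (cases "v 1 = 0")
    case True
    then have "v 0 \<noteq> 0" using assms(2) nzvec_1_vec2 vec2_in by metis
    then show ?thesis using real_ratD[OF assms(1), of 0] True
      by (intro exI[of _ 0]) (auto simp: hom_poly_at_infinity)
  next
    case False
    then show ?thesis using assms(1) unfolding real_rat_def
      by (metis hom_poly_dehom mult_eq_0_iff order_refl power_not_zero)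
  qed
  then show ?thesis by (auto simp: topspace_nzvec rat_vec_def fun_eq_iff)
qed

lemma rat_vec_infinity:
  assumes "real_rat m n f"
  shows "rat_vec m n f (vec2 1 0) = (\<lambda>i. if i \<le> m then 1 else 0)"
  using real_ratD[OF assms] by (auto simp: rat_vec_def hom_poly_at_infinity)

lemma rat_vec_real:
  assumes "real_rat m n f"
  shows "rat_vec m n f (vec2 x 1) = (\<lambda>i. if i \<le> m then poly (f i) x else 0)"
  using real_ratD[OF assms] by (auto simp: rat_vec_def hom_poly_1)

lemma continuous_map_hom_poly:
  assumes "continuous_map Z euclideanreal a" "continuous_map Z euclideanreal b"
  shows "continuous_map Z euclideanreal (\<lambda>z. hom_poly n p (a z) (b z))"
  unfolding hom_poly_def
  by (intro continuous_map_sum continuous_map_real_mult continuous_map_real_pow assms) auto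

lemma RP1_cases:
  assumes "l \<in> topspace (RP 1)"
  obtains x where "l = RP1_real x" | "l = RP1_infinity"
proof -
  obtain v where v: "v \<in> topspace (nzvec 1)" "l = proj_class v" using assms topspace_RP by auto
  have vv: "v = vec2 (v 0) (v 1)" by (rule nzvec_1_vec2[OF v(1)])
  show ?thesis
  proof (cases "v 1 = 0")
    case True
    then have "v 0 \<noteq> 0" using v(1) vv vec2_in by metis
    moreover have "v = (\<lambda>i. v 0 * vec2 1 0 i)" by (subst vv) (auto simp: vec2_def True)
    ultimately have "l = RP1_infinity"
      using proj_class_scale[of "v 0"] v(2) unfolding RP1_infinity_vec2 by metis
    then show ?thesis using that by blast
  next
    case False
    moreover have "v = (\<lambda>i. v 1 * vec2 (v 0 / v 1) 1 i)" by (subst vv) (use False in \<open>auto simp: vec2_def\<close>)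
    ultimately have "l = RP1_real (v 0 / v 1)"
      using proj_class_scale[of "v 1"] v(2) unfolding RP1_real_vec2 by metis
    then show ?thesis using that by blast
  qed
qed

lemma RP1_real_in [simp]: "RP1_real x \<in> topspace (RP 1)"
  unfolding RP1_real_vec2 topspace_RP by (rule imageI) simp

lemma lift_map_rat_vec_real:
  assumes "real_rat m n f"
  shows "lift_map (rat_vec m n f) (RP1_real x) = hpoint m (\<lambda>i. poly (f i) x)"
  unfolding RP1_real_vec2
  by (subst lift_map_proj_class[OF equivar_rat_vec]) (auto simp: rat_vec_real[OF assms] hpoint_def)

lemma lift_map_rat_vec_in:
  assumes "real_rat m n f"
  shows "lift_map (rat_vec m n f) \<in> real_loops n m"
proof -
  \<comment> \<open>A one-point parameter space turns the lemma on families into membership in the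
    loop space.\<close>
  have "continuous_map (top_of_set {0::real}) (Omega_RP m) (\<lambda>_. lift_map (rat_vec m n f))"
  proof (rule continuous_map_lift_map)
    show "continuous_map (prod_topology (top_of_set {0::real}) (nzvec 1)) euclideanreal (\<lambda>p. rat_vec m n f (snd p) i)" for i
      by (cases "i \<le> m")
         (auto simp: rat_vec_def intro!: continuous_map_hom_poly continuous_map_coord_snd)
  qed (auto simp: rat_vec_infinity[OF assms] hpoint_1_proj rat_vec_in[OF assms] equivar_rat_vec)
  from continuous_map_image_subset_topspace[OF this]
  have "lift_map (rat_vec m n f) \<in> topspace (Omega_RP m)" by simp
  then show ?thesis
    using lift_map_rat_vec_real[OF assms] assms unfolding real_loops_def by blast
qed

lemma real_loops_lift_map:
  assumes "\<phi> \<in> topspace (Omega_RP m)" "real_rat m n f" "\<And>x. \<phi> (RP1_real x) = hpoint m (\<lambda>i. poly (f i) x)"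
  shows "\<phi> = lift_map (rat_vec m n f)"
proof (rule Omega_ext[OF assms(1)])
  show in_Omega: "lift_map (rat_vec m n f) \<in> topspace (Omega_RP m)"
    using lift_map_rat_vec_in[OF assms(2)] by (simp add: real_loops_def)
  fix l assume "l \<in> topspace (RP 1)"
  then show "\<phi> l = lift_map (rat_vec m n f) l"
    by (cases rule: RP1_cases)
       (use assms in_Omega in \<open>auto simp: lift_map_rat_vec_real topspace_Omega\<close>)
qed

lemma poly_map_poly_of_real: "poly (map_poly of_real p) (of_real x :: complex) = of_real (poly p x)"
  by (induction p) (simp_all add: map_poly_pCons)

lemma RRat_subset_real_loops: "RRat n m \<subseteq> real_loops n m"
proof
  fix \<phi> assume "\<phi> \<in> RRat n m"
  then obtain f where f: "\<phi> \<in> topspace (Omega_RP m)"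
      "\<forall>i\<le>m. degree (f i) = n \<and> lead_coeff (f i) = 1"
      "\<not> (\<exists>z::complex. \<forall>i\<le>m. poly (map_poly of_real (f i)) z = 0)"
      "\<forall>x. \<phi> (RP1_real x) = hpoint m (\<lambda>i. poly (f i) x)" unfolding RRat_def by blast
  have "\<exists>i\<le>m. poly (f i) x \<noteq> 0" for x
    using f(3) poly_map_poly_of_real[of _ x] by (metis of_real_0)
  then show "\<phi> \<in> real_loops n m"
    using f unfolding real_loops_def real_rat_def by blast
qed

text \<open>Adding a constant to \<open>f 0\<close> destroys the common complex zeros for all but finitely many
  values of the constant.\<close>

lemma real_loops_subset_closure:
  assumes m: "m \<ge> 1"
  shows "real_loops n m \<subseteq> Omega_RP m closure_of RRat n m"
proof
  fix \<phi> assume "\<phi> \<in> real_loops n m"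
  then obtain f where \<phi>: "\<phi> \<in> topspace (Omega_RP m)" and f: "real_rat m n f"
    and \<phi>f: "\<And>x. \<phi> (RP1_real x) = hpoint m (\<lambda>i. poly (f i) x)"
    unfolding real_loops_def by blast
  have \<phi>_eq: "\<phi> = lift_map (rat_vec m n f)" by (rule real_loops_lift_map[OF \<phi> f \<phi>f])
  have deg: "\<And>i. i \<le> m \<Longrightarrow> degree (f i) = n \<and> lead_coeff (f i) = 1" using f unfolding real_rat_def by blast
  define g where "g e i = (if i = 0 then f 0 + [:e:] else f i)" for e :: real and i :: nat
  define good where "good e \<longleftrightarrow> \<not> (\<exists>z::complex. \<forall>i\<le>m. poly (map_poly of_real (g e i)) z = 0)" for e
  have RRat_g: "lift_map (rat_vec m n (g e)) \<in> RRat n m"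
    if "good e" "\<forall>i\<le>m. degree (g e i) = n \<and> lead_coeff (g e i) = 1" for e
  proof -
    have "\<exists>i\<le>m. poly (g e i) x \<noteq> 0" for x
      using that(1) poly_map_poly_of_real[of _ x] unfolding good_def by (metis of_real_0)
    then have "real_rat m n (g e)" using that(2) unfolding real_rat_def by blast
    then show ?thesis
      using lift_map_rat_vec_in lift_map_rat_vec_real that unfolding RRat_def good_def real_loops_def by blast
  qed
  show "\<phi> \<in> Omega_RP m closure_of RRat n m"
  proof (cases "n = 0")
    \<comment> \<open>The only monic polynomial of degree 0 is 1, which has no zeros; adding a
      constant would spoil its leading coefficient.\<close>
    case True
    then have "degree (f 0) = 0" "coeff (f 0) 0 = 1" using deg[of 0] by auto
    then have "f 0 = 1" by (metis degree_0_id one_pCons)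
    then have "good 0" unfolding good_def g_def by (auto intro!: exI[of _ 0])
    moreover have "g 0 = f" by (auto simp: g_def)
    ultimately have "\<phi> \<in> RRat n m" using RRat_g[of 0] deg \<phi>_eq by auto
    then show ?thesis
      using closure_of_subset[of "RRat n m" "Omega_RP m"] by (auto simp: RRat_def)
  next
    case False
    have g_monic: "\<forall>i\<le>m. degree (g e i) = n \<and> lead_coeff (g e i) = 1" for e
    proof (intro allI impI)
      fix i assume i: "i \<le> m"
      show "degree (g e i) = n \<and> lead_coeff (g e i) = 1"
      proof (cases "i = 0")
        case True
        have "degree (f 0 + [:e:]) \<le> n" using deg[of 0] by (intro degree_add_le) auto
        moreover have "coeff (f 0 + [:e:]) n = 1" using deg[of 0] False
          by (auto simp: coeff_pCons split: nat.splits)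
        ultimately have monic: "degree (f 0 + [:e:]) = n \<and> lead_coeff (f 0 + [:e:]) = 1" by (rule monicI)
        have gi: "g e i = f 0 + [:e:]" by (simp add: g_def True)
        show ?thesis unfolding gi by (rule monic)
      qed (use deg i in \<open>auto simp: g_def\<close>)
    qed
    \<comment> \<open>Here \<open>m \<ge> 1\<close> provides a second polynomial, which the
      perturbation leaves unchanged.\<close>
    define R where "R = {z::complex. poly (map_poly of_real (f 1)) z = 0}"
    have "f 1 \<noteq> 0" using deg[of 1] m False by auto
    then have "map_poly (of_real :: real \<Rightarrow> complex) (f 1) \<noteq> 0" by (simp add: map_poly_eq_0_iff)
    then have "finite R" unfolding R_def by (rule poly_roots_finite)
    \<comment> \<open>A common zero \<open>z\<close> for the constant \<open>e\<close> is a root of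
      \<open>f 1\<close> at which \<open>f 0\<close> has the value \<open>- e\<close>, so every bad
      constant lies in \<open>B\<close>.\<close>
    define B where "B = (\<lambda>z. Re (- poly (map_poly of_real (f 0)) z)) ` R"
    have finB: "finite B" using \<open>finite R\<close> by (simp add: B_def)
    have good: "good e" if "e \<notin> B" for e
      unfolding good_def
    proof
      assume "\<exists>z::complex. \<forall>i\<le>m. poly (map_poly of_real (g e i)) z = 0"
      then obtain z :: complex where z: "\<And>i. i \<le> m \<Longrightarrow> poly (map_poly of_real (g e i)) z = 0" by blast
      have "z \<in> R" using z[of 1] m by (simp add: g_def R_def)
      moreover have "map_poly of_real (f 0 + [:e:]) = map_poly of_real (f 0) + [:complex_of_real e:]"
        by (rule poly_eqI) (auto simp: coeff_map_poly coeff_pCons split: nat.splits)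
      then have "poly (map_poly of_real (f 0)) z + of_real e = 0"
        using z[of 0] by (simp add: g_def)
      then have "- poly (map_poly of_real (f 0)) z = complex_of_real e"
        by (simp add: add_eq_0_iff2 minus_equation_iff)
      then have "e = Re (- poly (map_poly of_real (f 0)) z)" by simp
      ultimately show False using that unfolding B_def by blast
    qed
    \<comment> \<open>The constant 0 may be bad, but \<open>g 0 = f\<close> still defines a loop. It
      is approached through the complement of the finite set \<open>B\<close>, which is
      dense.\<close>
    define E where "E = insert 0 (- B)"
    have real_rat_g: "real_rat m n (g e)" if "e \<in> E" for e
    proof (cases "e = 0")
      case True
      then have "g e = f" by (auto simp: g_def)
      then show ?thesis using f by simp
    next
      case False
      then have "good e" using that good E_def by auto
      then have "\<exists>i\<le>m. poly (g e i) x \<noteq> 0" for x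
        using poly_map_poly_of_real[of _ x] unfolding good_def by (metis of_real_0)
      then show ?thesis using g_monic unfolding real_rat_def by blast
    qed
    have cont: "continuous_map (top_of_set E) (Omega_RP m) (\<lambda>e. lift_map (rat_vec m n (g e)))"
    proof (rule continuous_map_lift_map)
      fix i
      let ?Z = "prod_topology (top_of_set E) (nzvec 1)"
      have "continuous_map ?Z euclideanreal (\<lambda>p. hom_poly n (f i) (snd p 0) (snd p 1))"
        by (intro continuous_map_hom_poly continuous_map_coord_snd)
      moreover have "continuous_map ?Z euclideanreal (\<lambda>p. hom_poly n (f 0) (snd p 0) (snd p 1) + fst p * snd p 1 ^ n)"
        by (intro continuous_map_add continuous_map_hom_poly continuous_map_coord_snd continuous_map_real_mult
            continuous_map_real_pow continuous_map_into_fulltopology[OF continuous_map_fst])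
      ultimately show "continuous_map ?Z euclideanreal (\<lambda>p. rat_vec m n (g (fst p)) (snd p) i)"
        by (cases "i = 0"; cases "i \<le> m") (simp_all add: rat_vec_def g_def hom_poly_add hom_poly_const)
    qed (auto simp: rat_vec_infinity[OF real_rat_g] hpoint_1_proj rat_vec_in[OF real_rat_g] equivar_rat_vec)
    have "interior B = {}" using finB by (rule empty_interior_finite)
    then have "closure (- B) = UNIV" by (simp add: closure_complement)
    then have "0 \<in> top_of_set E closure_of (- B)"
      by (simp add: closure_of_subtopology E_def Int_absorb1 subset_insertI flip: closure_of_UNIV)
    then have "lift_map (rat_vec m n (g 0)) \<in> Omega_RP m closure_of ((\<lambda>e. lift_map (rat_vec m n (g e))) ` (- B))"
      using continuous_map_image_closure_subset[OF cont, of "- B"] by blast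
    moreover have "g 0 = f" by (auto simp: g_def)
    moreover have "(\<lambda>e. lift_map (rat_vec m n (g e))) ` (- B) \<subseteq> RRat n m"
      using RRat_g good g_monic by blast
    ultimately show ?thesis using closure_of_mono \<phi>_eq by blast
  qed
qed


definition nonorth_maps :: "nat \<Rightarrow> ((nat \<Rightarrow> real) set \<Rightarrow> (nat \<Rightarrow> real) set) \<Rightarrow> ((nat \<Rightarrow> real) set \<Rightarrow> (nat \<Rightarrow> real) set) \<Rightarrow> bool" where
  "nonorth_maps m \<phi> \<psi> \<longleftrightarrow> (\<forall>x\<in>topspace (RP 1). nonorth m (\<phi> x) (\<psi> x))"

lemma topspace_rat: "topspace (rat n m) = Omega_RP m closure_of RRat n m"
  using closure_of_subset_topspace by (fastforce simp: rat_def)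

lemma seg_map_real_loops:
  assumes \<psi>: "\<psi> \<in> real_loops k m" and \<phi>: "\<phi> \<in> real_loops n m" and no: "nonorth_maps m \<psi> \<phi>"
  shows "seg_map m t \<psi> \<phi> \<in> real_loops (2 * k + n) m"
proof -
  obtain f where f: "real_rat m k f" "\<And>x. \<psi> (RP1_real x) = hpoint m (\<lambda>i. poly (f i) x)"
    using \<psi> unfolding real_loops_def by blast
  obtain h where h: "real_rat m n h" "\<And>x. \<phi> (RP1_real x) = hpoint m (\<lambda>i. poly (h i) x)"
    using \<phi> unfolding real_loops_def by blast
  have in_O: "\<psi> \<in> topspace (Omega_RP m)" "\<phi> \<in> topspace (Omega_RP m)"
    using \<psi> \<phi> by (auto simp: real_loops_def)
  \<comment> \<open>The leading coefficient before normalisation is the sum of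
    \<open>(1 - t) + t\<close> over \<open>m + 1\<close> indices.\<close>
  define c where "c = 1 / (real m + 1)"
  define s where "s i = smult c (\<Sum>j\<le>m. smult (1 - t) (f j * h j * f i) + smult t (f j * f j * h i))" for i
  define u where "u x i = (if i \<le> m then poly (f i) x else 0)" for x i
  define v where "v x i = (if i \<le> m then poly (h i) x else 0)" for x i
  have poly_s: "(\<lambda>i. if i \<le> m then poly (s i) x else 0) = (\<lambda>i. c * seg_vec m t (u x) (v x) i)" for x
    by (auto simp: fun_eq_iff s_def seg_vec_def u_def v_def ip_def poly_sum sum.distrib sum_distrib_left
        sum_distrib_right algebra_simps)
  have monic: "degree (s i) = 2 * k + n \<and> lead_coeff (s i) = 1" if i: "i \<le> m" for i
  proof (rule monicI)
    have d: "degree (f j) \<le> k" "degree (h j) \<le> n" "coeff (f j) k = 1" "coeff (h j) n = 1" if "j \<le> m" for j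
      using real_ratD[OF f(1) that] real_ratD[OF h(1) that] by auto
    have d2: "degree (f j * h j) \<le> k + n" "degree (f j * f j) \<le> k + k" "degree (f j * h j * f i) \<le> k + n + k"
       "degree (f j * f j * h i) \<le> k + k + n" if "j \<le> m" for j
      using d[OF that] d[OF i] degree_mult_le[of "f j" "h j"] degree_mult_le[of "f j" "f j"]
       degree_mult_le[of "f j * h j" "f i"] degree_mult_le[of "f j * f j" "h i"] by linarith+
    show "degree (s i) \<le> 2 * k + n"
      unfolding s_def
    proof (intro order_trans[OF degree_smult_le] degree_sum_le)
      fix j assume "j \<in> {..m}"
      then have "degree (smult (1 - t) (f j * h j * f i)) \<le> 2 * k + n" "degree (smult t (f j * f j * h i)) \<le> 2 * k + n"
        using d2[of j] degree_smult_le[of "1 - t" "f j * h j * f i"] degree_smult_le[of t "f j * f j * h i"]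
        by simp_all
      then show "degree (smult (1 - t) (f j * h j * f i) + smult t (f j * f j * h i)) \<le> 2 * k + n"
        by (rule degree_add_le)
    qed simp
    have "coeff (f j * h j * f i) (k + n + k) = 1" "coeff (f j * f j * h i) (k + k + n) = 1" if "j \<le> m" for j
      using d[OF that] d[OF i] d2[OF that] by (simp_all add: coeff_mult_top)
    then have "coeff (f j * h j * f i) (2 * k + n) = 1" "coeff (f j * f j * h i) (2 * k + n) = 1" if "j \<le> m" for j
      using that by (simp_all add: mult_2 add_ac)
    then have "coeff (s i) (2 * k + n) = c * (\<Sum>j\<le>m. (1 - t) + t)"
      by (simp add: s_def coeff_sum)
    then show "coeff (s i) (2 * k + n) = 1" by (simp add: c_def field_simps)
  qed
  have uv: "\<psi> (RP1_real x) = proj_class (u x)" "\<phi> (RP1_real x) = proj_class (v x)" for x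
    by (simp_all add: f(2) h(2) hpoint_def u_def[abs_def] v_def[abs_def])
  have sv: "seg_vec m t (u x) (v x) \<in> topspace (nzvec m)" for x
  proof (rule seg_vec_in)
    show "u x \<in> topspace (nzvec m)" "v x \<in> topspace (nzvec m)"
      using f(1) h(1) unfolding real_rat_def topspace_nzvec u_def v_def
      by (auto simp: fun_eq_iff)
    show "ip m (u x) (v x) \<noteq> 0"
      using no uv[of x] unfolding nonorth_maps_def by (metis nonorth_proj_class RP1_real_in)
  qed
  have c: "c \<noteq> 0" by (simp add: c_def)
  have "real_rat m (2 * k + n) s"
    unfolding real_rat_def
  proof (intro conjI allI impI)
    fix x
    obtain i where "seg_vec m t (u x) (v x) i \<noteq> 0"
      using sv[of x] by (auto simp: topspace_nzvec)
    then have "(if i \<le> m then poly (s i) x else 0) \<noteq> 0"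
      using fun_cong[OF poly_s[of x], of i] c by simp
    then show "\<exists>i\<le>m. poly (s i) x \<noteq> 0" by (auto split: if_splits)
  qed (use monic in blast)+
  moreover have "seg_map m t \<psi> \<phi> (RP1_real x) = hpoint m (\<lambda>i. poly (s i) x)" for x
    unfolding hpoint_def poly_s using c by (simp add: seg_map_def uv proj_class_scale)
  moreover have "seg_map m t \<psi> \<phi> \<in> topspace (Omega_RP m)"
  proof -
    have "continuous_map (top_of_set {0::real}) (Omega_RP m) (\<lambda>_. seg_map m t \<psi> \<phi>)"
      by (rule continuous_map_seg_map) (use in_O no in \<open>auto simp: nonorth_maps_def\<close>)
    from continuous_map_image_subset_topspace[OF this] show ?thesis by simp
  qed
  ultimately show ?thesis unfolding real_loops_def by blast
qed

text \<open>Non-orthogonality to \<open>\<psi>\<close> is an open condition on which the segment is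
  continuous in \<open>\<phi>\<close>; so the case of \<open>\<phi>\<close> in
  \<open>RRat n m\<close> passes to the closure.\<close>

lemma seg_map_rat:
  assumes m: "m \<ge> 1" and \<psi>: "\<psi> \<in> real_loops k m" and \<phi>: "\<phi> \<in> topspace (rat n m)" and no: "nonorth_maps m \<psi> \<phi>"
  shows "seg_map m t \<psi> \<phi> \<in> topspace (rat (2 * k + n) m)"
proof -
  define W where "W = {\<phi> \<in> topspace (Omega_RP m). nonorth_maps m \<psi> \<phi>}"
  have \<psi>O: "\<psi> \<in> topspace (Omega_RP m)" using \<psi> by (simp add: real_loops_def)
  have W: "openin (Omega_RP m) W"
    using openin_Omega_nonorth[OF \<psi>O] by (simp add: W_def nonorth_maps_def)
  have cont: "continuous_map (subtopology (Omega_RP m) W) (Omega_RP m) (seg_map m t \<psi>)"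
  proof (rule continuous_map_seg_map[where t = "\<lambda>_. t" and a = "\<lambda>_. \<psi>" and b = "\<lambda>\<phi>. \<phi>"])
    show "continuous_map (subtopology (Omega_RP m) W) (Omega_RP m) (\<lambda>\<phi>. \<phi>)"
      by (intro continuous_map_from_subtopology) simp
  qed (use \<psi>O in \<open>auto simp: W_def nonorth_maps_def\<close>)
  have \<phi>W: "\<phi> \<in> W" "\<phi> \<in> Omega_RP m closure_of RRat n m"
    using \<phi> no closure_of_subset_topspace[of "Omega_RP m" "RRat n m"] unfolding W_def topspace_rat by blast+
  then have "\<phi> \<in> subtopology (Omega_RP m) W closure_of (W \<inter> RRat n m)"
    using openin_Int_closure_of_subset[OF W] by (auto simp: closure_of_subtopology)
  then have "seg_map m t \<psi> \<phi> \<in> Omega_RP m closure_of (seg_map m t \<psi> ` (W \<inter> RRat n m))"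
    using continuous_map_image_closure_subset[OF cont] by blast
  moreover have "seg_map m t \<psi> ` (W \<inter> RRat n m) \<subseteq> Omega_RP m closure_of RRat (2 * k + n) m"
    using seg_map_real_loops[OF \<psi>] RRat_subset_real_loops real_loops_subset_closure[OF m]
    unfolding W_def by blast
  ultimately show ?thesis
    unfolding topspace_rat using closure_of_minimal[OF _ closedin_closure_of] by blast
qed

section \<open>Lifting loops to the sphere\<close>

text \<open>A coordinate of the orthogonal projection of \<open>w\<close> to the line
  \<open>l\<close>. It gives a continuous choice of a vector on every line that is not orthogonal to
  \<open>w\<close>.\<close>

lemma continuous_map_proj_component:
  "continuous_map (RP m) euclideanreal (\<lambda>l. ip m (rep l) w / ip m (rep l) (rep l) * rep l i)"
proof (rule continuous_compose_quotient_map)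
  show "quotient_map (nzvec m) (RP m) proj_class"
    using quotient_map_quotient_topology unfolding RP_def nzvec_def by blast
  have "continuous_map (nzvec m) euclideanreal (\<lambda>v. ip m v w / ip m v v * v i)"
    by (intro continuous_map_real_mult continuous_map_real_divide continuous_map_ip continuous_map_nzvec_coord)
       (auto dest!: ip_self_pos)
  moreover have "ip m (rep (proj_class v)) w / ip m (rep (proj_class v)) (rep (proj_class v)) * rep (proj_class v) i
      = ip m v w / ip m v v * v i" for v
  proof -
    obtain c where "c \<noteq> 0" "rep (proj_class v) = (\<lambda>i. c * v i)" using rep_proj_class by metis
    then show ?thesis by simp
  qed
  ultimately show "continuous_map (nzvec m) euclideanreal
     ((\<lambda>l. ip m (rep l) w / ip m (rep l) (rep l) * rep l i) \<circ> proj_class)"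
    by (simp add: o_def)
qed

lemma path_lift_step:
  assumes \<gamma>: "continuous_map euclideanreal (RP m) \<gamma>" and w: "w \<in> topspace (nzvec m)" "\<gamma> a = proj_class w"
    and no: "\<And>t. t \<in> {a..b} \<Longrightarrow> nonorth m (\<gamma> t) (\<gamma> a)"
  obtains L where "\<And>i. continuous_on {a..b} (\<lambda>t. L t i)" "L a = w"
     "\<And>t. t \<in> {a..b} \<Longrightarrow> L t \<in> topspace (nzvec m) \<and> \<gamma> t = proj_class (L t)"
proof
  define L where "L t = (\<lambda>i. ip m (rep (\<gamma> t)) w / ip m (rep (\<gamma> t)) (rep (\<gamma> t)) * rep (\<gamma> t) i)" for t
  show "continuous_on {a..b} (\<lambda>t. L t i)" for i
    using continuous_map_compose[OF \<gamma> continuous_map_proj_component[of m w i]] unfolding L_def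
    by (auto simp: o_def intro: continuous_on_subset)
  have \<gamma>in: "\<gamma> t \<in> topspace (RP m)" for t
    using \<gamma> continuous_map_image_subset_topspace by fastforce
  show "L a = w"
  proof -
    obtain c where "c \<noteq> 0" "rep (\<gamma> a) = (\<lambda>i. c * w i)" using rep_proj_class w(2) by metis
    then show ?thesis using ip_self_pos[OF w(1)] by (simp add: L_def)
  qed
  show "L t \<in> topspace (nzvec m) \<and> \<gamma> t = proj_class (L t)" if t: "t \<in> {a..b}" for t
  proof -
    have "nonorth m (proj_class (rep (\<gamma> t))) (proj_class w)"
      using no[OF t] rep(2)[OF \<gamma>in[of t]] w(2) by simp
    then have "ip m (rep (\<gamma> t)) w \<noteq> 0" by simp
    then have c: "ip m (rep (\<gamma> t)) w / ip m (rep (\<gamma> t)) (rep (\<gamma> t)) \<noteq> 0"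
      using ip_self_pos[OF rep(1)[OF \<gamma>in[of t]]] by simp
    have "\<gamma> t = proj_class (L t)"
      unfolding L_def proj_class_scale[OF c] by (rule rep(2)[OF \<gamma>in, symmetric])
    moreover have "L t \<in> topspace (nzvec m)"
      using c rep(1)[OF \<gamma>in[of t]] unfolding L_def topspace_nzvec by (auto simp: fun_eq_iff)
    ultimately show ?thesis by blast
  qed
qed

text \<open>By uniform continuity of the squared cosine, lines at parameters closer than
  \<open>\<delta>\<close> are not orthogonal; \<open>path_lift_step\<close> is then iterated over a
  subdivision with mesh below \<open>\<delta>\<close>.\<close>

lemma path_lift:
  assumes \<gamma>: "continuous_map euclideanreal (RP m) \<gamma>" and w: "w \<in> topspace (nzvec m)" "\<gamma> 0 = proj_class w"
    and T: "T > 0"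
  obtains L where "\<And>i. continuous_on {0..T} (\<lambda>t. L t i)" "L 0 = w"
     "\<And>t. t \<in> {0..T} \<Longrightarrow> L t \<in> topspace (nzvec m) \<and> \<gamma> t = proj_class (L t)"
proof -
  have \<gamma>in: "\<gamma> t \<in> topspace (RP m)" for t
    using \<gamma> continuous_map_image_subset_topspace by fastforce
  define F where "F p = cosq_RP m (\<gamma> (fst p)) (\<gamma> (snd p))" for p :: "real \<times> real"
  have "continuous_map euclidean (prod_topology (RP m) (RP m)) (\<lambda>p::real \<times> real. (\<gamma> (fst p), \<gamma> (snd p)))"
    by (intro continuous_map_pairedI continuous_map_compose[OF _ \<gamma>, unfolded o_def])
       (auto intro!: continuous_intros)
  from continuous_map_compose[OF this continuous_map_cosq_RP]
  have "continuous_on UNIV F" by (simp add: o_def F_def[abs_def])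
  then have "uniformly_continuous_on ({0..T} \<times> {0..T}) F"
    by (intro compact_uniformly_continuous) (auto intro: continuous_on_subset compact_Times)
  \<comment> \<open>The tolerance 1 is the value of \<open>F\<close> on the diagonal, so nearby
    values remain positive.\<close>
  then obtain \<delta> where \<delta>: "\<delta> > 0"
    "\<And>p q. p \<in> {0..T} \<times> {0..T} \<Longrightarrow> q \<in> {0..T} \<times> {0..T} \<Longrightarrow> dist q p < \<delta> \<Longrightarrow> dist (F q) (F p) < 1"
    unfolding uniformly_continuous_on_def by (metis zero_less_one)
  have F1: "F (t, t) = 1" for t
    using ip_self_pos[OF rep(1)[OF \<gamma>in[of t]]] by (simp add: F_def cosq_RP_def cosq_def power2_eq_square)
  have no: "nonorth m (\<gamma> t) (\<gamma> a)" if "t \<in> {0..T}" "a \<in> {0..T}" "\<bar>t - a\<bar> < \<delta>" for t a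
  proof -
    have "dist (F (t, a)) (F (a, a)) < 1"
      by (rule \<delta>(2)) (use that in \<open>auto simp: dist_prod_def dist_real_def\<close>)
    then have "F (t, a) > 0" by (auto simp: F1 dist_real_def)
    then show ?thesis using nonorth_iff_cosq_RP[OF \<gamma>in \<gamma>in] by (simp add: F_def)
  qed
  obtain N :: nat where N: "T / \<delta> < real N" using reals_Archimedean2 by blast
  then have "N > 0" using T \<delta>(1) by (metis divide_pos_pos gr0I of_nat_0 order_less_asym)
  define d where "d = T / real N"
  have d: "d > 0" "d < \<delta>" using N \<open>N > 0\<close> T \<delta>(1) by (auto simp: d_def field_simps)
  have "\<exists>L. (\<forall>i. continuous_on {0..real n * d} (\<lambda>t. L t i)) \<and> L 0 = w \<and>
     (\<forall>t\<in>{0..real n * d}. L t \<in> topspace (nzvec m) \<and> \<gamma> t = proj_class (L t))" if "n \<le> N" for n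
    using that
  proof (induction n)
    case 0
    then show ?case using w by (intro exI[of _ "\<lambda>_. w"]) auto
  next
    case (Suc n)
    have "n \<le> N" using Suc.prems by simp
    from Suc.IH[OF this]
    obtain L where L: "\<And>i. continuous_on {0..real n * d} (\<lambda>t. L t i)" "L 0 = w"
      "\<And>t. t \<in> {0..real n * d} \<Longrightarrow> L t \<in> topspace (nzvec m) \<and> \<gamma> t = proj_class (L t)" by metis
    define a where "a = real n * d"
    define b where "b = real (Suc n) * d"
    have ab: "b = a + d" "a \<ge> 0" "b \<le> T"
    proof -
      have "real (Suc n) * d \<le> real N * d" using Suc(2) d by (intro mult_right_mono) auto
      then show "b \<le> T" using \<open>N > 0\<close> by (simp add: b_def d_def)
    qed (use d in \<open>auto simp: a_def b_def algebra_simps\<close>)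
    have La: "L a \<in> topspace (nzvec m)" "\<gamma> a = proj_class (L a)" using L(3)[of a] ab d by (auto simp: a_def)
    obtain L' where L': "\<And>i. continuous_on {a..b} (\<lambda>t. L' t i)" "L' a = L a"
      "\<And>t. t \<in> {a..b} \<Longrightarrow> L' t \<in> topspace (nzvec m) \<and> \<gamma> t = proj_class (L' t)"
      by (rule path_lift_step[OF \<gamma> La, of b]) (use ab d in \<open>auto intro!: no\<close>)
    define M where "M t = (if t \<le> a then L t else L' t)" for t
    have "continuous_on {0..b} (\<lambda>t. M t i)" for i
    proof -
      have "continuous_on {0..b} (\<lambda>t. if t \<le> a then L t i else L' t i)"
        by (rule continuous_on_cases_le)
           (use L(1)[of i] L'(1)[of i] L'(2) ab in \<open>auto simp: a_def intro: continuous_on_subset\<close>)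
      then show ?thesis by (simp add: M_def if_distrib[of "\<lambda>f. f i"])
    qed
    moreover have "M 0 = w" using ab L(2) by (simp add: M_def)
    moreover have "M t \<in> topspace (nzvec m) \<and> \<gamma> t = proj_class (M t)" if "t \<in> {0..b}" for t
      using L(3)[of t] L'(3)[of t] that by (auto simp: M_def a_def)
    ultimately show ?case by (intro exI[of _ M]) (auto simp: b_def)
  qed
  then obtain L where "(\<forall>i. continuous_on {0..real N * d} (\<lambda>t. L t i)) \<and> L 0 = w \<and>
     (\<forall>t\<in>{0..real N * d}. L t \<in> topspace (nzvec m) \<and> \<gamma> t = proj_class (L t))" by blast
  moreover have "real N * d = T" using \<open>N > 0\<close> by (simp add: d_def)
  ultimately show ?thesis using that[of L] by metis
qed

text \<open>Placed in a Euclidean space type, as Stone-Weierstrass requires, rather than among the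
  functions that make up \<open>nzvec 1\<close>.\<close>

definition unit_circle :: "(real \<times> real) set" where
  "unit_circle = {p. (fst p)\<^sup>2 + (snd p)\<^sup>2 = 1}"

text \<open>The circle covers the projective line twice. The loop is lifted over the upper half
  circle, at whose ends the lift differs by the sign \<open>s\<close>; the lower half is then forced
  by \<open>ell (- p) = s * ell p\<close>. The sign \<open>s\<close> becomes the parity of the
  degree of the approximating polynomials.\<close>

lemma circle_lift:
  assumes \<phi>: "\<phi> \<in> topspace (Omega_RP m)"
  obtains ell and s :: real where "s = 1 \<or> s = - 1" "\<forall>i. continuous_on unit_circle (\<lambda>p. ell p i)"
    "\<forall>p\<in>unit_circle. ell p \<in> topspace (nzvec m) \<and> ip m (ell p) (ell p) = real m + 1 \<and>
        \<phi> (proj_class (vec2 (fst p) (snd p))) = proj_class (ell p) \<and> (\<forall>i. ell (- p) i = s * ell p i)"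
    "ell (1, 0) = (\<lambda>i. if i \<le> m then 1 else 0)"
proof -
  define u0 :: "nat \<Rightarrow> real" where "u0 = (\<lambda>i. if i \<le> m then 1 else 0)"
  have ip_u0: "ip m u0 u0 = real m + 1" by (simp add: ip_def u0_def)
  have u0: "u0 \<in> topspace (nzvec m)" by (auto simp: topspace_nzvec u0_def fun_eq_iff intro!: exI[of _ 0])
  define \<gamma> where "\<gamma> = \<phi> \<circ> circ"
  have \<gamma>: "continuous_map euclideanreal (RP m) \<gamma>"
    unfolding \<gamma>_def using \<phi> continuous_map_circ by (auto simp: topspace_Omega intro: continuous_map_compose)
  have base: "\<phi> (proj_class (vec2 1 0)) = proj_class u0"
    using \<phi> by (simp add: topspace_Omega RP1_infinity_vec2 hpoint_1_proj u0_def)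
  have "\<gamma> 0 = proj_class u0" using base by (simp add: \<gamma>_def circ_def)
  from path_lift[OF \<gamma> u0 this pi_gt_zero]
  obtain L0 where L0: "\<And>i. continuous_on {0..pi} (\<lambda>t. L0 t i)" "L0 0 = u0"
     "\<And>t. t \<in> {0..pi} \<Longrightarrow> L0 t \<in> topspace (nzvec m) \<and> \<gamma> t = proj_class (L0 t)" by metis
  \<comment> \<open>Rescaled to the norm of the vector of ones, so that the initial value is
    kept.\<close>
  define L where "L t = (\<lambda>i. sqrt (real m + 1) / sqrt (ip m (L0 t) (L0 t)) * L0 t i)" for t
  have pos: "ip m (L0 t) (L0 t) > 0" if "t \<in> {0..pi}" for t using L0(3)[OF that] ip_self_pos by blast
  have contL: "continuous_on {0..pi} (\<lambda>t. L t i)" for i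
    unfolding L_def ip_def
    by (intro continuous_intros L0(1)) (use pos in \<open>force simp: ip_def\<close>)
  have L_0: "L 0 = u0" using ip_u0 by (simp add: L_def L0(2))
  have L: "L t \<in> topspace (nzvec m)" "\<gamma> t = proj_class (L t)" "ip m (L t) (L t) = real m + 1"
    if t: "t \<in> {0..pi}" for t
  proof -
    define c where "c = sqrt (real m + 1) / sqrt (ip m (L0 t) (L0 t))"
    have c: "c \<noteq> 0" "c * c = (real m + 1) / ip m (L0 t) (L0 t)"
      using pos[OF t] by (auto simp: c_def)
    have Lt: "L t = (\<lambda>i. c * L0 t i)" by (simp add: L_def c_def)
    show "L t \<in> topspace (nzvec m)" using c L0(3)[OF t] unfolding Lt topspace_nzvec by (auto simp: fun_eq_iff)
    show "\<gamma> t = proj_class (L t)" using L0(3)[OF t] by (simp add: Lt proj_class_scale c(1))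
    show "ip m (L t) (L t) = real m + 1"
      unfolding Lt ip_scale mult.assoc[symmetric] c(2) using pos[OF t] by simp
  qed
  have "proj_class (L pi) = proj_class u0"
  proof -
    have "\<gamma> pi = \<phi> (proj_class (\<lambda>i. (- 1) * vec2 1 0 i))"
      unfolding \<gamma>_def circ_def o_def by (rule arg_cong[where f = "\<lambda>v. \<phi> (proj_class v)"]) (auto simp: vec2_def)
    also have "\<dots> = proj_class u0" using proj_class_scale[of "-1" "vec2 1 0"] base by simp
    finally show ?thesis using L(2)[of pi] by simp
  qed
  then obtain s where s: "s \<noteq> 0" "L pi = (\<lambda>i. s * u0 i)" using proj_class_eq_iff by blast
  have "s * s * (real m + 1) = real m + 1" using L(3)[of pi] unfolding s(2) ip_scale ip_u0 by simp
  then have "s * s = 1" by simp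
  then have s1: "s = 1 \<or> s = -1" using square_eq_1_iff by blast
  define ell where "ell p = (if snd p \<ge> 0 then L (arccos (fst p)) else (\<lambda>i. s * L (arccos (- fst p)) i))" for p :: "real \<times> real"
  have bd: "- 1 \<le> fst p \<and> fst p \<le> 1" if "p \<in> unit_circle" for p
  proof -
    have "(fst p)\<^sup>2 \<le> 1" using that unfolding unit_circle_def by (smt (verit) mem_Collect_eq zero_le_power2)
    then show ?thesis by (simp add: abs_square_le_1 abs_le_iff)
  qed
  have arc: "arccos (fst p) \<in> {0..pi}" "arccos (- fst p) \<in> {0..pi}" if "p \<in> unit_circle" for p
    using bd[OF that] by (auto intro: arccos_lbound arccos_ubound)
  \<comment> \<open>At these two points the formulas for the two half circles have to agree.\<close>
  have zero: "fst p = 1 \<or> fst p = - 1" if "p \<in> unit_circle" "snd p = 0" for p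
    using that by (auto simp: unit_circle_def power2_eq_1_iff)
  have neg: "ell (- p) i = s * ell p i" if p: "p \<in> unit_circle" for p i
  proof -
    consider "snd p > 0" | "snd p < 0" | "snd p = 0" by linarith
    then show ?thesis
    proof cases
      case 1 then show ?thesis by (simp add: ell_def)
    next
      case 2 then show ?thesis using \<open>s * s = 1\<close> by (simp add: ell_def flip: mult.assoc)
    next
      case 3
      then show ?thesis using zero[OF p 3] L_0 s(2) \<open>s * s = 1\<close> by (auto simp: ell_def simp flip: mult.assoc)
    qed
  qed
  show ?thesis
  proof (rule that[of s ell])
    show "s = 1 \<or> s = - 1" by (rule s1)
    show "ell (1, 0) = (\<lambda>i. if i \<le> m then 1 else 0)" using L_0 by (simp add: ell_def u0_def)
    show "\<forall>i. continuous_on unit_circle (\<lambda>p. ell p i)"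
    proof
      fix i
      have "continuous_on unit_circle (\<lambda>p. if snd p \<le> 0 then s * L (arccos (- fst p)) i else L (arccos (fst p)) i)"
      proof (rule continuous_on_cases_le)
        show "continuous_on {t \<in> unit_circle. snd t \<le> 0} (\<lambda>p. s * L (arccos (- fst p)) i)"
          by (intro continuous_on_mult continuous_on_const continuous_on_compose2[OF contL[of i]] continuous_intros)
             (use bd arc in force)+
        show "continuous_on {t \<in> unit_circle. 0 \<le> snd t} (\<lambda>p. L (arccos (fst p)) i)"
          by (intro continuous_on_compose2[OF contL[of i]] continuous_intros)
             (use bd arc in force)+
        show "continuous_on unit_circle snd" by (intro continuous_intros)
        show "s * L (arccos (- fst t)) i = L (arccos (fst t)) i" if "t \<in> unit_circle" "snd t = 0" for t
          using zero[OF that] L_0 s(2) \<open>s * s = 1\<close> by (auto simp flip: mult.assoc)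
      qed
      then show "continuous_on unit_circle (\<lambda>p. ell p i)"
      proof (rule continuous_on_eq)
        fix p assume p: "p \<in> unit_circle"
        show "(if snd p \<le> 0 then s * L (arccos (- fst p)) i else L (arccos (fst p)) i) = ell p i"
        proof (cases "snd p = 0")
          case True
          then show ?thesis using zero[OF p True] L_0 s(2) \<open>s * s = 1\<close> by (auto simp: ell_def simp flip: mult.assoc)
        qed (auto simp: ell_def)
      qed
    qed
    have up: "ell p \<in> topspace (nzvec m) \<and> ip m (ell p) (ell p) = real m + 1 \<and>
        \<phi> (proj_class (vec2 (fst p) (snd p))) = proj_class (ell p)" if p: "p \<in> unit_circle" "snd p \<ge> 0" for p
    proof -
      define t where "t = arccos (fst p)"
      have t: "t \<in> {0..pi}" using arc[OF p(1)] by (simp add: t_def)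
      have "cos t = fst p" using bd[OF p(1)] by (simp add: t_def)
      moreover have "sin t = snd p"
      proof -
        have "(sin t)\<^sup>2 = (snd p)\<^sup>2" using p(1) sin_cos_squared_add[of t] \<open>cos t = fst p\<close> by (simp add: unit_circle_def)
        moreover have "sin t \<ge> 0" using t by (simp add: sin_ge_zero)
        ultimately show ?thesis using p(2) by (simp add: power2_eq_iff_nonneg)
      qed
      ultimately have "\<phi> (proj_class (vec2 (fst p) (snd p))) = \<gamma> t" by (simp add: \<gamma>_def circ_def)
      then show ?thesis using L[OF t] p(2) by (simp add: ell_def t_def)
    qed
    show "\<forall>p\<in>unit_circle. ell p \<in> topspace (nzvec m) \<and> ip m (ell p) (ell p) = real m + 1 \<and>
        \<phi> (proj_class (vec2 (fst p) (snd p))) = proj_class (ell p) \<and> (\<forall>i. ell (- p) i = s * ell p i)"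
    proof
      fix p assume p: "p \<in> unit_circle"
      show "ell p \<in> topspace (nzvec m) \<and> ip m (ell p) (ell p) = real m + 1 \<and>
          \<phi> (proj_class (vec2 (fst p) (snd p))) = proj_class (ell p) \<and> (\<forall>i. ell (- p) i = s * ell p i)"
      proof (cases "snd p \<ge> 0")
        case True
        then show ?thesis using up[OF p] neg[OF p] by blast
      next
        case False
        have mp: "- p \<in> unit_circle" "snd (- p) \<ge> 0" using p False by (auto simp: unit_circle_def)
        have ellp: "ell p = (\<lambda>i. s * ell (- p) i)" using neg[OF mp(1)] by auto
        have "proj_class (vec2 (fst p) (snd p)) = proj_class (\<lambda>i. (- 1) * vec2 (fst (- p)) (snd (- p)) i)"
          by (rule arg_cong[where f = proj_class]) (auto simp: vec2_def)
        then have "\<phi> (proj_class (vec2 (fst p) (snd p))) = \<phi> (proj_class (vec2 (fst (- p)) (snd (- p))))"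
          using proj_class_scale[of "- 1"] by simp
        also have "\<dots> = proj_class (ell p)"
          using up[OF mp] s(1) ellp proj_class_scale[of s "ell (- p)"] by simp
        finally have "\<phi> (proj_class (vec2 (fst p) (snd p))) = proj_class (ell p)" .
        moreover have "ip m (ell p) (ell p) = real m + 1"
          using up[OF mp] \<open>s * s = 1\<close> by (simp add: ellp flip: mult.assoc)
        moreover have "ell p \<in> topspace (nzvec m)"
          using up[OF mp] s(1) unfolding ellp topspace_nzvec by (auto simp: fun_eq_iff)
        ultimately show ?thesis using neg[OF p] by blast
      qed
    qed
  qed
qed

section \<open>Rational approximation of loops\<close>

text \<open>As functions on the circle, homogeneous polynomials of degree \<open>n\<close> are also
  homogeneous of degree \<open>n + 2\<close>, so only the parity of \<open>n\<close> is intrinsic: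
  it decides the behaviour under the antipode.\<close>

definition circ_poly :: "nat \<Rightarrow> (real \<times> real \<Rightarrow> real) \<Rightarrow> bool" where
  "circ_poly n F \<longleftrightarrow> (\<exists>p. degree p \<le> n \<and> (\<forall>z\<in>unit_circle. F z = hom_poly n p (fst z) (snd z)))"

lemma circ_poly_mult:
  assumes "circ_poly n F" "circ_poly k G"
  shows "circ_poly (n + k) (\<lambda>z. F z * G z)"
proof -
  obtain p q where "degree p \<le> n" "\<forall>z\<in>unit_circle. F z = hom_poly n p (fst z) (snd z)"
    "degree q \<le> k" "\<forall>z\<in>unit_circle. G z = hom_poly k q (fst z) (snd z)"
    using assms unfolding circ_poly_def by blast
  then show ?thesis
    unfolding circ_poly_def
    by (intro exI[of _ "p * q"]) (auto simp: hom_poly_mult intro: order_trans[OF degree_mult_le])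
qed

lemma circ_poly_add:
  assumes "circ_poly n F" "circ_poly n G"
  shows "circ_poly n (\<lambda>z. F z + G z)"
proof -
  obtain p q where "degree p \<le> n" "\<forall>z\<in>unit_circle. F z = hom_poly n p (fst z) (snd z)"
    "degree q \<le> n" "\<forall>z\<in>unit_circle. G z = hom_poly n q (fst z) (snd z)"
    using assms unfolding circ_poly_def by blast
  then show ?thesis
    unfolding circ_poly_def
    by (intro exI[of _ "p + q"]) (auto simp: hom_poly_add intro: degree_add_le)
qed

text \<open>Multiplication by \<open>(a\<^sup>2 + b\<^sup>2) ^ k\<close>, which is 1 on the circle.\<close>

lemma circ_poly_raise:
  assumes "circ_poly n F"
  shows "circ_poly (n + 2 * k) F"
proof (induction k)
  case (Suc k)
  have "circ_poly 2 (\<lambda>_. 1)"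
    unfolding circ_poly_def
    by (intro exI[of _ "[:1, 0, 1:]"]) (auto simp: hom_poly_def unit_circle_def numeral_2_eq_2)
  from circ_poly_mult[OF Suc this] show ?case by (simp add: algebra_simps)
qed (use assms in simp)

lemma circ_poly_raise':
  assumes "circ_poly n F" "n \<le> k" "even n \<longleftrightarrow> even k"
  shows "circ_poly k F"
proof -
  have "even (k - n)" using assms(2,3) by simp
  then obtain j where "k - n = 2 * j" by (elim evenE)
  then have "k = n + 2 * j" using assms(2) by linarith
  then show ?thesis using circ_poly_raise[OF assms(1)] by simp
qed

lemma circ_poly_minus:
  assumes "circ_poly n F" "z \<in> unit_circle"
  shows "F (- z) = (- 1) ^ n * F z"
proof -
  obtain p where p: "\<forall>z\<in>unit_circle. F z = hom_poly n p (fst z) (snd z)"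
    using assms(1) unfolding circ_poly_def by blast
  have "- z \<in> unit_circle" using assms(2) by (simp add: unit_circle_def)
  then show ?thesis using p assms(2) hom_poly_scale[of n p "-1" "fst z" "snd z"] by simp
qed

text \<open>A polynomial splits into terms of even and of odd degree; on the circle each part can be
  made homogeneous.\<close>

lemma circ_poly_of_real_polynomial_function:
  assumes "real_polynomial_function g"
  shows "\<exists>n F G. circ_poly (2 * n) F \<and> circ_poly (2 * n + 1) G \<and> (\<forall>z\<in>unit_circle. g z = F z + G z)"
  using assms
proof (induction g rule: real_polynomial_function.induct)
  case (linear g)
  interpret bounded_linear g by fact
  have g: "g z = fst z * g (1, 0) + snd z * g (0, 1)" for z
  proof -
    have "z = fst z *\<^sub>R (1, 0) + snd z *\<^sub>R (0, 1)" by (cases z) simp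
    then have "g z = g (fst z *\<^sub>R (1, 0) + snd z *\<^sub>R (0, 1))" by simp
    then show ?thesis by (simp only: add scaleR real_scaleR_def)
  qed
  have "circ_poly (2 * 0) (\<lambda>_. 0)"
    unfolding circ_poly_def by (intro exI[of _ 0]) (auto simp: hom_poly_def)
  \<comment> \<open>The constant coefficient belongs to the second coordinate, as homogenisation
    pads with powers of it.\<close>
  moreover have "circ_poly (2 * 0 + 1) g"
    unfolding circ_poly_def
    by (intro exI[of _ "[:g (0, 1), g (1, 0):]"] conjI ballI, simp add: One_nat_def, subst g)
       (simp add: hom_poly_def One_nat_def)
  ultimately show ?case
    by (intro exI[of _ 0] exI[of _ "\<lambda>_. 0"] exI[of _ g]) simp
next
  case (const c)
  have "circ_poly (2 * 0) (\<lambda>_. c)"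
    unfolding circ_poly_def by (intro exI[of _ "[:c:]"]) (auto simp: hom_poly_def)
  moreover have "circ_poly (2 * 0 + 1) (\<lambda>_. 0)"
    unfolding circ_poly_def by (intro exI[of _ 0]) (auto simp: hom_poly_def)
  ultimately show ?case
    by (intro exI[of _ 0] exI[of _ "\<lambda>_. c"] exI[of _ "\<lambda>_. 0"]) simp
next
  case (add f g)
  obtain n F G where 1: "circ_poly (2 * n) F" "circ_poly (2 * n + 1) G" "\<forall>z\<in>unit_circle. f z = F z + G z"
    using add.IH by blast
  obtain k F' G' where 2: "circ_poly (2 * k) F'" "circ_poly (2 * k + 1) G'" "\<forall>z\<in>unit_circle. g z = F' z + G' z"
    using add.IH by blast
  have "circ_poly (2 * (n + k)) F" "circ_poly (2 * (n + k)) F'" "circ_poly (2 * (n + k) + 1) G" "circ_poly (2 * (n + k) + 1) G'"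
    by (rule circ_poly_raise'[OF 1(1)] circ_poly_raise'[OF 1(2)] circ_poly_raise'[OF 2(1)] circ_poly_raise'[OF 2(2)]; simp)+
  then show ?case
    using 1(3) 2(3)
    by (intro exI[of _ "n + k"] exI[of _ "\<lambda>z. F z + F' z"] exI[of _ "\<lambda>z. G z + G' z"]) (auto intro: circ_poly_add)
next
  case (mult f g)
  obtain n F G where 1: "circ_poly (2 * n) F" "circ_poly (2 * n + 1) G" "\<forall>z\<in>unit_circle. f z = F z + G z"
    using mult.IH by blast
  obtain k F' G' where 2: "circ_poly (2 * k) F'" "circ_poly (2 * k + 1) G'" "\<forall>z\<in>unit_circle. g z = F' z + G' z"
    using mult.IH by blast
  \<comment> \<open>The product of the odd parts has degree \<open>2 * n + 1 + (2 * k + 1)\<close>,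
    whence the witness \<open>n + k + 1\<close>.\<close>
  have "circ_poly (2 * (n + k + 1)) (\<lambda>z. F z * F' z + G z * G' z)"
    by (intro circ_poly_add circ_poly_raise'[OF circ_poly_mult[OF 1(1) 2(1)]] circ_poly_raise'[OF circ_poly_mult[OF 1(2) 2(2)]]) simp_all
  moreover have "circ_poly (2 * (n + k + 1) + 1) (\<lambda>z. F z * G' z + G z * F' z)"
    by (intro circ_poly_add circ_poly_raise'[OF circ_poly_mult[OF 1(1) 2(2)]] circ_poly_raise'[OF circ_poly_mult[OF 1(2) 2(1)]]) simp_all
  ultimately show ?case
    using 1(3) 2(3)
    by (intro exI[of _ "n + k + 1"] exI[of _ "\<lambda>z. F z * F' z + G z * G' z"] exI[of _ "\<lambda>z. F z * G' z + G z * F' z"])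
       (auto simp: algebra_simps)
qed

lemma circ_poly_approx:
  fixes ell :: "real \<times> real \<Rightarrow> real" and s :: real
  assumes cont: "continuous_on unit_circle ell" and sym: "\<And>z. z \<in> unit_circle \<Longrightarrow> ell (- z) = s * ell z"
    and s: "s = 1 \<or> s = - 1" and e: "e > 0"
  obtains n F where "circ_poly n F" "even n \<longleftrightarrow> s = 1" "\<And>z. z \<in> unit_circle \<Longrightarrow> \<bar>ell z - F z\<bar> < e"
proof -
  have "compact unit_circle"
  proof -
    have "unit_circle = sphere 0 1"
      by (auto simp: unit_circle_def dist_prod_def)
    then show ?thesis using compact_sphere[of "0 :: real \<times> real" 1] by metis
  qed
  then obtain g where g: "real_polynomial_function g" "\<And>z. z \<in> unit_circle \<Longrightarrow> \<bar>ell z - g z\<bar> < e"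
    using Stone_Weierstrass_real_polynomial_function[OF _ cont e] by blast
  obtain n F G where F: "circ_poly (2 * n) F" and G: "circ_poly (2 * n + 1) G"
    and FG: "\<And>z. z \<in> unit_circle \<Longrightarrow> g z = F z + G z"
    using circ_poly_of_real_polynomial_function[OF g(1)] by blast
  \<comment> \<open>The second bound is the approximation at \<open>- z\<close>. Half the sum or
    half the difference of the two isolates the part with the parity of \<open>ell\<close>, without
    loss in \<open>e\<close>.\<close>
  have bounds: "\<bar>ell z - (F z + G z)\<bar> < e \<and> \<bar>s * ell z - (F z - G z)\<bar> < e" if z: "z \<in> unit_circle" for z
  proof -
    have mz: "- z \<in> unit_circle" using z by (simp add: unit_circle_def)
    have "F (- z) = F z" "G (- z) = - G z"
      using circ_poly_minus[OF F z] circ_poly_minus[OF G z] by simp_all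
    then show ?thesis using g(2)[OF z] g(2)[OF mz] FG[OF z] FG[OF mz] sym[OF z] by simp
  qed
  show ?thesis
  proof (cases "s = 1")
    case True
    have "\<bar>ell z - F z\<bar> < e" if "z \<in> unit_circle" for z
      using bounds[OF that] unfolding True by linarith
    then show ?thesis using that[OF F] True by simp
  next
    case False
    then have s: "s = - 1" using s by simp
    have "\<bar>ell z - G z\<bar> < e" if "z \<in> unit_circle" for z
      using bounds[OF that] unfolding s by linarith
    then show ?thesis using that[OF G] s by simp
  qed
qed

lemma monic_rational_approx:
  assumes deg: "degree p \<le> N" and lead: "\<bar>coeff p N - 1\<bar> < e"
  obtains q where "degree q = N" "coeff q N = 1" "\<And>j. coeff q j \<in> \<rat>"
    "\<And>z. z \<in> unit_circle \<Longrightarrow> \<bar>hom_poly N q (fst z) (snd z) - hom_poly N p (fst z) (snd z)\<bar> \<le> 2 * e"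
proof -
  have e: "e > 0" using lead by linarith
  define d where "d = e / (real N + 1)"
  have d: "d > 0" using e by (simp add: d_def)
  \<comment> \<open>Error budget: monomials are bounded by 1 on the circle, rounding costs
    \<open>d\<close> for each of the \<open>N + 1\<close> coefficients, and setting the leading one
    to 1 costs \<open>e\<close> more, in total \<open>2 * e\<close>.\<close>
  define b where "b j = d + (if j = N then e else 0)" for j
  have "\<exists>r. r \<in> \<rat> \<and> \<bar>r - coeff p j\<bar> \<le> b j \<and> (j = N \<longrightarrow> r = 1)" for j
  proof (cases "j = N")
    case True
    then show ?thesis using lead d by (intro exI[of _ 1]) (simp add: b_def)
  next
    case False
    obtain r where "r \<in> \<rat>" "coeff p j - d < r" "r < coeff p j + d"
      using Rats_dense_in_real[of "coeff p j - d" "coeff p j + d"] d by auto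
    then show ?thesis using False by (intro exI[of _ r]) (auto simp: b_def)
  qed
  then obtain r where r: "\<And>j. r j \<in> \<rat>" "\<And>j. \<bar>r j - coeff p j\<bar> \<le> b j" "r N = 1" by metis
  define q where "q = (\<Sum>j\<le>N. monom (r j) j)"
  have cq: "coeff q j = (if j \<le> N then r j else 0)" for j
    by (auto simp: q_def coeff_sum if_distrib cong: if_cong)
  have "degree q \<le> N" by (rule degree_le) (simp add: cq)
  show ?thesis
  proof (rule that[of q])
    show "coeff q N = 1" by (simp add: cq r(3))
    then show "degree q = N" using monicI[OF \<open>degree q \<le> N\<close>] by blast
    show "coeff q j \<in> \<rat>" for j by (simp add: cq r(1))
    fix z assume z: "z \<in> unit_circle"
    have le1: "\<bar>fst z\<bar> \<le> 1" "\<bar>snd z\<bar> \<le> 1"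
    proof -
      have "(fst z)\<^sup>2 \<le> 1" "(snd z)\<^sup>2 \<le> 1" using z unfolding unit_circle_def
        by (smt (verit) mem_Collect_eq zero_le_power2)+
      then show "\<bar>fst z\<bar> \<le> 1" "\<bar>snd z\<bar> \<le> 1" by (simp_all add: abs_square_le_1)
    qed
    have "\<bar>hom_poly N q (fst z) (snd z) - hom_poly N p (fst z) (snd z)\<bar> =
       \<bar>\<Sum>j\<le>N. (r j - coeff p j) * (fst z ^ j * snd z ^ (N - j))\<bar>"
      by (simp add: hom_poly_def cq algebra_simps flip: sum_subtractf)
    also have "\<dots> \<le> (\<Sum>j\<le>N. \<bar>(r j - coeff p j) * (fst z ^ j * snd z ^ (N - j))\<bar>)" by (rule sum_abs)
    also have "\<dots> \<le> (\<Sum>j\<le>N. b j)"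
    proof (rule sum_mono)
      fix j
      have "\<bar>fst z ^ j * snd z ^ (N - j)\<bar> \<le> 1"
        unfolding abs_mult power_abs by (intro mult_le_one power_le_one le1) auto
      then have "\<bar>r j - coeff p j\<bar> * \<bar>fst z ^ j * snd z ^ (N - j)\<bar> \<le> b j * 1"
        using r(2)[of j] e d by (intro mult_mono) (auto simp: b_def)
      then show "\<bar>(r j - coeff p j) * (fst z ^ j * snd z ^ (N - j))\<bar> \<le> b j" by (simp add: abs_mult)
    qed
    also have "\<dots> = 2 * e"
    proof -
      have "(\<Sum>j\<le>N. b j) = (real N + 1) * d + e" by (simp add: b_def sum.distrib)
      also have "(real N + 1) * d = e" by (simp add: d_def)
      finally show ?thesis by simp
    qed
    finally show "\<bar>hom_poly N q (fst z) (snd z) - hom_poly N p (fst z) (snd z)\<bar> \<le> 2 * e" .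
  qed
qed


lemma unit_circle_RP1:
  assumes "l \<in> topspace (RP 1)"
  obtains z where "z \<in> unit_circle" "l = proj_class (vec2 (fst z) (snd z))"
proof -
  obtain \<theta> where "l = circ \<theta>" using circ_surj[OF assms] .
  then show ?thesis using that[of "(cos \<theta>, sin \<theta>)"] by (simp add: circ_def unit_circle_def)
qed

text \<open>The bound 4/5 lies strictly above the threshold 3/4 of \<open>closeness\<close>, so it
  leaves a positive margin after taking the infimum over the circle.\<close>

lemma rational_loop_approx:
  assumes \<phi>: "\<phi> \<in> topspace (Omega_RP m)"
  obtains N h where "real_rat m N h" "\<And>i j. coeff (h i) j \<in> \<rat>" "\<And>i. i > m \<Longrightarrow> h i = 0"
    "\<And>l. l \<in> topspace (RP 1) \<Longrightarrow> cosq_RP m (\<phi> l) (lift_map (rat_vec m N h) l) \<ge> 4 / 5"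
proof -
  obtain ell and s :: real where s: "s = 1 \<or> s = - 1" and cont: "\<forall>i. continuous_on unit_circle (\<lambda>p. ell p i)"
    and ell': "\<forall>p\<in>unit_circle. ell p \<in> topspace (nzvec m) \<and> ip m (ell p) (ell p) = real m + 1 \<and>
        \<phi> (proj_class (vec2 (fst p) (snd p))) = proj_class (ell p) \<and> (\<forall>i. ell (- p) i = s * ell p i)"
    and ell0: "ell (1, 0) = (\<lambda>i. if i \<le> m then 1 else 0)"
    by (rule circle_lift[OF \<phi>])
  note ell = bspec[OF ell']
  \<comment> \<open>One third of the error 1/100 per coordinate; rounding the coefficients takes the
    other two thirds.\<close>
  have "\<exists>n F. circ_poly n F \<and> (even n \<longleftrightarrow> s = 1) \<and> (\<forall>z\<in>unit_circle. \<bar>ell z i - F z\<bar> < 1 / 300)" for i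
  proof -
    have "\<And>z. z \<in> unit_circle \<Longrightarrow> ell (- z) i = s * ell z i" using ell by blast
    from circ_poly_approx[OF spec[OF cont] this s, of "1/300"] show ?thesis
      by (metis zero_less_divide_1_iff zero_less_numeral)
  qed
  then obtain n F where F: "\<And>i. circ_poly (n i) (F i)" "\<And>i. even (n i) \<longleftrightarrow> s = 1"
     "\<And>i z. z \<in> unit_circle \<Longrightarrow> \<bar>ell z i - F i z\<bar> < 1 / 300"
    by metis
  \<comment> \<open>A common degree for all coordinates: large enough, and of the parity that
    \<open>s\<close> prescribes.\<close>
  define N where "N = 2 * (\<Sum>i\<le>m. n i) + (if s = 1 then 0 else 1)"
  have "\<exists>q. degree q = N \<and> coeff q N = 1 \<and> (\<forall>j. coeff q j \<in> \<rat>) \<and>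
     (\<forall>z\<in>unit_circle. \<bar>ell z i - hom_poly N q (fst z) (snd z)\<bar> \<le> 1 / 100)" if i: "i \<le> m" for i
  proof -
    have "n i \<le> (\<Sum>i\<le>m. n i)" using i by (intro member_le_sum) auto
    then have "n i \<le> N" by (simp add: N_def)
    moreover have "even (n i) \<longleftrightarrow> even N" using F(2)[of i] by (simp add: N_def)
    ultimately have "circ_poly N (F i)" using circ_poly_raise'[OF F(1)] by blast
    then obtain p where p: "degree p \<le> N" "\<And>z. z \<in> unit_circle \<Longrightarrow> F i z = hom_poly N p (fst z) (snd z)"
      unfolding circ_poly_def by blast
    have one: "(1, 0) \<in> unit_circle" by (simp add: unit_circle_def)
    \<comment> \<open>The lift is the vector of ones at infinity, so the approximants are almost
      monic already.\<close>
    have "\<bar>coeff p N - 1\<bar> < 1 / 300"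
      using F(3)[OF one, of i] p(2)[OF one] ell0 i by (simp add: hom_poly_at_infinity abs_minus_commute)
    from monic_rational_approx[OF p(1) this]
    obtain q where q: "degree q = N" "coeff q N = 1" "\<And>j. coeff q j \<in> \<rat>"
      "\<And>z. z \<in> unit_circle \<Longrightarrow> \<bar>hom_poly N q (fst z) (snd z) - hom_poly N p (fst z) (snd z)\<bar> \<le> 2 * (1 / 300)"
      by metis
    have "\<bar>ell z i - hom_poly N q (fst z) (snd z)\<bar> \<le> 1 / 100" if z: "z \<in> unit_circle" for z
      using F(3)[OF z, of i] p(2)[OF z] q(4)[OF z] by linarith
    then show ?thesis using q by blast
  qed
  then obtain q where q: "\<And>i. i \<le> m \<Longrightarrow> degree (q i) = N" "\<And>i. i \<le> m \<Longrightarrow> coeff (q i) N = 1"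
     "\<And>i j. i \<le> m \<Longrightarrow> coeff (q i) j \<in> \<rat>"
     "\<And>i z. i \<le> m \<Longrightarrow> z \<in> unit_circle \<Longrightarrow> \<bar>ell z i - hom_poly N (q i) (fst z) (snd z)\<bar> \<le> 1 / 100"
    by metis
  define h where "h i = (if i \<le> m then q i else 0)" for i
  define M where "M = real m + 1"
  have M: "M > 0" by (simp add: M_def)
  have close: "cosq m (ell z) (rat_vec m N h (vec2 (fst z) (snd z))) \<ge> 4 / 5 \<and>
      rat_vec m N h (vec2 (fst z) (snd z)) \<noteq> (\<lambda>_. 0)" if z: "z \<in> unit_circle" for z
  proof -
    define w where "w = rat_vec m N h (vec2 (fst z) (snd z))"
    define d where "d = (\<lambda>i. ell z i - w i)"
    have uu: "ip m (ell z) (ell z) = M" using ell[OF z] by (simp add: M_def)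
    have "ip m d d \<le> (\<Sum>i\<le>m. (1 / 100)\<^sup>2)"
      unfolding ip_def
    proof (rule sum_mono)
      fix i assume "i \<in> {..m}"
      then have "\<bar>d i\<bar> \<le> 1 / 100" using q(4)[OF _ z] by (simp add: d_def w_def rat_vec_def h_def)
      then have "\<bar>d i\<bar>\<^sup>2 \<le> (1 / 100)\<^sup>2" by (rule power_mono) simp
      then show "d i * d i \<le> (1 / 100)\<^sup>2" by (simp add: power2_eq_square)
    qed
    then have dd: "ip m d d \<le> M / 10000" by (simp add: M_def power2_eq_square)
    have "(ip m (ell z) d)\<^sup>2 \<le> M * ip m d d" using Cauchy_Schwarz_ip[of m "ell z" d] uu by simp
    also have "\<dots> \<le> M * (M / 10000)" using dd M by (intro mult_left_mono) auto
    also have "\<dots> = (M / 100)\<^sup>2" by (simp add: power2_eq_square)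
    finally have ud: "\<bar>ip m (ell z) d\<bar> \<le> M / 100"
      using M by (metis abs_le_square_iff abs_of_pos divide_pos_pos zero_less_numeral)
    have w: "w = (\<lambda>i. ell z i - d i)" by (simp add: d_def)
    have uw: "ip m (ell z) w = M - ip m (ell z) d" unfolding w ip_diff uu by simp
    have ww: "ip m w w = M - 2 * ip m (ell z) d + ip m d d"
      unfolding w ip_diff uu by (simp add: ip_commute[of m d "ell z"])
    \<comment> \<open>The squared cosine is at least (99/100)^2 / (103/100), which exceeds
      4/5.\<close>
    have uw1: "ip m (ell z) w \<ge> 99 / 100 * M" using ud uw by linarith
    have ww1: "ip m w w \<le> 103 / 100 * M" using ud ww dd by linarith
    have ww0: "ip m w w > 0" using ud ww M ip_self_nonneg[of m d] by linarith
    have "4 / 5 * (M * ip m w w) \<le> 4 / 5 * (M * (103 / 100 * M))"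
      using ww1 M by (intro mult_left_mono) auto
    also have "\<dots> \<le> (99 / 100 * M)\<^sup>2" using M by (simp add: power2_eq_square)
    also have "\<dots> \<le> (ip m (ell z) w)\<^sup>2" using uw1 M by (intro power_mono) auto
    finally have "cosq m (ell z) w \<ge> 4 / 5" using ww0 M by (simp add: cosq_def uu field_simps)
    moreover have "w \<noteq> (\<lambda>_. 0)" using ww0 by (auto simp: ip_def)
    ultimately show ?thesis by (simp add: w_def)
  qed
  have rr: "real_rat m N h"
    unfolding real_rat_def
  proof (intro conjI allI impI)
    fix x
    have "vec2 x 1 \<in> topspace (nzvec 1)" by simp
    from polar_vec2[OF this] obtain r \<theta> where r: "r > 0" "vec2 x 1 = (\<lambda>i. r * vec2 (cos \<theta>) (sin \<theta>) i)"
      by metis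
    have "(cos \<theta>, sin \<theta>) \<in> unit_circle" by (simp add: unit_circle_def)
    from close[OF this] obtain i where "rat_vec m N h (vec2 (cos \<theta>) (sin \<theta>)) i \<noteq> 0" by auto
    then have "rat_vec m N h (vec2 x 1) i \<noteq> 0" using r by (simp add: rat_vec_scale)
    then show "\<exists>i\<le>m. poly (h i) x \<noteq> 0"
      using q(1) by (auto simp: rat_vec_def hom_poly_1 h_def split: if_splits)
  qed (use q in \<open>auto simp: h_def\<close>)
  show ?thesis
  proof (rule that[of N h])
    fix l assume "l \<in> topspace (RP 1)"
    then obtain z where z: "z \<in> unit_circle" "l = proj_class (vec2 (fst z) (snd z))"
      using unit_circle_RP1 by blast
    have "vec2 (fst z) (snd z) \<in> topspace (nzvec 1)" using z(1) by (auto simp: unit_circle_def)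
    then show "cosq_RP m (\<phi> l) (lift_map (rat_vec m N h) l) \<ge> 4 / 5"
      using close[OF z(1)] ell[OF z(1)] by (simp add: z(2) lift_map_proj_class[OF equivar_rat_vec])
  qed (use rr q(3) in \<open>auto simp: h_def\<close>)
qed

section \<open>Blending the approximations\<close>

text \<open>The lines of \<open>v\<close> and \<open>w\<close> lie within 30 degrees of the line of
  \<open>u\<close>. Their components along \<open>u\<close> dominate the orthogonal residuals
  \<open>v'\<close> and \<open>w'\<close>, so \<open>ip m v w\<close> has the sign of the product of
  these components. Each vector occurs twice, so the triple product is insensitive to changes of
  sign.\<close>

lemma ip_ip_ip_pos:
  assumes u: "u \<in> topspace (nzvec m)" and v: "v \<in> topspace (nzvec m)" and w: "w \<in> topspace (nzvec m)"
    and uv: "cosq m u v > 3 / 4" and uw: "cosq m u w > 3 / 4"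
  shows "ip m u v * ip m u w * ip m v w > 0"
proof -
  define a p q where "a = ip m u u" and "p = ip m u v" and "q = ip m u w"
  define v' w' where "v' = (\<lambda>i. v i - (p / a) * u i)" and "w' = (\<lambda>i. w i - (q / a) * u i)"
  have pos: "a > 0" "ip m v v > 0" "ip m w w > 0" using ip_self_pos u v w by (auto simp: a_def)
  have p2: "p\<^sup>2 / a > 3 / 4 * ip m v v" and q2: "q\<^sup>2 / a > 3 / 4 * ip m w w"
    using uv uw pos by (auto simp: cosq_def a_def p_def q_def field_simps)
  have "ip m v' v' = ip m v v - p\<^sup>2 / a" "ip m w' w' = ip m w w - q\<^sup>2 / a"
    unfolding v'_def w'_def ip_diff ip_scale ip_commute[of m v u] ip_commute[of m w u]
    using pos by (simp_all add: p_def[symmetric] q_def[symmetric] a_def[symmetric] power2_eq_square)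
  then have small: "ip m v' v' < 1 / 4 * ip m v v" "ip m w' w' < 1 / 4 * ip m w w"
    using p2 q2 by linarith+
  define X Y where "X = p * q / a" and "Y = ip m v' w'"
  have vw: "ip m v w = X + Y"
    unfolding X_def Y_def v'_def w'_def ip_diff ip_scale ip_commute[of m v u]
    using pos by (simp add: p_def[symmetric] q_def[symmetric] a_def[symmetric])
  have "Y\<^sup>2 \<le> ip m v' v' * ip m w' w'" unfolding Y_def by (rule Cauchy_Schwarz_ip)
  also have "\<dots> \<le> (1 / 4 * ip m v v) * (1 / 4 * ip m w w)"
    using small pos by (intro mult_mono) auto
  also have "\<dots> < (3 / 4 * ip m v v) * (3 / 4 * ip m w w)" using pos by simp
  also have "\<dots> \<le> (p\<^sup>2 / a) * (q\<^sup>2 / a)" using p2 q2 pos by (intro mult_mono) auto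
  also have "\<dots> = X\<^sup>2" by (simp add: X_def power2_eq_square)
  finally have "\<bar>Y\<bar> < \<bar>X\<bar>" using abs_le_square_iff by (metis not_le)
  then have "X * (X + Y) > 0" by (cases "X > 0") (auto simp: zero_less_mult_iff)
  then have "a * (X * (X + Y)) > 0" using pos by simp
  also have "a * (X * (X + Y)) = p * q * ip m v w" using pos vw by (simp add: X_def)
  finally show ?thesis by (simp add: p_def q_def)
qed

text \<open>On the unit circle the inner product has no zero, hence a constant sign, and replacing \<open>v\<close> by \<open>- v\<close>
  multiplies it by \<open>(- 1) ^ (N + n)\<close>.\<close>

lemma rat_vec_ip_pos:
  assumes f: "real_rat m N f" and h: "real_rat m n h"
    and nz: "\<And>v. v \<in> topspace (nzvec 1) \<Longrightarrow> ip m (rat_vec m N f v) (rat_vec m n h v) \<noteq> 0"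
  shows "even N \<longleftrightarrow> even n"
    and "\<And>v. v \<in> topspace (nzvec 1) \<Longrightarrow> ip m (rat_vec m N f v) (rat_vec m n h v) > 0"
proof -
  define S where "S v = ip m (rat_vec m N f v) (rat_vec m n h v)" for v
  have S_scale: "S (\<lambda>i. c * v i) = c ^ (N + n) * S v" for c v
    by (simp add: S_def rat_vec_scale power_add)
  define T where "T \<theta> = S (vec2 (cos \<theta>) (sin \<theta>))" for \<theta> :: real
  have contT: "continuous_on UNIV T"
    unfolding T_def S_def ip_def rat_vec_def hom_poly_def vec2_simps
    by (auto intro!: continuous_intros)
  \<comment> \<open>At infinity both vectors consist of ones.\<close>
  have T0: "T 0 > 0"
    by (simp add: T_def S_def rat_vec_infinity[OF f] rat_vec_infinity[OF h] ip_def)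
  have Tnz: "T \<theta> \<noteq> 0" for \<theta>
    unfolding T_def S_def by (rule nz, rule vec2_cos_sin_in)
  have Tpos: "T \<theta> > 0" if \<theta>: "\<theta> \<ge> 0" for \<theta>
  proof (rule ccontr)
    assume "\<not> T \<theta> > 0"
    then have "T \<theta> \<le> 0" by simp
    moreover have "continuous_on {0..\<theta>} T" using contT continuous_on_subset by blast
    ultimately obtain x where "T x = 0"
      using IVT2'[of T \<theta> 0 0] \<theta> T0 by (metis less_imp_le)
    then show False using Tnz by blast
  qed
  show pos: "ip m (rat_vec m N f v) (rat_vec m n h v) > 0" if v: "v \<in> topspace (nzvec 1)" for v
  proof -
    obtain r \<theta> where r: "r > 0" "0 \<le> \<theta>" "v = (\<lambda>i. r * vec2 (cos \<theta>) (sin \<theta>) i)"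
      using polar_vec2[OF v] by metis
    then have "S v = r ^ (N + n) * T \<theta>" by (simp add: S_scale T_def)
    then show ?thesis using Tpos[OF r(2)] r(1) by (simp add: S_def)
  qed
  have "vec2 (- 1) 0 = (\<lambda>i. - 1 * vec2 1 0 i)" by (auto simp: vec2_def)
  then have "S (vec2 (- 1) 0) = (- 1) ^ (N + n) * S (vec2 1 0)" using S_scale[of "-1" "vec2 1 0"] by simp
  moreover have "S (vec2 (- 1) 0) > 0" "S (vec2 1 0) > 0" unfolding S_def by (rule pos, simp)+
  ultimately show "even N \<longleftrightarrow> even n"
    by (cases "even (N + n)") auto
qed

text \<open>Vanishing beyond \<open>m\<close> makes every element a finite list of finite lists of
  rationals, hence the set countable.\<close>

definition rat_data :: "nat \<Rightarrow> (nat \<Rightarrow> real poly) set" where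
  "rat_data m = {f. (\<exists>N. real_rat m N f) \<and> (\<forall>i j. coeff (f i) j \<in> \<rat>) \<and> (\<forall>i>m. f i = 0)}"

lemma countable_rat_data: "countable (rat_data m)"
proof -
  define F where "F xs i = (if i < length xs then Poly (xs ! i) else 0)" for xs :: "real list list" and i
  have "rat_data m \<subseteq> F ` lists (lists \<rat>)"
  proof
    fix f assume f: "f \<in> rat_data m"
    define xs where "xs = map (\<lambda>i. coeffs (f i)) [0..<Suc m]"
    have "xs \<in> lists (lists \<rat>)"
      using f by (auto simp: xs_def rat_data_def coeffs_def)
    moreover have "f = F xs"
    proof
      fix i show "f i = F xs i"
        using f by (cases "i \<le> m") (auto simp: F_def xs_def rat_data_def less_Suc_eq_le simp del: upt_Suc)
    qed
    ultimately show "f \<in> F ` lists (lists \<rat>)" by blast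
  qed
  moreover have "countable (F ` lists (lists \<rat>))"
    by (intro countable_image countable_lists countable_rat)
  ultimately show ?thesis by (rule countable_subset)
qed

definition ratf :: "nat \<Rightarrow> nat \<Rightarrow> nat \<Rightarrow> real poly" where
  "ratf m k = from_nat_into (rat_data m) k"

definition ratd :: "nat \<Rightarrow> nat \<Rightarrow> nat" where
  "ratd m k = degree (ratf m k 0)"

lemma real_rat_ratf: "real_rat m (ratd m k) (ratf m k)"
proof -
  \<comment> \<open>The constant loop shows that the set is nonempty, so that
    \<open>from_nat_into\<close> returns members of it.\<close>
  have "(\<lambda>i. if i \<le> m then 1 else 0) \<in> rat_data m"
    unfolding rat_data_def by (auto simp: real_rat_def coeff_1 intro!: exI[of _ 0])
  then have "ratf m k \<in> rat_data m" unfolding ratf_def by (intro from_nat_into) blast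
  then obtain N where N: "real_rat m N (ratf m k)" unfolding rat_data_def by blast
  then have "N = ratd m k" using real_ratD(1)[OF N, of 0] by (simp add: ratd_def)
  then show ?thesis using N by simp
qed

lemma ratf_surj:
  assumes "real_rat m N h" "\<And>i j. coeff (h i) j \<in> \<rat>" "\<And>i. i > m \<Longrightarrow> h i = 0"
  obtains k where "ratf m k = h" "ratd m k = N"
proof -
  have "h \<in> rat_data m" using assms unfolding rat_data_def by blast
  then obtain k where "ratf m k = h" unfolding ratf_def
    using from_nat_into_surj[OF countable_rat_data] by blast
  moreover have "ratd m k = N" using real_ratD(1)[OF assms(1), of 0] calculation by (simp add: ratd_def)
  ultimately show ?thesis using that by blast
qed

definition rvec :: "nat \<Rightarrow> nat \<Rightarrow> (nat \<Rightarrow> real) \<Rightarrow> nat \<Rightarrow> real" where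
  "rvec m k = rat_vec m (ratd m k) (ratf m k)"

lemma rvec_in: "v \<in> topspace (nzvec 1) \<Longrightarrow> rvec m k v \<in> topspace (nzvec m)"
  unfolding rvec_def by (rule rat_vec_in[OF real_rat_ratf])

text \<open>With the threshold 3/4, lemma \<open>ip_ip_ip_pos\<close> makes any two loops close to a third one non-orthogonal.\<close>

definition closeness :: "nat \<Rightarrow> nat \<Rightarrow> ((nat \<Rightarrow> real) set \<Rightarrow> (nat \<Rightarrow> real) set) \<Rightarrow> real" where
  "closeness m k \<phi> = max 0 ((INF l\<in>topspace (RP 1). cosq_RP m (\<phi> l) (lift_map (rvec m k) l)) - 3 / 4)"

lemma closeness_nonneg: "closeness m k \<phi> \<ge> 0"
  by (simp add: closeness_def)

lemma bdd_below_cosq_RP: "bdd_below ((\<lambda>l. cosq_RP m (f l) (g l)) ` A)"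
  by (intro bdd_belowI[of _ 0]) (auto simp: cosq_RP_def cosq_nonneg)

lemma closeness_le_1: "closeness m k \<phi> \<le> 1"
proof -
  have "(INF l\<in>topspace (RP 1). cosq_RP m (\<phi> l) (lift_map (rvec m k) l)) \<le>
     cosq_RP m (\<phi> RP1_infinity) (lift_map (rvec m k) RP1_infinity)"
    by (intro cINF_lower bdd_below_cosq_RP) simp
  also have "\<dots> \<le> 1" by (simp add: cosq_RP_def cosq_le_1)
  finally show ?thesis by (simp add: closeness_def)
qed

lemma closeness_pos_cosq:
  assumes "closeness m k \<phi> > 0" "v \<in> topspace (nzvec 1)"
  shows "cosq_RP m (\<phi> (proj_class v)) (proj_class (rvec m k v)) > 3 / 4"
proof -
  have l: "proj_class v \<in> topspace (RP 1)" using assms(2) by (simp add: topspace_RP)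
  have "(INF l\<in>topspace (RP 1). cosq_RP m (\<phi> l) (lift_map (rvec m k) l)) > 3 / 4"
    using assms(1) by (auto simp: closeness_def max_def split: if_splits)
  also have "(INF l\<in>topspace (RP 1). cosq_RP m (\<phi> l) (lift_map (rvec m k) l)) \<le>
     cosq_RP m (\<phi> (proj_class v)) (lift_map (rvec m k) (proj_class v))"
    by (intro cINF_lower bdd_below_cosq_RP l)
  also have "lift_map (rvec m k) (proj_class v) = proj_class (rvec m k v)"
    unfolding rvec_def by (rule lift_map_proj_class[OF equivar_rat_vec assms(2)])
  finally show ?thesis .
qed

lemma continuous_map_closeness: "continuous_map (Omega_RP m) euclideanreal (closeness m k)"
proof -
  let ?Z = "prod_topology (Omega_RP m) (RP 1)"
  have h: "continuous_map (RP 1) (RP m) (lift_map (rvec m k))"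
    using lift_map_rat_vec_in[OF real_rat_ratf[of m k]]
    by (simp add: real_loops_def topspace_Omega flip: rvec_def)
  have "continuous_map ?Z (prod_topology (RP m) (RP m)) (\<lambda>p. (fst p (snd p), lift_map (rvec m k) (snd p)))"
    by (intro continuous_map_pairedI continuous_map_Omega_eval[OF continuous_map_fst continuous_map_snd]
         continuous_map_compose[OF continuous_map_snd h, unfolded o_def])
  from continuous_map_compose[OF this continuous_map_cosq_RP]
  have "continuous_map ?Z euclideanreal (\<lambda>(\<phi>, l). cosq_RP m (\<phi> l) (lift_map (rvec m k) l))"
    by (simp add: o_def case_prod_unfold)
  then have "continuous_map (Omega_RP m) euclideanreal
      (\<lambda>\<phi>. INF l\<in>topspace (RP 1). cosq_RP m (\<phi> l) (lift_map (rvec m k) l))"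
    by (rule continuous_map_INF_compact[OF _ compact_space_RP1])
       (use RP1_infinity_in in \<open>auto simp: cosq_RP_def cosq_nonneg\<close>)
  then show ?thesis
    unfolding closeness_def[abs_def]
    by (intro continuous_map_real_max continuous_map_diff) auto
qed

lemma closeness_pos_ex:
  assumes "\<phi> \<in> topspace (Omega_RP m)"
  shows "\<exists>k. closeness m k \<phi> > 0"
proof -
  obtain N h where h: "real_rat m N h" "\<And>i j. coeff (h i) j \<in> \<rat>" "\<And>i. i > m \<Longrightarrow> h i = 0"
    "\<And>l. l \<in> topspace (RP 1) \<Longrightarrow> cosq_RP m (\<phi> l) (lift_map (rat_vec m N h) l) \<ge> 4 / 5"
    using rational_loop_approx[OF assms] by metis
  obtain k where k: "ratf m k = h" "ratd m k = N" using ratf_surj[OF h(1-3)] by metis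
  have "(INF l\<in>topspace (RP 1). cosq_RP m (\<phi> l) (lift_map (rvec m k) l)) \<ge> 4 / 5"
    by (rule cINF_greatest) (use RP1_infinity_in h(4) in \<open>auto simp: rvec_def k\<close>)
  then show ?thesis by (intro exI[of _ k]) (auto simp: closeness_def)
qed

text \<open>Locally finite: if \<open>closeness m j\<close> exceeds \<open>e\<close> near a loop, then \<open>weight m k\<close> vanishes there for
  all \<open>k > j\<close> with \<open>k \<ge> 1 / e\<close>.\<close>

definition weight :: "nat \<Rightarrow> nat \<Rightarrow> ((nat \<Rightarrow> real) set \<Rightarrow> (nat \<Rightarrow> real) set) \<Rightarrow> real" where
  "weight m k \<phi> = max 0 (closeness m k \<phi> - real k * (\<Sum>j<k. closeness m j \<phi>))"

lemma weight_nonneg: "weight m k \<phi> \<ge> 0"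
  by (simp add: weight_def)

lemma weight_imp_closeness: "weight m k \<phi> \<noteq> 0 \<Longrightarrow> closeness m k \<phi> > 0"
proof -
  assume "weight m k \<phi> \<noteq> 0"
  moreover have "real k * (\<Sum>j<k. closeness m j \<phi>) \<ge> 0"
    by (intro mult_nonneg_nonneg sum_nonneg closeness_nonneg) auto
  ultimately show ?thesis by (auto simp: weight_def max_def split: if_splits)
qed

lemma continuous_map_weight: "continuous_map (Omega_RP m) euclideanreal (weight m k)"
  unfolding weight_def[abs_def]
  by (intro continuous_map_real_max continuous_map_diff continuous_map_real_mult continuous_map_sum
      continuous_map_closeness) auto

text \<open>At the first index of positive closeness nothing is subtracted.\<close>

lemma weight_pos_ex:
  assumes "\<phi> \<in> topspace (Omega_RP m)"
  shows "\<exists>k. weight m k \<phi> > 0"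
proof -
  define k where "k = (LEAST k. closeness m k \<phi> > 0)"
  have "closeness m k \<phi> > 0" unfolding k_def using closeness_pos_ex[OF assms] by (rule LeastI_ex)
  moreover have "closeness m j \<phi> = 0" if "j < k" for j
    using not_less_Least[of j "\<lambda>k. closeness m k \<phi> > 0"] that closeness_nonneg[of m j \<phi>] unfolding k_def by linarith
  ultimately have "weight m k \<phi> > 0" by (simp add: weight_def)
  then show ?thesis by blast
qed

text \<open>The index \<open>j\<close> is returned as well: its loop is close to every loop in
  \<open>U\<close>, and so it fixes the parity throughout \<open>U\<close>.\<close>

lemma weight_locally_finite:
  assumes "\<phi> \<in> topspace (Omega_RP m)"
  obtains U M j where "openin (Omega_RP m) U" "\<phi> \<in> U" "\<And>\<psi> k. \<psi> \<in> U \<Longrightarrow> k \<ge> M \<Longrightarrow> weight m k \<psi> = 0"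
    "\<And>\<psi>. \<psi> \<in> U \<Longrightarrow> closeness m j \<psi> > 0"
proof -
  obtain j where j: "closeness m j \<phi> > 0" using closeness_pos_ex[OF assms] by blast
  define e where "e = closeness m j \<phi> / 2"
  have e: "e > 0" "e < closeness m j \<phi>" using j by (auto simp: e_def)
  define U where "U = {\<psi> \<in> topspace (Omega_RP m). closeness m j \<psi> > e}"
  obtain M0 :: nat where M0: "1 / e < real M0" using reals_Archimedean2 by blast
  show ?thesis
  proof (rule that[of U "max M0 (Suc j)" j])
    show "openin (Omega_RP m) U"
      using continuous_map_closeness[of m j] unfolding U_def continuous_map_upper_lower_semicontinuous_lt by blast
    show "\<phi> \<in> U" using assms e by (simp add: U_def)
    show "closeness m j \<psi> > 0" if "\<psi> \<in> U" for \<psi> using that e by (auto simp: U_def)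
    show "weight m k \<psi> = 0" if \<psi>: "\<psi> \<in> U" and k: "k \<ge> max M0 (Suc j)" for \<psi> k
    proof -
      have "closeness m j \<psi> \<le> (\<Sum>i<k. closeness m i \<psi>)"
        using k by (intro member_le_sum) (auto simp: closeness_nonneg)
      then have "e \<le> (\<Sum>i<k. closeness m i \<psi>)" using \<psi> by (auto simp: U_def)
      moreover have "real k \<ge> 1 / e" using M0 k by linarith
      ultimately have "(1 / e) * e \<le> real k * (\<Sum>i<k. closeness m i \<psi>)"
        using e by (intro mult_mono) auto
      then have "1 \<le> real k * (\<Sum>i<k. closeness m i \<psi>)" using e by simp
      then show ?thesis using closeness_le_1[of m k \<psi>] by (simp add: weight_def)
    qed
  qed
qed

definition active :: "nat \<Rightarrow> ((nat \<Rightarrow> real) set \<Rightarrow> (nat \<Rightarrow> real) set) \<Rightarrow> nat set" where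
  "active m \<phi> = {k. weight m k \<phi> \<noteq> 0}"

lemma finite_active: "\<phi> \<in> topspace (Omega_RP m) \<Longrightarrow> finite (active m \<phi>)"
proof -
  assume "\<phi> \<in> topspace (Omega_RP m)"
  then obtain U M where "\<phi> \<in> U" "\<And>\<psi> k. \<psi> \<in> U \<Longrightarrow> k \<ge> M \<Longrightarrow> weight m k \<psi> = 0"
    by (metis weight_locally_finite)
  then have "active m \<phi> \<subseteq> {..<M}" by (force simp: active_def simp flip: not_le)
  then show ?thesis by (rule finite_subset) simp
qed

text \<open>By \<open>ip_ip_ip_pos\<close> the two rational loops are nowhere orthogonal, so by
  \<open>rat_vec_ip_pos\<close> their inner product is positive everywhere and can be cancelled from
  the triple product.\<close>

lemma close_pair:
  assumes \<phi>: "\<phi> \<in> topspace (Omega_RP m)" and k: "closeness m k \<phi> > 0" and l: "closeness m l \<phi> > 0"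
  shows "even (ratd m k) \<longleftrightarrow> even (ratd m l)"
    and "v \<in> topspace (nzvec 1) \<Longrightarrow>
       ip m (rep (\<phi> (proj_class v))) (rvec m k v) * ip m (rep (\<phi> (proj_class v))) (rvec m l v) > 0"
proof -
  have triple: "ip m (rep (\<phi> (proj_class v))) (rvec m k v) * ip m (rep (\<phi> (proj_class v))) (rvec m l v) *
      ip m (rvec m k v) (rvec m l v) > 0" if v: "v \<in> topspace (nzvec 1)" for v
  proof (rule ip_ip_ip_pos)
    have "\<phi> (proj_class v) \<in> topspace (RP m)"
      by (rule Omega_in_RP[OF \<phi>]) (use v in \<open>simp add: topspace_RP\<close>)
    note r = rep[OF this]
    show "rep (\<phi> (proj_class v)) \<in> topspace (nzvec m)" by (rule r)
    show "cosq m (rep (\<phi> (proj_class v))) (rvec m k v) > 3 / 4"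
      using closeness_pos_cosq[OF k v] r(2) cosq_RP_proj_class by metis
    show "cosq m (rep (\<phi> (proj_class v))) (rvec m l v) > 3 / 4"
      using closeness_pos_cosq[OF l v] r(2) cosq_RP_proj_class by metis
  qed (use rvec_in v in auto)
  have nz: "ip m (rvec m k v) (rvec m l v) \<noteq> 0" if v: "v \<in> topspace (nzvec 1)" for v
    using triple[OF v] by auto
  show "even (ratd m k) \<longleftrightarrow> even (ratd m l)"
    by (rule rat_vec_ip_pos(1)[OF real_rat_ratf real_rat_ratf], fold rvec_def, rule nz)
  have pos: "ip m (rvec m k v) (rvec m l v) > 0" if "v \<in> topspace (nzvec 1)" for v
    unfolding rvec_def
    by (rule rat_vec_ip_pos(2)[OF real_rat_ratf real_rat_ratf _ that], fold rvec_def, rule nz)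
  show "ip m (rep (\<phi> (proj_class v))) (rvec m k v) * ip m (rep (\<phi> (proj_class v))) (rvec m l v) > 0"
    if v: "v \<in> topspace (nzvec 1)"
    using triple[OF v] pos[OF v] by (simp add: zero_less_mult_iff)
qed

section \<open>The blended loop\<close>

definition nrm :: "(nat \<Rightarrow> real) \<Rightarrow> real" where
  "nrm v = sqrt ((v 0)\<^sup>2 + (v 1)\<^sup>2)"

lemma nrm_pos: "v \<in> topspace (nzvec 1) \<Longrightarrow> nrm v > 0"
  by (metis nrm_def nzvec_1_vec2 real_sqrt_gt_0_iff sum_power2_gt_zero_iff vec2_in)

lemma nrm_scale: "nrm (\<lambda>i. c * v i) = \<bar>c\<bar> * nrm v"
  by (simp add: nrm_def power_mult_distrib real_sqrt_mult flip: distrib_left)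

text \<open>Division by powers of the norm reduces summands of different degrees to homogeneity 0 up
  to sign, so that they can be added.\<close>

definition blend_vec :: "nat \<Rightarrow> ((nat \<Rightarrow> real) set \<Rightarrow> (nat \<Rightarrow> real) set) \<Rightarrow> (nat \<Rightarrow> real) \<Rightarrow> nat \<Rightarrow> real" where
  "blend_vec m \<phi> v = (\<lambda>i. \<Sum>k\<in>active m \<phi>. weight m k \<phi> / nrm v ^ ratd m k * rvec m k v i)"

definition blend where
  "blend m \<phi> = lift_map (blend_vec m \<phi>)"

text \<open>By \<open>close_pair\<close> all close rational loops have the same parity. It selects
  the summand of \<open>rat_infinity\<close> that receives the blend.\<close>

definition loop_odd :: "nat \<Rightarrow> ((nat \<Rightarrow> real) set \<Rightarrow> (nat \<Rightarrow> real) set) \<Rightarrow> bool" where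
  "loop_odd m \<phi> \<longleftrightarrow> (\<exists>k. closeness m k \<phi> > 0 \<and> odd (ratd m k))"

lemma loop_odd_iff:
  assumes "\<phi> \<in> topspace (Omega_RP m)" "closeness m k \<phi> > 0"
  shows "loop_odd m \<phi> \<longleftrightarrow> odd (ratd m k)"
  using close_pair(1)[OF assms(1)] assms(2) unfolding loop_odd_def by blast

text \<open>All active degrees have the same parity, so a negative scalar changes the sign of all
  summands or of none.\<close>

lemma equivar_blend_vec:
  assumes \<phi>: "\<phi> \<in> topspace (Omega_RP m)"
  shows "equivar (blend_vec m \<phi>)"
  unfolding equivar_def
proof (intro ballI allI impI)
  fix v and c :: real assume v: "v \<in> topspace (nzvec 1)" and c: "c \<noteq> 0"
  define d where "d = (if loop_odd m \<phi> then sgn c else 1)"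
  have "weight m k \<phi> / nrm (\<lambda>i. c * v i) ^ ratd m k * rvec m k (\<lambda>i. c * v i) i =
      d * (weight m k \<phi> / nrm v ^ ratd m k * rvec m k v i)" if k: "k \<in> active m \<phi>" for k i
  proof -
    have odd: "loop_odd m \<phi> \<longleftrightarrow> odd (ratd m k)"
      using loop_odd_iff[OF \<phi>] weight_imp_closeness k by (simp add: active_def)
    have "c ^ ratd m k = d * \<bar>c\<bar> ^ ratd m k"
      by (cases "c > 0"; cases "odd (ratd m k)") (use odd c in \<open>auto simp: d_def\<close>)
    then show ?thesis
      using c by (simp add: rvec_def rat_vec_scale nrm_scale power_mult_distrib)
  qed
  then have "blend_vec m \<phi> (\<lambda>i. c * v i) = (\<lambda>i. d * blend_vec m \<phi> v i)"
    by (auto simp: blend_vec_def sum_distrib_left)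
  moreover have "d \<noteq> 0" using c by (auto simp: d_def sgn_zero_iff)
  ultimately show "\<exists>d. d \<noteq> 0 \<and> blend_vec m \<phi> (\<lambda>i. c * v i) = (\<lambda>i. d * blend_vec m \<phi> v i)" by blast
qed

text \<open>The sign of the inner products with \<open>rep (\<phi> (proj_class v))\<close> depends
  on the representative, but it is common to all active indices; the factor of one active index
  \<open>l\<close> makes every summand positive.\<close>

lemma blend_vec_ip:
  assumes \<phi>: "\<phi> \<in> topspace (Omega_RP m)" and v: "v \<in> topspace (nzvec 1)"
  shows "ip m (blend_vec m \<phi> v) (rep (\<phi> (proj_class v))) \<noteq> 0"
proof -
  let ?u = "rep (\<phi> (proj_class v))"
  obtain l where l: "weight m l \<phi> > 0" using weight_pos_ex[OF \<phi>] by blast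
  then have la: "l \<in> active m \<phi>" by (simp add: active_def)
  have "ip m (blend_vec m \<phi> v) ?u * ip m ?u (rvec m l v) =
     (\<Sum>k\<in>active m \<phi>. weight m k \<phi> / nrm v ^ ratd m k * (ip m ?u (rvec m k v) * ip m ?u (rvec m l v)))"
    unfolding blend_vec_def ip_sum ip_scale sum_distrib_right
    by (intro sum.cong) (simp_all add: ip_commute[of m _ ?u] mult_ac)
  also have "\<dots> > 0"
  proof (rule sum_pos)
    show "finite (active m \<phi>)" by (rule finite_active[OF \<phi>])
    fix k assume k: "k \<in> active m \<phi>"
    then have "weight m k \<phi> > 0" using weight_nonneg[of m k \<phi>] by (simp add: active_def)
    moreover have "ip m ?u (rvec m k v) * ip m ?u (rvec m l v) > 0"
      using close_pair(2)[OF \<phi> _ _ v] k la weight_imp_closeness by (simp add: active_def)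
    ultimately show "weight m k \<phi> / nrm v ^ ratd m k * (ip m ?u (rvec m k v) * ip m ?u (rvec m l v)) > 0"
      by (intro mult_pos_pos[OF divide_pos_pos[OF _ zero_less_power[OF nrm_pos[OF v]]]])
  qed (use la in blast)
  finally show ?thesis by auto
qed

lemma blend_vec_in:
  assumes \<phi>: "\<phi> \<in> topspace (Omega_RP m)" and v: "v \<in> topspace (nzvec 1)"
  shows "blend_vec m \<phi> v \<in> topspace (nzvec m)"
proof -
  have "blend_vec m \<phi> v \<noteq> (\<lambda>_. 0)" using blend_vec_ip[OF assms] by (auto simp: ip_def)
  then show ?thesis by (auto simp: topspace_nzvec blend_vec_def rvec_def rat_vec_def)
qed

lemma blend_nonorth:
  assumes \<phi>: "\<phi> \<in> topspace (Omega_RP m)"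
  shows "nonorth_maps m (blend m \<phi>) \<phi>"
  unfolding nonorth_maps_def
proof
  fix l assume l: "l \<in> topspace (RP 1)"
  then obtain v where v: "v \<in> topspace (nzvec 1)" "l = proj_class v" by (auto simp: topspace_RP)
  have "nonorth m (proj_class (blend_vec m \<phi> v)) (proj_class (rep (\<phi> l)))"
    using blend_vec_ip[OF \<phi> v(1)] v(2) by simp
  moreover have "blend m \<phi> l = proj_class (blend_vec m \<phi> v)"
    by (simp add: blend_def v(2) lift_map_proj_class[OF equivar_blend_vec[OF \<phi>] v(1)])
  ultimately show "nonorth m (blend m \<phi> l) (\<phi> l)"
    by (simp only: rep(2)[OF Omega_in_RP[OF \<phi> l]])
qed

section \<open>The homotopy equivalence\<close>

text \<open>Supplies everything that is local about the blend: near each loop it is continuous, of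
  one degree \<open>N\<close>, and \<open>N\<close> has the parity \<open>loop_odd\<close>.\<close>

lemma blend_local:
  assumes \<phi>0: "\<phi>0 \<in> topspace (Omega_RP m)"
  obtains U N where "openin (Omega_RP m) U" "\<phi>0 \<in> U"
    "continuous_map (subtopology (Omega_RP m) U) (Omega_RP m) (blend m)"
    "\<forall>\<phi>\<in>U. blend m \<phi> \<in> real_loops N m" "\<forall>\<phi>\<in>U. loop_odd m \<phi> \<longleftrightarrow> odd N"
proof -
  obtain U M j where U: "openin (Omega_RP m) U" "\<phi>0 \<in> U"
    and M: "\<And>\<psi> k. \<psi> \<in> U \<Longrightarrow> k \<ge> M \<Longrightarrow> weight m k \<psi> = 0"
    and j: "\<And>\<psi>. \<psi> \<in> U \<Longrightarrow> closeness m j \<psi> > 0"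
    using weight_locally_finite[OF \<phi>0] by metis
  have UO: "\<phi> \<in> topspace (Omega_RP m)" if "\<phi> \<in> U" for \<phi> using openin_subset[OF U(1)] that by blast
  \<comment> \<open>Bounds all degrees that can be active on \<open>U\<close> and shares their
    common parity.\<close>
  define N where "N = 2 * (\<Sum>k<M. ratd m k) + (if odd (ratd m j) then 1 else 0)"
  have odd: "loop_odd m \<phi> \<longleftrightarrow> odd N" if "\<phi> \<in> U" for \<phi>
    using loop_odd_iff[OF UO[OF that] j[OF that]] by (simp add: N_def)
  have act: "k < M" "ratd m k \<le> N" "even (N - ratd m k)" if "\<phi> \<in> U" "k \<in> active m \<phi>" for k \<phi>
  proof -
    show k: "k < M" using M[of \<phi> k] that by (force simp: active_def simp flip: not_le)
    have "ratd m k \<le> (\<Sum>k<M. ratd m k)" using k by (intro member_le_sum) auto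
    then show le: "ratd m k \<le> N" by (simp add: N_def)
    have "closeness m k \<phi> > 0" using that(2) weight_imp_closeness by (simp add: active_def)
    then have "odd (ratd m k) \<longleftrightarrow> odd N"
      using odd[OF that(1)] loop_odd_iff[OF UO[OF that(1)]] by blast
    then show "even (N - ratd m k)" using le by simp
  qed
  \<comment> \<open>The set \<open>active m \<phi>\<close> varies with \<open>\<phi>\<close>;
    continuity is read off from the sum over a fixed range.\<close>
  have blend_U: "blend_vec m \<phi> v = (\<lambda>i. \<Sum>k<M. weight m k \<phi> / nrm v ^ ratd m k * rvec m k v i)" if "\<phi> \<in> U" for \<phi> v
    unfolding blend_vec_def
    by (intro ext sum.mono_neutral_left) (use act(1)[OF that] in \<open>auto simp: active_def\<close>)
  define sw where "sw \<phi> = (\<Sum>k\<in>active m \<phi>. weight m k \<phi>)" for \<phi>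
  have sw: "sw \<phi> > 0" if "\<phi> \<in> U" for \<phi>
    unfolding sw_def
  proof (rule sum_pos)
    show "active m \<phi> \<noteq> {}" using weight_pos_ex[OF UO[OF that]] by (force simp: active_def)
    show "weight m k \<phi> > 0" if "k \<in> active m \<phi>" for k
      using that weight_nonneg[of m k \<phi>] by (simp add: active_def)
  qed (rule finite_active[OF UO[OF that]])
  have blend_inf: "blend_vec m \<phi> (vec2 1 0) = (\<lambda>i. sw \<phi> * (if i \<le> m then 1 else 0))" for \<phi>
    by (auto simp: blend_vec_def nrm_def rvec_def rat_vec_infinity[OF real_rat_ratf] sw_def sum_distrib_left fun_eq_iff)
  have cont: "continuous_map (subtopology (Omega_RP m) U) (Omega_RP m) (blend m)"
    unfolding blend_def[abs_def]
  proof (rule continuous_map_lift_map)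
    let ?Z = "prod_topology (subtopology (Omega_RP m) U) (nzvec 1)"
    have w: "continuous_map ?Z euclideanreal (\<lambda>p. weight m k (fst p))" for k
      by (intro continuous_map_compose[OF continuous_map_fst, unfolded o_def]
          continuous_map_from_subtopology continuous_map_weight)
    have n: "continuous_map ?Z euclideanreal (\<lambda>p. nrm (snd p))"
      unfolding nrm_def
      by (intro continuous_map_sqrt continuous_map_add continuous_map_real_pow continuous_map_coord_snd)
    have r: "continuous_map ?Z euclideanreal (\<lambda>p. rvec m k (snd p) i)" for k i
      unfolding rvec_def rat_vec_def
      by (cases "i \<le> m") (auto intro!: continuous_map_hom_poly continuous_map_coord_snd)
    fix i
    have "continuous_map ?Z euclideanreal (\<lambda>p. \<Sum>k<M. weight m k (fst p) / nrm (snd p) ^ ratd m k * rvec m k (snd p) i)"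
      by (intro continuous_map_sum continuous_map_real_mult continuous_map_real_divide continuous_map_real_pow w n r)
         (use nrm_pos in force)+
    then show "continuous_map ?Z euclideanreal (\<lambda>p. blend_vec m (fst p) (snd p) i)"
      by (rule continuous_map_eq) (auto simp: blend_U)
  next
    fix \<phi> assume "\<phi> \<in> topspace (subtopology (Omega_RP m) U)"
    then have \<phi>: "\<phi> \<in> U" by simp
    show "equivar (blend_vec m \<phi>)" by (rule equivar_blend_vec[OF UO[OF \<phi>]])
    show "proj_class (blend_vec m \<phi> (vec2 1 0)) = hpoint m (\<lambda>_. 1)"
      unfolding blend_inf hpoint_1_proj using sw[OF \<phi>] by (intro proj_class_scale) simp
    show "blend_vec m \<phi> v \<in> topspace (nzvec m)" if "v \<in> topspace (nzvec 1)" for v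
      by (rule blend_vec_in[OF UO[OF \<phi>] that])
  qed
  have "blend m \<phi> \<in> real_loops N m" if \<phi>: "\<phi> \<in> U" for \<phi>
  proof -
    \<comment> \<open>Multiplication by \<open>nrm (vec2 x 1) ^ N\<close> leaves powers of the norm
      with even exponent \<open>N - ratd m k\<close>, that is, powers of \<open>[:1, 0, 1:]\<close>.
      The factor \<open>1 / sw \<phi>\<close> makes the result monic.\<close>
    define s where "s i = smult (1 / sw \<phi>) (\<Sum>k\<in>active m \<phi>.
        smult (weight m k \<phi>) (ratf m k i * [:1, 0, 1:] ^ ((N - ratd m k) div 2)))" for i
    have pw: "degree ([:1, 0, 1 :: real:] ^ e) = 2 * e" "coeff ([:1, 0, 1 :: real:] ^ e) (2 * e) = 1" for e
    proof -
      show d: "degree ([:1, 0, 1 :: real:] ^ e) = 2 * e" by (simp add: degree_power_eq)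
      have "lead_coeff ([:1, 0, 1 :: real:] ^ e) = 1" by (simp add: lead_coeff_power)
      then show "coeff ([:1, 0, 1 :: real:] ^ e) (2 * e) = 1" by (simp only: d)
    qed
    have tm: "degree (ratf m k i * [:1, 0, 1:] ^ ((N - ratd m k) div 2)) \<le> N"
       "coeff (ratf m k i * [:1, 0, 1:] ^ ((N - ratd m k) div 2)) N = 1"
      if i: "i \<le> m" and k: "k \<in> active m \<phi>" for i k
    proof -
      have e: "N = ratd m k + 2 * ((N - ratd m k) div 2)" using act[OF \<phi> k] by simp
      note d = real_ratD[OF real_rat_ratf[of m k] i]
      show "degree (ratf m k i * [:1, 0, 1:] ^ ((N - ratd m k) div 2)) \<le> N"
        using degree_mult_le[of "ratf m k i" "[:1, 0, 1:] ^ ((N - ratd m k) div 2)"] d(1) pw(1) e by simp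
      have "coeff (ratf m k i * [:1, 0, 1:] ^ ((N - ratd m k) div 2)) (ratd m k + 2 * ((N - ratd m k) div 2)) = 1"
        by (subst coeff_mult_top) (simp_all add: d pw)
      then show "coeff (ratf m k i * [:1, 0, 1:] ^ ((N - ratd m k) div 2)) N = 1" using e by simp
    qed
    have monic: "degree (s i) = N \<and> lead_coeff (s i) = 1" if i: "i \<le> m" for i
    proof (rule monicI)
      show "degree (s i) \<le> N"
        unfolding s_def
        by (intro order_trans[OF degree_smult_le] degree_sum_le finite_active[OF UO[OF \<phi>]] tm(1)[OF i])
      show "coeff (s i) N = 1"
        using sw[OF \<phi>] tm(2)[OF i] by (simp add: s_def coeff_sum sw_def)
    qed
    have key: "(\<lambda>i. if i \<le> m then poly (s i) x else 0) = (\<lambda>i. (nrm (vec2 x 1) ^ N / sw \<phi>) * blend_vec m \<phi> (vec2 x 1) i)" for x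
    proof
      fix i
      define r where "r = nrm (vec2 x 1)"
      have r: "r > 0" unfolding r_def by (rule nrm_pos) simp
      have r2: "r\<^sup>2 = x\<^sup>2 + 1" by (simp add: r_def nrm_def)
      show "(if i \<le> m then poly (s i) x else 0) = (nrm (vec2 x 1) ^ N / sw \<phi>) * blend_vec m \<phi> (vec2 x 1) i"
      proof (cases "i \<le> m")
        case True
        have "poly (ratf m k i * [:1, 0, 1:] ^ ((N - ratd m k) div 2)) x = r ^ N / r ^ ratd m k * rvec m k (vec2 x 1) i"
          if k: "k \<in> active m \<phi>" for k
        proof -
          have "poly [:1, 0, 1:] x = r\<^sup>2" unfolding r2 by (simp add: power2_eq_square)
          then have "poly ([:1, 0, 1:] ^ ((N - ratd m k) div 2)) x = (r\<^sup>2) ^ ((N - ratd m k) div 2)"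
            by (simp only: poly_power)
          also have "\<dots> = r ^ (N - ratd m k)" using act(3)[OF \<phi> k] by (simp flip: power_mult)
          also have "\<dots> = r ^ N / r ^ ratd m k" using act(2)[OF \<phi> k] r by (simp add: power_diff)
          finally show ?thesis using True by (simp add: rvec_def rat_vec_real[OF real_rat_ratf])
        qed
        then show ?thesis
          using True by (simp add: s_def blend_vec_def poly_sum sum_distrib_left r_def[symmetric] mult_ac cong: sum.cong)
      next
        case False
        then show ?thesis by (simp add: blend_vec_def rvec_def rat_vec_def)
      qed
    qed
    have nz: "nrm (vec2 x 1) ^ N / sw \<phi> \<noteq> 0" for x
      using nrm_pos[of "vec2 x 1"] sw[OF \<phi>] by simp
    have "real_rat m N s"
      unfolding real_rat_def
    proof (intro conjI allI impI)
      fix x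
      have "blend_vec m \<phi> (vec2 x 1) \<in> topspace (nzvec m)" by (rule blend_vec_in[OF UO[OF \<phi>]]) simp
      then obtain i where "blend_vec m \<phi> (vec2 x 1) i \<noteq> 0" by (auto simp: topspace_nzvec)
      then have "(if i \<le> m then poly (s i) x else 0) \<noteq> 0"
        using fun_cong[OF key[of x], of i] nz[of x] by (metis mult_eq_0_iff)
      then show "\<exists>i\<le>m. poly (s i) x \<noteq> 0" by (auto split: if_splits)
    qed (use monic in blast)+
    moreover have "blend m \<phi> (RP1_real x) = hpoint m (\<lambda>i. poly (s i) x)" for x
      unfolding hpoint_def key proj_class_scale[OF nz] blend_def RP1_real_vec2
      by (rule lift_map_proj_class[OF equivar_blend_vec[OF UO[OF \<phi>]]]) simp
    moreover have "blend m \<phi> \<in> topspace (Omega_RP m)"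
      using continuous_map_image_subset_topspace[OF cont] \<phi> UO[OF \<phi>] by auto
    ultimately show ?thesis unfolding real_loops_def by blast
  qed
  then show ?thesis using that[OF U cont] odd by blast
qed

lemma continuous_map_blend: "continuous_map (Omega_RP m) (Omega_RP m) (blend m)"
proof (rule continuous_map_locally)
  fix \<phi> assume "\<phi> \<in> topspace (Omega_RP m)"
  from blend_local[OF this] obtain U N where "openin (Omega_RP m) U" "\<phi> \<in> U"
    "continuous_map (subtopology (Omega_RP m) U) (Omega_RP m) (blend m)"
    "\<forall>\<phi>\<in>U. blend m \<phi> \<in> real_loops N m" "\<forall>\<phi>\<in>U. loop_odd m \<phi> \<longleftrightarrow> odd N" .
  then show "\<exists>U. openin (Omega_RP m) U \<and> \<phi> \<in> U \<and> continuous_map (subtopology (Omega_RP m) U) (Omega_RP m) (blend m)"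
    by blast
qed

lemma blend_in: "\<phi> \<in> topspace (Omega_RP m) \<Longrightarrow> blend m \<phi> \<in> topspace (Omega_RP m)"
  using continuous_map_image_subset_topspace[OF continuous_map_blend] by blast

text \<open>The parity \<open>loop_odd\<close> is locally constant, so it may be computed at a
  nearby member of \<open>RRat n m\<close>, which is nowhere orthogonal to the rational loops close
  to it. It ensures that \<open>g\<close> leads back to the summand a point came from.\<close>

lemma loop_odd_rat:
  assumes "\<phi> \<in> topspace (rat n m)"
  shows "loop_odd m \<phi> \<longleftrightarrow> odd n"
proof -
  have \<phi>: "\<phi> \<in> topspace (Omega_RP m)" "\<phi> \<in> Omega_RP m closure_of RRat n m"
    using assms closure_of_subset_topspace by (auto simp: rat_def)
  obtain U N where U: "openin (Omega_RP m) U" "\<phi> \<in> U"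
    "continuous_map (subtopology (Omega_RP m) U) (Omega_RP m) (blend m)"
    "\<forall>\<phi>\<in>U. blend m \<phi> \<in> real_loops N m" "\<forall>\<phi>\<in>U. loop_odd m \<phi> \<longleftrightarrow> odd N"
    using blend_local[OF \<phi>(1)] .
  obtain \<psi> where \<psi>: "\<psi> \<in> U" "\<psi> \<in> RRat n m" using \<phi>(2) U(1,2) unfolding in_closure_of by metis
  then have "\<psi> \<in> real_loops n m" using RRat_subset_real_loops by blast
  then obtain f where f: "\<psi> \<in> topspace (Omega_RP m)" "real_rat m n f" "\<psi> = lift_map (rat_vec m n f)"
    using real_loops_lift_map unfolding real_loops_def by blast
  obtain k where k: "closeness m k \<psi> > 0" using closeness_pos_ex[OF f(1)] by blast
  have "even n \<longleftrightarrow> even (ratd m k)"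
  proof (rule rat_vec_ip_pos(1)[OF f(2) real_rat_ratf])
    fix v assume v: "v \<in> topspace (nzvec 1)"
    have "cosq m (rat_vec m n f v) (rvec m k v) > 3 / 4"
      using closeness_pos_cosq[OF k v] by (simp add: f(3) lift_map_proj_class[OF equivar_rat_vec v])
    then show "ip m (rat_vec m n f v) (rat_vec m (ratd m k) (ratf m k) v) \<noteq> 0"
      by (auto simp: cosq_def rvec_def)
  qed
  then show ?thesis using loop_odd_iff[OF f(1) k] U(2,5) \<psi>(1) by blast
qed

text \<open>Presents the two limits and their disjoint union as a single quotient of all stages,
  tagged by parity.\<close>

lemma quotient_map_rat_infinity:
  "quotient_map (sum_topology (\<lambda>n. rat n m) UNIV) (rat_infinity m) (\<lambda>(n, \<phi>). (odd n, \<phi>))"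
proof -
  have ts: "topspace (rat_infinity m) = {(b, \<phi>). \<exists>n. odd n = b \<and> \<phi> \<in> topspace (rat n m)}"
    by (auto simp: rat_infinity_def rat_odd_def rat_ev_def split: if_splits)
  have op_b: "openin (if b then rat_odd m else rat_ev m) W \<longleftrightarrow>
      W \<subseteq> (\<Union>n\<in>{n. odd n = b}. topspace (rat n m)) \<and>
      (\<forall>n. odd n = b \<longrightarrow> openin (rat n m) (topspace (rat n m) \<inter> W))" for b W
    by (cases b) (simp_all add: rat_odd_def rat_ev_def openin_direct_limit)
  have op: "openin (rat_infinity m) V \<longleftrightarrow>
      (\<forall>n. openin (rat n m) (topspace (rat n m) \<inter> {\<phi>. (odd n, \<phi>) \<in> V}))" if "V \<subseteq> topspace (rat_infinity m)" for V
  proof -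
    have "V \<subseteq> Sigma UNIV (topspace \<circ> (\<lambda>b. if b then rat_odd m else rat_ev m))"
      using that by (simp add: rat_infinity_def)
    moreover have "{x. (b, x) \<in> V} \<subseteq> (\<Union>n\<in>{n. odd n = b}. topspace (rat n m))" for b
    proof
      fix x assume "x \<in> {x. (b, x) \<in> V}"
      then have "(b, x) \<in> topspace (rat_infinity m)" using that by blast
      then show "x \<in> (\<Union>n\<in>{n. odd n = b}. topspace (rat n m))" unfolding ts by auto
    qed
    ultimately show ?thesis
      unfolding rat_infinity_def openin_sum_topology op_b by simp
  qed
  show ?thesis
    unfolding quotient_map_def
  proof (intro conjI allI impI)
    show "(\<lambda>(n, \<phi>). (odd n, \<phi>)) ` topspace (sum_topology (\<lambda>n. rat n m) UNIV) = topspace (rat_infinity m)"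
      unfolding ts by force
    fix V assume V: "V \<subseteq> topspace (rat_infinity m)"
    have "{\<phi>. (n, \<phi>) \<in> {x \<in> topspace (sum_topology (\<lambda>n. rat n m) UNIV). (case x of (n, \<phi>) \<Rightarrow> (odd n, \<phi>)) \<in> V}} =
       topspace (rat n m) \<inter> {\<phi>. (odd n, \<phi>) \<in> V}" for n by auto
    then show "openin (sum_topology (\<lambda>n. rat n m) UNIV)
        {x \<in> topspace (sum_topology (\<lambda>n. rat n m) UNIV). (case x of (n, \<phi>) \<Rightarrow> (odd n, \<phi>)) \<in> V} =
        openin (rat_infinity m) V"
      unfolding op[OF V] openin_sum_topology by auto
  qed
qed

lemma homotopicI:
  assumes "continuous_map (prod_topology (top_of_set {0..1::real}) X) Y h"
    and "\<And>x. x \<in> topspace X \<Longrightarrow> h (0, x) = p x" "\<And>x. x \<in> topspace X \<Longrightarrow> h (1, x) = q x"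
  shows "homotopic_with (\<lambda>_. True) X Y p q"
proof (rule iffD2[OF homotopic_with])
  show "\<exists>h. continuous_map (prod_topology (top_of_set {0..1::real}) X) Y h \<and>
     (\<forall>x\<in>topspace X. h (0, x) = p x) \<and> (\<forall>x\<in>topspace X. h (1, x) = q x) \<and> (\<forall>t\<in>{0..1::real}. True)"
    by (intro exI[of _ h]) (use assms in auto)
qed simp

lemma topspace_rat_infinity:
  "x \<in> topspace (rat_infinity m) \<longleftrightarrow> (\<exists>n \<phi>. x = (odd n, \<phi>) \<and> \<phi> \<in> topspace (rat n m))"
  unfolding quotient_imp_surjective_map[OF quotient_map_rat_infinity, symmetric] by force

text \<open>Each stage has the subspace topology and maps continuously to the limit, so continuity
  into the loop space suffices as long as the stage is locally fixed.\<close>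

lemma continuous_map_into_rat_infinity:
  assumes "\<And>z. z \<in> topspace Z \<Longrightarrow> \<exists>U N. openin Z U \<and> z \<in> U \<and>
     continuous_map (subtopology Z U) (Omega_RP m) f \<and> (\<forall>y\<in>U. g y = (odd N, f y) \<and> f y \<in> topspace (rat N m))"
  shows "continuous_map Z (rat_infinity m) g"
proof (rule continuous_map_locally)
  fix z assume "z \<in> topspace Z"
  from assms[OF this] obtain U N where U: "openin Z U" "z \<in> U" "continuous_map (subtopology Z U) (Omega_RP m) f"
     "\<forall>y\<in>U. g y = (odd N, f y) \<and> f y \<in> topspace (rat N m)" by blast
  have "continuous_map (subtopology Z U) (rat N m) f"
    unfolding rat_def continuous_map_in_subtopology using U(3,4) by (auto simp: topspace_rat)
  moreover have "continuous_map (rat N m) (rat_infinity m) (\<lambda>\<phi>. (odd N, \<phi>))"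
    using continuous_map_compose[OF continuous_map_component_injection[of N UNIV "\<lambda>n. rat n m"]
        quotient_imp_continuous_map[OF quotient_map_rat_infinity]]
    by (simp add: o_def)
  ultimately have "continuous_map (subtopology Z U) (rat_infinity m) (\<lambda>y. (odd N, f y))"
    using continuous_map_compose by (fastforce simp: o_def)
  then have "continuous_map (subtopology Z U) (rat_infinity m) g"
    by (rule continuous_map_eq) (use U(4) in auto)
  then show "\<exists>U. openin Z U \<and> z \<in> U \<and> continuous_map (subtopology Z U) (rat_infinity m) g"
    using U(1,2) by blast
qed

theorem proposition4p1:
  fixes m :: nat
  assumes "m \<ge> 1"
  shows "homotopy_equivalence (rat_infinity m) (Omega_RP m) rat_inclusion"
proof -
  let ?X = "rat_infinity m" and ?Y = "Omega_RP m" and ?S = "sum_topology (\<lambda>n. rat n m) UNIV"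
  let ?I = "top_of_set {0..1::real}"
  define q where "q = (\<lambda>(n :: nat, \<phi> :: (nat \<Rightarrow> real) set \<Rightarrow> (nat \<Rightarrow> real) set). (odd n, \<phi>))"
  have q: "quotient_map ?S ?X q" unfolding q_def by (rule quotient_map_rat_infinity)
  have rat_Y: "\<phi> \<in> topspace ?Y" if "\<phi> \<in> topspace (rat n m)" for \<phi> n
    using that by (simp add: rat_def)
  have snd_S: "continuous_map ?S ?Y snd"
    unfolding continuous_map_def
  proof (intro conjI allI impI)
    fix V assume "openin ?Y V"
    then have V: "openin (rat n m) (topspace (rat n m) \<inter> V)" for n
      by (auto simp: rat_def openin_subtopology Int_commute Int_left_commute)
    have "{x. (n, x) \<in> {x \<in> topspace ?S. snd x \<in> V}} = topspace (rat n m) \<inter> V" for n by auto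
    with V show "openin ?S {x \<in> topspace ?S. snd x \<in> V}"
      unfolding openin_sum_topology by auto
  qed (auto dest: rat_Y)
  have incl: "continuous_map ?X ?Y rat_inclusion"
    by (rule continuous_compose_quotient_map[OF q])
       (use snd_S in \<open>simp add: rat_inclusion_def q_def o_def case_prod_unfold\<close>)
  define g where "g \<phi> = (loop_odd m \<phi>, blend m \<phi>)" for \<phi>
  have g: "continuous_map ?Y ?X g"
  proof (rule continuous_map_into_rat_infinity[where f = "blend m"])
    fix \<phi> assume "\<phi> \<in> topspace ?Y"
    from blend_local[OF this] obtain U N where U: "openin ?Y U" "\<phi> \<in> U"
      "continuous_map (subtopology ?Y U) ?Y (blend m)"
      "\<forall>\<phi>\<in>U. blend m \<phi> \<in> real_loops N m" "\<forall>\<phi>\<in>U. loop_odd m \<phi> \<longleftrightarrow> odd N" .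
    then show "\<exists>U N. openin ?Y U \<and> \<phi> \<in> U \<and> continuous_map (subtopology ?Y U) ?Y (blend m) \<and>
      (\<forall>y\<in>U. g y = (odd N, blend m y) \<and> blend m y \<in> topspace (rat N m))"
      using real_loops_subset_closure[OF assms, of N] unfolding topspace_rat g_def
      by (intro exI[of _ U] exI[of _ N]) auto
  qed
  have nonorth: "nonorth m (blend m \<phi> l) (\<phi> l)" if "\<phi> \<in> topspace ?Y" "l \<in> topspace (RP 1)" for \<phi> l
    using blend_nonorth[OF that(1)] that(2) by (simp add: nonorth_maps_def)
  have seg_cont: "continuous_map Z ?Y (\<lambda>z. seg_map m (t z) (blend m (\<phi> z)) (\<phi> z))"
    if "continuous_map Z euclideanreal t" "continuous_map Z ?Y \<phi>" for Z :: "'z topology" and t \<phi>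
  proof (rule continuous_map_seg_map[OF that(1) _ that(2)])
    show "continuous_map Z ?Y (\<lambda>z. blend m (\<phi> z))"
      using continuous_map_compose[OF that(2) continuous_map_blend] by (simp add: o_def)
    show "nonorth m (blend m (\<phi> z) x) (\<phi> z x)" if "z \<in> topspace Z" "x \<in> topspace (RP 1)" for z x
      using nonorth continuous_map_image_subset_topspace[OF \<open>continuous_map Z ?Y \<phi>\<close>] that by blast
  qed
  have seg0: "seg_map m 0 (blend m \<phi>) \<phi> = blend m \<phi>" and seg1: "seg_map m 1 (blend m \<phi>) \<phi> = \<phi>"
    if "\<phi> \<in> topspace ?Y" for \<phi>
    using seg_map_0[OF blend_in that] seg_map_1[OF blend_in that] nonorth that by auto
  \<comment> \<open>The tag can stay fixed because the segment has degree \<open>2 * N + n\<close>,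
    of the same parity as \<open>n\<close>.\<close>
  define H where "H = (\<lambda>(t, b :: bool, \<phi>). (b, seg_map m t (blend m \<phi>) \<phi>))"
  have "homotopic_with (\<lambda>_. True) ?Y ?Y (rat_inclusion \<circ> g) id"
  proof (rule homotopicI[where h = "\<lambda>p. seg_map m (fst p) (blend m (snd p)) (snd p)"])
    show "continuous_map (prod_topology ?I ?Y) ?Y (\<lambda>p. seg_map m (fst p) (blend m (snd p)) (snd p))"
      by (intro seg_cont continuous_map_into_fulltopology[OF continuous_map_fst] continuous_map_snd)
  qed (simp_all add: seg0 seg1 rat_inclusion_def g_def)
  moreover have "homotopic_with (\<lambda>_. True) ?X ?X (g \<circ> rat_inclusion) id"
  proof (rule homotopicI[where h = H])
    \<comment> \<open>The product with the locally compact interval preserves the quotient map, so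
      \<open>H\<close> may be tested on the stages.\<close>
    have "quotient_map (prod_topology ?I ?S) (prod_topology ?I ?X) (\<lambda>(t, x). (t, q x))"
      by (rule quotient_map_prod_right[OF _ _ q])
         (auto simp: Hausdorff_space_subtopology intro!: compact_imp_locally_compact_space compact_space_subtopology)
    moreover have "continuous_map (prod_topology ?I ?S) ?X (H \<circ> (\<lambda>(t, x). (t, q x)))"
    proof (rule continuous_map_into_rat_infinity[where f = "\<lambda>p. seg_map m (fst p) (blend m (snd (snd p))) (snd (snd p))"])
      fix z assume z: "z \<in> topspace (prod_topology ?I ?S)"
      then obtain t n \<phi> where z_eq: "z = (t, n, \<phi>)" and t: "t \<in> {0..1}" and \<phi>: "\<phi> \<in> topspace (rat n m)"
        by auto
      from blend_local[OF rat_Y[OF \<phi>]] obtain U N where U: "openin ?Y U" "\<phi> \<in> U"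
        "continuous_map (subtopology ?Y U) ?Y (blend m)"
        "\<forall>\<phi>\<in>U. blend m \<phi> \<in> real_loops N m" "\<forall>\<phi>\<in>U. loop_odd m \<phi> \<longleftrightarrow> odd N" .
      \<comment> \<open>On \<open>V\<close> both the stage \<open>n\<close> and the degree
        \<open>N\<close> of the blend are fixed, so the whole homotopy stays in stage
        \<open>2 * N + n\<close>.\<close>
      define V where "V = topspace ?I \<times> Pair n ` (topspace (rat n m) \<inter> U)"
      have "openin (rat n m) (topspace (rat n m) \<inter> U)"
        using U(1) by (auto simp: rat_def openin_subtopology Int_commute Int_left_commute)
      then have "openin ?S (Pair n ` (topspace (rat n m) \<inter> U))"
        using open_map_component_injection[of n UNIV "\<lambda>n. rat n m"] unfolding open_map_def by blast
      then have "openin (prod_topology ?I ?S) V"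
        unfolding V_def by (simp add: openin_prod_Times_iff)
      moreover have "z \<in> V" using t \<phi> U(2) by (auto simp: z_eq V_def)
      moreover have "continuous_map (subtopology (prod_topology ?I ?S) V) ?Y
          (\<lambda>p. seg_map m (fst p) (blend m (snd (snd p))) (snd (snd p)))"
        by (intro seg_cont continuous_map_from_subtopology continuous_map_into_fulltopology[OF continuous_map_fst]
            continuous_map_compose[OF continuous_map_snd snd_S, unfolded o_def])
      moreover have "(H \<circ> (\<lambda>(t, x). (t, q x))) y = (odd (2 * N + n), seg_map m (fst y) (blend m (snd (snd y))) (snd (snd y))) \<and>
          seg_map m (fst y) (blend m (snd (snd y))) (snd (snd y)) \<in> topspace (rat (2 * N + n) m)" if yV: "y \<in> V" for y
      proof -
        obtain t \<psi> where y: "y = (t, n, \<psi>)" "\<psi> \<in> topspace (rat n m)" "\<psi> \<in> U"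
          using yV by (auto simp: V_def)
        have "seg_map m t (blend m \<psi>) \<psi> \<in> topspace (rat (2 * N + n) m)"
          by (rule seg_map_rat[OF assms bspec[OF U(4) y(3)] y(2) blend_nonorth[OF rat_Y[OF y(2)]]])
        then show ?thesis by (simp add: y(1) H_def q_def)
      qed
      ultimately show "\<exists>V N. openin (prod_topology ?I ?S) V \<and> z \<in> V \<and>
         continuous_map (subtopology (prod_topology ?I ?S) V) ?Y
           (\<lambda>p. seg_map m (fst p) (blend m (snd (snd p))) (snd (snd p))) \<and>
         (\<forall>y\<in>V. (H \<circ> (\<lambda>(t, x). (t, q x))) y = (odd N, seg_map m (fst y) (blend m (snd (snd y))) (snd (snd y))) \<and>
           seg_map m (fst y) (blend m (snd (snd y))) (snd (snd y)) \<in> topspace (rat N m))"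
        by blast
    qed
    ultimately show "continuous_map (prod_topology ?I ?X) ?X H"
      by (rule continuous_compose_quotient_map)
    fix x assume "x \<in> topspace ?X"
    then obtain n \<phi> where x: "x = (odd n, \<phi>)" "\<phi> \<in> topspace (rat n m)"
      unfolding topspace_rat_infinity by blast
    show "H (0, x) = (g \<circ> rat_inclusion) x"
      using seg0[OF rat_Y[OF x(2)]] loop_odd_rat[OF x(2)] by (simp add: x(1) H_def g_def rat_inclusion_def)
    show "H (1, x) = id x"
      using seg1[OF rat_Y[OF x(2)]] by (simp add: x(1) H_def)
  qed
  ultimately show ?thesis
    unfolding homotopy_equivalence_def using incl g by blast
qed

end
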